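(* Let $\mathrm{Z}$ be a densely defined linear operator in a Banach space $\mathbf{X}$ and let $t>0$. Assume that there exists a function $\mathrm{F}\in\mathcal{F}_{\mathbf{X}}$ such that: (i) $\mathcal{D}(\mathrm{F}'(0))\supset\mathcal{D}(\mathrm{Z})$ and $\mathrm{F}'(0)f=\mathrm{Z}f$ for $f\in\mathcal{D}(\mathrm{Z})$. (ii) $\mathcal{D}({\mathrm{F}^*}'(0))$ is weak-$*$ dense in $\mathbf{X}^*$. Then $\mathrm{Z}$ is closable and its closure is a generator of a $C_0$-semigroup if and only if there exists a dense linear subspace $\mathbf{A}\subseteq\mathcal{D}(\mathrm{Z})$ (dense in $\mathbf{X}$) such that for all $f\in\mathbf{A}$, $s\ge 0$ there exists a sequence $\{f_n^s\}_{n=1}^\infty$, $f_n^s\in\mathcal{D}(\mathrm{Z})$, satisfying the following conditions: (a) $\lim_{n\to\infty}\|\mathrm{F}(t/n)^{[ns]}f-f_n^s\|=0$; (b) every subsequence of $\{\mathrm{Z}f_n^s\}_{n\in\mathbb{N}}$ has a weakly convergent subsequence; (c) every subsequence of $\{f_n^s\}_{n\in\mathbb{N}}$ has a weakly convergent subsequence.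
   Context: $\mathcal{L}(\mathbf{E})$ is the space of bounded linear operators on a Banach space $\mathbf{E}$ (over $\mathbb{R}$ or $\mathbb{C}$). For $\mathrm{S}:[0,\infty)\to\mathcal{L}(\mathbf{E})$, the (strong) derivative at $0$ is the linear operator $\mathrm{S}'(0)\psi=\lim_{h\to 0}h^{-1}(\mathrm{S}(h)\psi-\mathrm{S}(0)\psi)$ (norm limit, $h>0$), whose domain $\mathcal{D}(\mathrm{S}'(0))$ is the set of all $\psi\in\mathbf{E}$ for which the limit exists. For $\mathrm{F}:[0,\infty)\to\mathcal{L}(\mathbf{X})$, $\mathrm{F}^*$ is the function $s\mapsto(\mathrm{F}(s))^*\in\mathcal{L}(\mathbf{X}^* )$, and ${\mathrm{F}^*}'(0)$ is its strong derivative at $0$ (norm of $\mathbf{X}^*$). $\mathcal{F}_{\mathbf{X}}$ is the set of all functions $\mathrm{F}:[0,\infty)\to\mathcal{L}(\mathbf{X})$ such that $\mathrm{F}(0)=\mathrm{I}$, there exist $M\ge 1$, $a\in\mathbb{R}$ with $\|\mathrm{F}(s/n)^m\|\le M\exp(\frac{am}{n}s)$ for all $n,m\in\mathbb{N}$, $s\ge 0$, and $\mathcal{D}(\mathrm{F}'(0))$ is dense in $\mathbf{X}$. The function $\mathrm{F}$ in (a) is the one given by the assumption. $[x]$ is the integer part of $x$. *)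

theory Defs
  imports "HOL-Analysis.Analysis"
begin

text \<open>
  A class with exactly the two models \<open>\<real>\<close> and \<open>\<complex>\<close> (up to isomorphism), so that Banach spaces over
  both fields are treated at once.
\<close>

class real_or_complex = real_normed_field +
  assumes real_or_complex:
    "(\<forall>z. \<exists>a. z = a *\<^sub>R 1) \<or>
     (\<exists>j. j * j = - 1 \<and> (\<forall>z. \<exists>a b. z = a *\<^sub>R 1 + b *\<^sub>R j))"

instance real :: real_or_complex
  by standard auto

instance complex :: real_or_complex
proof
  have "\<i> * \<i> = - 1" by simp
  moreover have "\<exists>a b. z = a *\<^sub>R 1 + b *\<^sub>R \<i>" for z :: complex
    by (rule exI[of _ "Re z"], rule exI[of _ "Im z"]) (simp add: complex_eq_iff)
  ultimately show "(\<forall>z::complex. \<exists>a. z = a *\<^sub>R 1) \<or>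
     (\<exists>j::complex. j * j = - 1 \<and> (\<forall>z. \<exists>a b. z = a *\<^sub>R 1 + b *\<^sub>R j))"
    by blast
qed

text \<open>
  The type class \<open>banach\<close> only provides real scalars; the locale adds a scalar multiplication by
  \<open>'k\<close> that extends the real one and makes the given norm a norm over \<open>'k\<close>.
\<close>

locale banach_over = vector_space smul
  for smul :: "'k::real_or_complex \<Rightarrow> 'a::banach \<Rightarrow> 'a" +
  assumes norm_smul: "norm (smul c x) = norm c * norm x"
    and smul_of_real: "smul (of_real r) x = r *\<^sub>R x"

lemma banach_over_scaleR: "banach_over ((*\<^sub>R) :: real \<Rightarrow> 'a::banach \<Rightarrow> 'a)"
  by unfold_locales (auto simp: algebra_simps)

lemma banach_over_complex: "banach_over ((*) :: complex \<Rightarrow> complex \<Rightarrow> complex)"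
  by unfold_locales (auto simp: algebra_simps norm_mult scaleR_conv_of_real)

text \<open>Elements of \<open>'a \<Rightarrow>\<^sub>L 'b\<close> are only real-linear; \<open>'k\<close>-linearity is imposed here.\<close>

definition bounded_ops ::
    "('k \<Rightarrow> 'a \<Rightarrow> 'a) \<Rightarrow> ('a::real_normed_vector \<Rightarrow>\<^sub>L 'a) set" where
  "bounded_ops smul = {T. \<forall>c x. blinfun_apply T (smul c x) = smul c (blinfun_apply T x)}"

definition dual_space ::
    "('k \<Rightarrow> 'a \<Rightarrow> 'a) \<Rightarrow> ('a::real_normed_vector \<Rightarrow>\<^sub>L 'k::real_normed_field) set" where
  "dual_space smul = {\<phi>. \<forall>c x. blinfun_apply \<phi> (smul c x) = c * blinfun_apply \<phi> x}"

definition weak_star_topology ::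
    "('k \<Rightarrow> 'a \<Rightarrow> 'a) \<Rightarrow> ('a::real_normed_vector \<Rightarrow>\<^sub>L 'k::real_normed_field) topology" where
  "weak_star_topology smul =
     pullback_topology (dual_space smul) blinfun_apply (product_topology (\<lambda>_. euclidean) UNIV)"

definition weakly_convergent ::
    "('k::real_normed_field \<Rightarrow> 'a \<Rightarrow> 'a) \<Rightarrow> (nat \<Rightarrow> 'a::real_normed_vector) \<Rightarrow> bool" where
  "weakly_convergent smul u \<longleftrightarrow>
     (\<exists>x. \<forall>\<phi>\<in>dual_space smul. (\<lambda>n. blinfun_apply \<phi> (u n)) \<longlonglongrightarrow> blinfun_apply \<phi> x)"

definition every_subseq_has_weakly_convergent_subseq ::
    "('k::real_normed_field \<Rightarrow> 'a \<Rightarrow> 'a) \<Rightarrow> (nat \<Rightarrow> 'a::real_normed_vector) \<Rightarrow> bool" where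
  "every_subseq_has_weakly_convergent_subseq smul u \<longleftrightarrow>
     (\<forall>p. strict_mono (p :: nat \<Rightarrow> nat) \<longrightarrow>
        (\<exists>q. strict_mono (q :: nat \<Rightarrow> nat) \<and> weakly_convergent smul (u \<circ> p \<circ> q)))"

definition adjoint_op :: "('a::real_normed_vector \<Rightarrow>\<^sub>L 'a) \<Rightarrow>
    ('a \<Rightarrow>\<^sub>L 'b::real_normed_vector) \<Rightarrow>\<^sub>L ('a \<Rightarrow>\<^sub>L 'b)" where
  "adjoint_op T = Blinfun (\<lambda>\<phi>. \<phi> o\<^sub>L T)"

lemma adjoint_op_apply [simp]: "blinfun_apply (adjoint_op T) \<phi> = \<phi> o\<^sub>L T"
  unfolding adjoint_op_def
  by (simp add: bounded_linear_Blinfun_apply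
      bounded_bilinear.bounded_linear_left[OF bounded_bilinear_blinfun_compose])

definition blinfun_pow :: "('a::real_normed_vector \<Rightarrow>\<^sub>L 'a) \<Rightarrow> nat \<Rightarrow> 'a \<Rightarrow>\<^sub>L 'a" where
  "blinfun_pow T m = ((o\<^sub>L) T ^^ m) id_blinfun"

text \<open>
  An unbounded operator is a partial map \<open>Z :: 'a \<rightharpoonup> 'a\<close> with domain \<open>dom Z\<close>.
\<close>

definition linear_operator ::
    "('k \<Rightarrow> 'a \<Rightarrow> 'a) \<Rightarrow> ('a::ab_group_add \<rightharpoonup> 'a) \<Rightarrow> bool" where
  "linear_operator smul Z \<longleftrightarrow>
     0 \<in> dom Z \<and>
     (\<forall>f g u v. Z f = Some u \<longrightarrow> Z g = Some v \<longrightarrow> Z (f + g) = Some (u + v)) \<and>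
     (\<forall>c f u. Z f = Some u \<longrightarrow> Z (smul c f) = Some (smul c u))"

definition closable :: "('a::topological_space \<rightharpoonup> 'a) \<Rightarrow> bool" where
  "closable Z \<longleftrightarrow> single_valued (closure (Map.graph Z))"

definition closure_op :: "('a::topological_space \<rightharpoonup> 'a) \<Rightarrow> ('a \<rightharpoonup> 'a)" where
  "closure_op Z f =
     (if f \<in> Domain (closure (Map.graph Z))
      then Some (THE g. (f, g) \<in> closure (Map.graph Z)) else None)"

text \<open>
  The strong derivative at 0 of a function \<open>S\<close> with values in the operators on the Banach space
  \<open>E\<close>. The carrier \<open>E\<close> is a set because the dual over \<open>'k\<close> is a closed subspace of the type of
  all bounded real-linear maps.
\<close>

definition strong_deriv0 ::
    "'e::real_normed_vector set \<Rightarrow> (real \<Rightarrow> 'e \<Rightarrow>\<^sub>L 'e) \<Rightarrow> 'e \<rightharpoonup> 'e" where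
  "strong_deriv0 E S \<psi> =
     (let D = (\<lambda>h. (1 / h) *\<^sub>R (S h \<psi> - S 0 \<psi>))
      in if \<psi> \<in> E \<and> (\<exists>l\<in>E. (D \<longlongrightarrow> l) (at_right 0)) then Some (Lim (at_right 0) D) else None)"

definition C0_semigroup ::
    "('k \<Rightarrow> 'a \<Rightarrow> 'a) \<Rightarrow> (real \<Rightarrow> 'a::real_normed_vector \<Rightarrow>\<^sub>L 'a) \<Rightarrow> bool" where
  "C0_semigroup smul T \<longleftrightarrow>
     (\<forall>s\<ge>0. T s \<in> bounded_ops smul) \<and>
     T 0 = id_blinfun \<and>
     (\<forall>s\<ge>0. \<forall>r\<ge>0. T (s + r) = T s o\<^sub>L T r) \<and>
     (\<forall>f. continuous_on {0..} (\<lambda>s. T s f))"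

definition is_generator :: "('k \<Rightarrow> 'a \<Rightarrow> 'a) \<Rightarrow> ('a::real_normed_vector \<rightharpoonup> 'a) \<Rightarrow> bool" where
  "is_generator smul A \<longleftrightarrow> (\<exists>T. C0_semigroup smul T \<and> A = strong_deriv0 UNIV T)"

text \<open>
  The set \<open>\<F>\<^sub>X\<close>. Functions on \<open>[0, \<infinity>)\<close> are total functions on \<open>real\<close> whose values at negative
  arguments are never used.
\<close>

definition chernoff_functions ::
    "('k \<Rightarrow> 'a \<Rightarrow> 'a) \<Rightarrow> (real \<Rightarrow> 'a::real_normed_vector \<Rightarrow>\<^sub>L 'a) set" where
  "chernoff_functions smul =
     {F. (\<forall>s\<ge>0. F s \<in> bounded_ops smul) \<and>
         F 0 = id_blinfun \<and>
         (\<exists>M a. M \<ge> 1 \<and>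
            (\<forall>n\<ge>1. \<forall>m\<ge>1. \<forall>s\<ge>0.
               norm (blinfun_pow (F (s / real n)) m) \<le> M * exp (a * real m / real n * s))) \<and>
         closure (dom (strong_deriv0 UNIV F)) = UNIV}"

end

(* A Chernoff function F gives bounded operators A_n = (F(t/n) - I)/(t/n) with uniformly stable
   resolvents.  If (l - Z) has dense range for all large l, these resolvents converge strongly.  For
   fixed n the powers of F(t/n) and of the scaled resolvent commute, and their difference on vectors
   R_n R_n g is controlled by the step lengths alone, so the powers F(t/n)^[s n/t] themselves converge;
   the limit is a C0-semigroup and its generator is the closure of Z.  This replaces the
   Hille-Yosida and Trotter-Kato theorems.

   If the closure of Z generates a semigroup, truncated Laplace transforms of its orbits show that the
   range is dense, and conditions (a)-(c) hold on A = D(Z) because the limits stay in the domain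
   of the closure.

   Conversely, let psi annihilate the range of l - Z and let f be in A.  The vectors
   F(t/n)^[n s] Z f - Z f_n^s are relatively weakly compact (approximate Z f by elements of A) and tend
   to 0 when tested against the weak-* dense set D(F*'(0)), hence weakly.  So psi(F(t/n)^k f) satisfies
   the discretised equation p' = l p up to an error that tends to 0 pointwise; since it grows more
   slowly than exp(l s), dominated convergence gives psi f = 0, and psi = 0 by density of A. *)
theory Submission
  imports Defs "HOL-Library.Diagonal_Subsequence"
begin

section \<open>Separating functionals\<close>

text \<open>A direct Cauchy argument for the powers fails because \<open>A n (A n f)\<close> need
  not stay bounded for a fixed \<open>f\<close> in the domain. Second-order expansions are therefore
  made only at \<open>Res n l (Res n l g)\<close>, where
  \<open>A n (Res n l x) = l *\<^sub>R Res n l x - x\<close> keeps two applications of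
  \<open>A n\<close> bounded. The comparison process consists of a fixed number of factors
  \<open>Res n l\<close>, so strong convergence of each factor suffices.

  In the converse the approximants vary with \<open>n\<close>, and strong convergence of
  \<open>A n\<close> to \<open>Z\<close> says nothing at moving vectors. For \<open>\<phi>\<close>
  in the domain of the adjoint derivative, however, \<open>\<phi>\<close> composed with
  \<open>A n\<close> converges in norm, to a functional that agrees with \<open>\<phi>\<close>
  composed with \<open>Z\<close>. Condition (c) enters because \<open>Z f\<close> need not lie in
  the given subspace: with (a) it makes the powers applied to \<open>f\<close> weakly compact, and
  density and stability carry this over to the powers applied to \<open>Z f\<close>. The
  subsequences in (b) and (c) depend on \<open>s\<close>; they serve to find the limit of the whole
  sequence at one \<open>s\<close>, and only afterwards is \<open>s\<close> integrated out.\<close>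

definition sublinear :: "('a::real_vector \<Rightarrow> real) \<Rightarrow> bool" where
  "sublinear p \<longleftrightarrow> (\<forall>x y. p (x + y) \<le> p x + p y) \<and> (\<forall>c x. 0 \<le> c \<longrightarrow> p (c *\<^sub>R x) = c * p x)"

lemma sublinear_add: "sublinear p \<Longrightarrow> p (x + y) \<le> p x + p y"
  and sublinear_scale: "sublinear p \<Longrightarrow> 0 \<le> c \<Longrightarrow> p (c *\<^sub>R x) = c * p x"
  by (auto simp: sublinear_def)

lemma sublinear_zero: "sublinear p \<Longrightarrow> p 0 = 0"
  using sublinear_scale[of p 0 0] by simp

lemma sublinear_minus: "sublinear p \<Longrightarrow> - p (- x) \<le> p x"
  using sublinear_add[of p x "- x"] sublinear_zero[of p] by simp

lemma cInf_scale:
  fixes S :: "real set"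
  assumes "S \<noteq> {}" "bdd_below S" "c > 0"
  shows "Inf ((*) c ` S) = c * Inf S"
proof (rule antisym)
  have b: "bdd_below ((*) c ` S)"
  proof -
    obtain m where "\<And>x. x \<in> S \<Longrightarrow> m \<le> x" using assms(2) by (auto simp: bdd_below_def)
    then show ?thesis using assms(3) by (intro bdd_belowI2[of _ "c * m"]) (simp add: mult_left_mono)
  qed
  show "c * Inf S \<le> Inf ((*) c ` S)"
    by (rule cInf_greatest) (use assms in \<open>auto intro: cInf_lower mult_left_mono\<close>)
  have "Inf ((*) c ` S) / c \<le> Inf S"
  proof (rule cInf_greatest[OF assms(1)])
    fix x assume "x \<in> S"
    then have "Inf ((*) c ` S) \<le> c * x" by (intro cInf_lower b) auto
    then show "Inf ((*) c ` S) / c \<le> x" using assms(3) by (simp add: field_simps)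
  qed
  then show "Inf ((*) c ` S) \<le> c * Inf S" using assms(3) by (simp add: field_simps)
qed

text \<open>The descent step of Hahn-Banach. If \<open>p\<close> is minimal, then
  \<open>q = p\<close> and the last bound becomes superadditivity; at \<open>x = - y\<close> the
  last bound gives \<open>q (- y) \<le> - p y\<close>, so every linear functional below
  \<open>q\<close> takes the value \<open>p y\<close> at \<open>y\<close>.\<close>

lemma sublinear_descend:
  fixes p :: "'a::real_vector \<Rightarrow> real" and y :: 'a
  assumes p: "sublinear p"
  defines "q \<equiv> \<lambda>x. INF s\<in>{0..}. p (x + s *\<^sub>R y) - s * p y"
  shows "sublinear q" "q x \<le> p x" "q x \<le> p (x + y) - p y"
proof -
  \<comment> \<open>This bound is free of \<open>s\<close>, so the infimum is over a set bounded
    below.\<close>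
  have low: "- p (- x) \<le> p (x + s *\<^sub>R y) - s * p y" if "s \<ge> 0" for s x
    using sublinear_add[OF p, of "x + s *\<^sub>R y" "- x"] sublinear_scale[OF p that, of y] by simp
  then have bdd: "bdd_below ((\<lambda>s. p (x + s *\<^sub>R y) - s * p y) ` {0..})" for x
    by (auto intro!: bdd_belowI2)
  have le: "q x \<le> p (x + s *\<^sub>R y) - s * p y" if "s \<ge> 0" for s x
    unfolding q_def using that by (intro cINF_lower bdd) auto
  show "q x \<le> p x" using le[of 0 x] by simp
  show "q x \<le> p (x + y) - p y" using le[of 1 x] by simp
  have ge: "B \<le> q x" if "\<And>s. s \<ge> 0 \<Longrightarrow> B \<le> p (x + s *\<^sub>R y) - s * p y" for B x
    unfolding q_def by (rule cINF_greatest) (use that in auto)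
  have add: "q (x + z) \<le> q x + q z" for x z
  proof -
    \<comment> \<open>The parameters \<open>s\<close> for \<open>x\<close> and \<open>r\<close> for
      \<open>z\<close> merge into \<open>s + r\<close> for \<open>x + z\<close>; the two infima are
      then taken one at a time.\<close>
    have "q (x + z) - (p (z + r *\<^sub>R y) - r * p y) \<le> p (x + s *\<^sub>R y) - s * p y"
      if "s \<ge> 0" "r \<ge> 0" for s r
      using le[of "s + r" "x + z"] sublinear_add[OF p, of "x + s *\<^sub>R y" "z + r *\<^sub>R y"] that
      by (simp add: algebra_simps)
    then have "q (x + z) - (p (z + r *\<^sub>R y) - r * p y) \<le> q x" if "r \<ge> 0" for r
      using ge that by blast
    then have "q (x + z) - q x \<le> p (z + r *\<^sub>R y) - r * p y" if "r \<ge> 0" for r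
      using that by (simp add: algebra_simps)
    then have "q (x + z) - q x \<le> q z" by (rule ge)
    then show ?thesis by simp
  qed
  have scale: "q (c *\<^sub>R x) = c * q x" if c: "c > 0" for c x
  proof -
    have "(\<lambda>s. p (c *\<^sub>R x + s *\<^sub>R y) - s * p y) ` {0..}
      = (*) c ` (\<lambda>s. p (x + s *\<^sub>R y) - s * p y) ` {0..}" (is "?f ` _ = (*) c ` ?g ` _")
    proof -
      have eq: "?f (c * s) = c * ?g s" if "s \<ge> 0" for s
        using sublinear_scale[OF p, of c "x + s *\<^sub>R y"] c by (simp add: algebra_simps)
      have "{0..} = (*) c ` {0::real..}"
      proof (intro set_eqI iffI)
        fix u :: real assume "u \<in> {0..}"
        then show "u \<in> (*) c ` {0..}" using c by (intro image_eqI[of _ _ "u / c"]) auto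
      qed (use c in auto)
      then have "?f ` {0..} = ?f ` (*) c ` {0..}" by simp
      also have "\<dots> = (*) c ` ?g ` {0..}"
        unfolding image_image by (intro image_cong refl) (use eq in auto)
      finally show ?thesis .
    qed
    then show ?thesis
      unfolding q_def using bdd c by (simp add: cInf_scale)
  qed
  have "q 0 = 0"
  proof (rule antisym)
    show "q 0 \<le> 0" using le[of 0 0] sublinear_zero[OF p] by simp
    show "0 \<le> q 0" by (rule ge) (simp add: sublinear_scale[OF p])
  qed
  then show "sublinear q"
    unfolding sublinear_def using add scale by (auto simp: less_eq_real_def)
qed

text \<open>Minimality means that the descent along any \<open>y\<close> returns \<open>q\<close>,
  which turns its last bound into superadditivity. Additivity makes \<open>q\<close> odd, and this
  extends homogeneity to negative scalars.\<close>

lemma sublinear_minimal_linear: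
  fixes q :: "'a::real_vector \<Rightarrow> real"
  assumes q: "sublinear q"
    and min: "\<And>r. sublinear r \<Longrightarrow> (\<And>x. r x \<le> q x) \<Longrightarrow> r = q"
  shows "linear q"
proof -
  have sup: "q x + q y \<le> q (x + y)" for x y
  proof -
    have "(\<lambda>x. INF s\<in>{0..}. q (x + s *\<^sub>R y) - s * q y) = q"
      by (rule min) (rule sublinear_descend[OF q])+
    then show ?thesis using sublinear_descend(3)[OF q, of x y] by (simp add: fun_eq_iff)
  qed
  then have add: "q (x + y) = q x + q y" for x y
    using sublinear_add[OF q, of x y] by (simp add: antisym)
  have neg: "q (- x) = - q x" for x
    using add[of x "- x"] sublinear_zero[OF q] by simp
  have "q (c *\<^sub>R x) = c * q x" for c x
  proof (cases "c \<ge> 0")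
    case False
    then show ?thesis using sublinear_scale[OF q, of "- c" x] neg[of "c *\<^sub>R x"] by simp
  qed (simp add: sublinear_scale[OF q])
  then show ?thesis by (intro linearI) (auto simp: add)
qed

text \<open>Supplies the bounds of chains for Zorn's lemma. The common upper bound \<open>p\<close>
  also bounds the chain below, by \<open>- p (- x)\<close>. For subadditivity, the two members
  tested at \<open>x\<close> and at \<open>y\<close> are replaced by the smaller of them.\<close>

lemma sublinear_INF_chain:
  fixes C :: "('a::real_vector \<Rightarrow> real) set"
  assumes ne: "C \<noteq> {}" and sub: "\<And>q. q \<in> C \<Longrightarrow> sublinear q"
    and le: "\<And>q x. q \<in> C \<Longrightarrow> q x \<le> p x"
    and chain: "\<And>q r. q \<in> C \<Longrightarrow> r \<in> C \<Longrightarrow> q \<le> r \<or> r \<le> q"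
  defines "u \<equiv> \<lambda>x. INF q\<in>C. q x"
  shows "sublinear u" "q \<in> C \<Longrightarrow> u x \<le> q x"
proof -
  have bdd: "bdd_below ((\<lambda>q. q x) ` C)" for x
  proof (rule bdd_belowI2)
    fix q assume "q \<in> C"
    then show "- p (- x) \<le> q x" using sublinear_minus[of q x] sub le[of q "- x"] by fastforce
  qed
  have lower: "u x \<le> q x" if "q \<in> C" for q x
    unfolding u_def using that by (intro cINF_lower bdd)
  then show "q \<in> C \<Longrightarrow> u x \<le> q x" by blast
  have ge: "B \<le> u x" if "\<And>q. q \<in> C \<Longrightarrow> B \<le> q x" for B x
    unfolding u_def by (rule cINF_greatest) (use that ne in auto)
  have "u (x + y) \<le> u x + u y" for x y
  proof -
    have "u (x + y) \<le> q x + r y" if qr: "q \<in> C" "r \<in> C" for q r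
    proof -
      obtain m where m: "m \<in> C" "m \<le> q" "m \<le> r" using chain[OF qr] qr by auto
      have "u (x + y) \<le> m x + m y"
        using lower[OF m(1), of "x + y"] sublinear_add[OF sub[OF m(1)], of x y] by simp
      also have "\<dots> \<le> q x + r y" using m by (simp add: add_mono le_funD)
      finally show ?thesis .
    qed
    then have "u (x + y) - r y \<le> q x" if "q \<in> C" "r \<in> C" for q r
      using that by (simp add: algebra_simps)
    then have "u (x + y) - r y \<le> u x" if "r \<in> C" for r using that by (blast intro: ge)
    then have "u (x + y) - u x \<le> r y" if "r \<in> C" for r using that by (simp add: algebra_simps)
    then have "u (x + y) - u x \<le> u y" by (rule ge)
    then show ?thesis by simp
  qed
  moreover have "u (c *\<^sub>R x) = c * u x" if "c \<ge> 0" for c x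
  proof -
    consider "c = 0" | "c > 0" using \<open>c \<ge> 0\<close> by linarith
    then show ?thesis
    proof cases
      case 1
      have "(\<lambda>q. q 0) ` C = {0}" using ne sub sublinear_zero by force
      then show ?thesis using 1 by (simp add: u_def)
    next
      case 2
      have "(\<lambda>q. q (c *\<^sub>R x)) ` C = (*) c ` (\<lambda>q. q x) ` C"
        unfolding image_image by (intro image_cong refl) (use sub sublinear_scale 2 in force)
      then show ?thesis using 2 ne bdd by (simp add: u_def cInf_scale)
    qed
  qed
  ultimately show "sublinear u" by (simp add: sublinear_def)
qed

lemma sublinear_dominates_linear:
  fixes p :: "'a::real_vector \<Rightarrow> real"
  assumes p: "sublinear p"
  obtains r where "linear r" "\<And>x. r x \<le> p x"
proof -
  define A where "A = {q. sublinear q \<and> (\<forall>x. q x \<le> p x)}"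
  \<comment> \<open>The order is reversed: an element maximal for \<open>P\<close> is a minimal
    functional.\<close>
  define P where "P = (\<lambda>q r. r \<le> (q :: 'a \<Rightarrow> real))"
  have "\<exists>m\<in>A. \<forall>a\<in>A. P m a \<longrightarrow> a = m"
  proof (rule predicate_Zorn)
    show "partial_order_on A (relation_of P A)"
      by (rule partial_order_on_relation_ofI) (auto simp: P_def)
    fix C assume C: "C \<in> Chains (relation_of P A)"
    show "\<exists>u\<in>A. \<forall>a\<in>C. P a u"
    proof (cases "C = {}")
      case True
      then show ?thesis using p by (auto simp: A_def)
    next
      case False
      have CA: "C \<subseteq> A" using C by (auto simp: Chains_def relation_of_def)
      have ch: "q \<le> r \<or> r \<le> q" if "q \<in> C" "r \<in> C" for q r
        using C that by (auto simp: Chains_def relation_of_def P_def)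
      define u where "u = (\<lambda>x. INF q\<in>C. q x)"
      have u: "sublinear u" "q \<in> C \<Longrightarrow> u x \<le> q x" for q x
        unfolding u_def
        by (rule sublinear_INF_chain[of C p]; use False CA ch in \<open>auto simp: A_def\<close>)+
      obtain q where q: "q \<in> C" using False by blast
      then have "u x \<le> p x" for x using u(2)[OF q, of x] CA q order_trans unfolding A_def by blast
      then have "u \<in> A" using u(1) by (simp add: A_def)
      then show ?thesis using u by (auto simp: P_def le_fun_def)
    qed
  qed
  then obtain m where m: "m \<in> A" "\<And>a. a \<in> A \<Longrightarrow> P m a \<Longrightarrow> a = m" by blast
  have "linear m"
  proof (rule sublinear_minimal_linear)
    fix r assume "sublinear r" "\<And>x. r x \<le> m x"
    then show "r = m" using m by (intro m(2)) (auto simp: A_def P_def le_fun_def intro: order_trans)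
  qed (use m in \<open>simp add: A_def\<close>)
  then show thesis using m that by (auto simp: A_def)
qed

text \<open>A linear functional is placed below the descent of \<open>p\<close> along
  \<open>x0\<close> rather than below \<open>p\<close> itself: its value at \<open>- x0\<close> is
  then at most \<open>- p x0\<close>, which forces equality at \<open>x0\<close>.\<close>

lemma hahn_banach_point:
  fixes p :: "'a::real_vector \<Rightarrow> real"
  assumes p: "sublinear p"
  obtains r where "linear r" "\<And>x. r x \<le> p x" "r x0 = p x0"
proof -
  define q where "q = (\<lambda>x. INF s\<in>{0..}. p (x + s *\<^sub>R x0) - s * p x0)"
  have q: "sublinear q" "q x \<le> p x" for x
    unfolding q_def by (rule sublinear_descend[OF p])+
  have "q (- x0) \<le> p (- x0 + x0) - p x0" unfolding q_def by (rule sublinear_descend[OF p])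
  then have q0: "q (- x0) \<le> - p x0" by (simp add: sublinear_zero[OF p])
  obtain r where r: "linear r" "\<And>x. r x \<le> q x" using sublinear_dominates_linear[OF q(1)] by blast
  have "r x0 \<ge> p x0" using r(2)[of "- x0"] q0 linear_neg[OF r(1), of x0] by simp
  then show thesis using that[of r] r q(2) order_trans[OF r(2) q(2)] antisym by blast
qed

section \<open>Bounded functionals over the scalar field\<close>

context banach_over
begin

text \<open>The factors \<open>2\<close> and \<open>1 / 2\<close> are not optimal; they avoid identifying the norm of \<open>'k\<close>
  with the absolute value of \<open>\<real>\<close> or \<open>\<complex>\<close>.\<close>

lemma hahn_banach_seminorm:
  fixes p :: "'a \<Rightarrow> real"
  assumes add: "\<And>x y. p (x + y) \<le> p x + p y"
    and scale: "\<And>c x. p (smul c x) = norm c * p x"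
    and le: "\<And>x. p x \<le> norm x"
  obtains \<psi> where "\<psi> \<in> dual_space smul" "\<And>x. norm (\<psi> x) \<le> 2 * p x" "p x0 \<le> 2 * norm (\<psi> x0)"
proof -
  have scaleR: "p (c *\<^sub>R x) = \<bar>c\<bar> * p x" for c x
    using scale[of "of_real c" x] by (simp add: smul_of_real)
  have "sublinear p" by (simp add: sublinear_def add scaleR)
  then obtain r where r: "linear r" "\<And>x. r x \<le> p x" "r x0 = p x0" using hahn_banach_point by blast
  have rabs: "\<bar>r x\<bar> \<le> p x" for x
    using r(2)[of x] r(2)[of "- x"] linear_neg[OF r(1), of x] scaleR[of "- 1" x] by simp
  have p0: "p x \<ge> 0" for x using rabs[of x] by linarith
  have sR: "smul (a *\<^sub>R c) x = a *\<^sub>R smul c x" for a c x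
    by (metis scale_scale smul_of_real scaleR_conv_of_real)
  consider (re) "\<forall>z::'k. \<exists>a. z = a *\<^sub>R 1"
    | (co) j :: 'k where "j * j = - 1" "\<forall>z. \<exists>a b. z = a *\<^sub>R 1 + b *\<^sub>R j"
    using real_or_complex by blast
  then show thesis
  proof cases
    case re
    define f :: "'a \<Rightarrow> 'k" where "f = (\<lambda>x. of_real (r x))"
    have fl: "f (smul c x) = c * f x" for c x
    proof -
      obtain a where "c = a *\<^sub>R 1" using re by blast
      then show ?thesis
        by (simp add: f_def sR linear_scale[OF r(1)]) (simp add: scaleR_conv_of_real)
    qed
    have bl: "bounded_linear f"
      by (rule bounded_linear_intro[where K = 1])
        (use order_trans[OF rabs le] in \<open>simp_all add: f_def linear_add[OF r(1)] linear_scale[OF r(1)] scaleR_conv_of_real\<close>)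
    have norm_f: "norm (f x) = \<bar>r x\<bar>" for x by (simp add: f_def)
    have fb: "\<bar>r x\<bar> \<le> 2 * p x" for x using rabs[of x] p0[of x] by linarith
    show thesis
      by (rule that[of "Blinfun f"])
        (use fl fb rabs[of x0] p0[of x0] r(3) in
          \<open>simp_all add: dual_space_def bounded_linear_Blinfun_apply[OF bl] norm_f\<close>)
  next
    case co
    have "norm j * norm j = 1" using co(1) by (metis norm_minus_cancel norm_mult norm_one)
    then have nj: "norm j = 1" using norm_ge_zero[of j] by (metis abs_of_nonneg real_sqrt_abs2 real_sqrt_one)
    \<comment> \<open>The usual complexification of a real functional, with \<open>j\<close> as
      imaginary unit.\<close>
    define f :: "'a \<Rightarrow> 'k" where "f = (\<lambda>x. of_real (r x) - j * of_real (r (smul j x)))"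
    have sS: "smul c (a *\<^sub>R x) = a *\<^sub>R smul c x" for a c x
      by (metis scale_left_commute smul_of_real)
    have jj: "smul j (smul j x) = - x" for x by (simp add: co(1))
    have fl: "f (smul c x) = c * f x" for c x
    proof -
      obtain a b where c: "c = a *\<^sub>R 1 + b *\<^sub>R j" using co by blast
      have 1: "smul c x = a *\<^sub>R x + b *\<^sub>R smul j x"
        by (simp add: c scale_left_distrib sR)
      have 2: "smul j (smul c x) = a *\<^sub>R smul j x - b *\<^sub>R x"
        unfolding 1 by (simp only: scale_right_distrib sS jj) simp
      have jx: "j * (j * z) = - z" for z using co(1) by (metis mult.assoc mult_minus1)
      show ?thesis
        unfolding f_def 2 unfolding 1 unfolding c
        by (simp add: linear_add[OF r(1)] linear_diff[OF r(1)] linear_scale[OF r(1)]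
            scaleR_conv_of_real algebra_simps jx)
    qed
    have fb: "norm (f x) \<le> 2 * p x" for x
    proof -
      have "norm (f x) \<le> norm (of_real (r x) :: 'k) + norm (j * of_real (r (smul j x)))"
        unfolding f_def by (rule norm_triangle_ineq4)
      also have "\<dots> \<le> p x + p (smul j x)" using rabs by (simp add: norm_mult nj add_mono)
      finally show ?thesis by (simp add: scale nj)
    qed
    have fadd: "f (x + y) = f x + f y" for x y
      by (simp add: f_def linear_add[OF r(1)] scale_right_distrib algebra_simps)
    have fR: "f (c *\<^sub>R x) = c *\<^sub>R f x" for c x
      using fl[of "of_real c" x] by (simp add: smul_of_real scaleR_conv_of_real)
    have bl: "bounded_linear f"
    proof (rule bounded_linear_intro[where K = 2])
      show "norm (f x) \<le> norm x * 2" for x using fb[of x] le[of x] by simp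
    qed (simp_all add: fadd fR)
    \<comment> \<open>The product with the conjugate is a^2 + b^2, the conjugate has norm at most
      |a| + |b|, and (|a| + |b|)^2 \<le> 2 (a^2 + b^2).\<close>
    have lower: "\<bar>a\<bar> \<le> 2 * norm (of_real a - j * of_real b)" for a b
    proof -
      let ?z = "of_real a - j * of_real b" and ?w = "of_real a + j * of_real b"
      have "?z * ?w = of_real a * of_real a - (j * j) * (of_real b * of_real b)"
        by (simp add: algebra_simps)
      then have "?z * ?w = of_real (a\<^sup>2 + b\<^sup>2)"
        by (simp add: co(1) power2_eq_square)
      then have "norm ?z * norm ?w = a\<^sup>2 + b\<^sup>2" by (metis norm_mult norm_of_real abs_of_nonneg sum_power2_ge_zero)
      moreover have "norm ?w \<le> \<bar>a\<bar> + \<bar>b\<bar>"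
        using norm_triangle_ineq[of "of_real a" "j * of_real b"] by (simp add: norm_mult nj)
      ultimately have 1: "a\<^sup>2 + b\<^sup>2 \<le> norm ?z * (\<bar>a\<bar> + \<bar>b\<bar>)" by (metis mult_left_mono norm_ge_zero)
      have "(\<bar>a\<bar> + \<bar>b\<bar>) * (\<bar>a\<bar> + \<bar>b\<bar>) \<le> 2 * (a\<^sup>2 + b\<^sup>2)"
        using sum_squares_bound[of "\<bar>a\<bar>" "\<bar>b\<bar>"] by (simp add: power2_eq_square distrib_left distrib_right)
      then have *: "(\<bar>a\<bar> + \<bar>b\<bar>) * (\<bar>a\<bar> + \<bar>b\<bar>) \<le> (2 * norm ?z) * (\<bar>a\<bar> + \<bar>b\<bar>)" using 1 by simp
      show ?thesis
      proof (cases "\<bar>a\<bar> + \<bar>b\<bar> = 0")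
        case False
        then have "\<bar>a\<bar> + \<bar>b\<bar> > 0" by linarith
        with * have "\<bar>a\<bar> + \<bar>b\<bar> \<le> 2 * norm ?z" by (simp only: mult_le_cancel_right_pos)
        then show ?thesis by linarith
      next
        case True
        then have "a = 0" by linarith
        then show ?thesis by simp
      qed
    qed
    show thesis
    proof (rule that[of "Blinfun f"])
      show "Blinfun f \<in> dual_space smul"
        by (simp add: dual_space_def bounded_linear_Blinfun_apply[OF bl] fl)
      show "norm (Blinfun f x) \<le> 2 * p x" for x
        by (simp add: bounded_linear_Blinfun_apply[OF bl] fb)
      have "p x0 \<le> \<bar>r x0\<bar>" using r(3) by simp
      also have "\<dots> \<le> 2 * norm (f x0)" unfolding f_def by (rule lower)
      finally show "p x0 \<le> 2 * norm (Blinfun f x0)"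
        by (simp add: bounded_linear_Blinfun_apply[OF bl])
    qed
  qed
qed

lemma norming_functional:
  obtains \<psi> where "\<psi> \<in> dual_space smul" "\<And>x. norm (\<psi> x) \<le> 2 * norm x" "norm x0 \<le> 2 * norm (\<psi> x0)"
  using hahn_banach_seminorm[of norm x0] by (auto simp: norm_triangle_ineq norm_smul)

lemma infdist_add_le:
  assumes Y: "subspace Y"
  shows "infdist (x + y) Y \<le> infdist x Y + infdist y Y"
proof (rule field_le_epsilon)
  fix e :: real assume e: "e > 0"
  have ne: "Y \<noteq> {}" using Y subspace_0 by auto
  have ex: "\<exists>u\<in>Y. dist z u < infdist z Y + e / 2" for z
  proof (rule ccontr)
    assume "\<not> ?thesis"
    then have "infdist z Y + e / 2 \<le> infdist z Y"
      unfolding infdist_notempty[OF ne] by (intro cINF_greatest[OF ne]) (auto simp: not_less)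
    then show False using e by simp
  qed
  obtain u v where uv: "u \<in> Y" "v \<in> Y" "dist x u < infdist x Y + e / 2" "dist y v < infdist y Y + e / 2"
    using ex by meson
  have "infdist (x + y) Y \<le> dist (x + y) (u + v)" using uv Y by (intro infdist_le subspace_add)
  also have "\<dots> \<le> dist x u + dist y v" by (rule dist_triangle_add)
  finally show "infdist (x + y) Y \<le> infdist x Y + infdist y Y + e" using uv by simp
qed

lemma infdist_smul:
  assumes Y: "subspace Y"
  shows "infdist (smul c x) Y = norm c * infdist x Y"
proof -
  have ne: "Y \<noteq> {}" using Y subspace_0 by auto
  have le: "infdist (smul c x) Y \<le> norm c * infdist x Y" for c x
  proof (cases "c = 0")
    case True
    then show ?thesis using Y subspace_0 by simp
  next
    case False
    have "infdist (smul c x) Y / norm c \<le> infdist x Y"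
      unfolding infdist_notempty[OF ne, of x]
    proof (rule cINF_greatest[OF ne])
      fix u assume "u \<in> Y"
      then have "infdist (smul c x) Y \<le> dist (smul c x) (smul c u)"
        using Y by (intro infdist_le subspace_scale)
      also have "\<dots> = norm c * dist x u"
        by (simp add: dist_norm norm_smul flip: scale_right_diff_distrib)
      finally show "infdist (smul c x) Y / norm c \<le> dist x u"
        using False by (simp add: field_simps)
    qed
    then show ?thesis using False by (simp add: field_simps)
  qed
  show ?thesis
  proof (cases "c = 0")
    case True
    then show ?thesis using Y subspace_0 by simp
  next
    case False
    have "norm c * infdist x Y \<le> infdist (smul c x) Y"
    proof -
      have "infdist x Y \<le> inverse (norm c) * infdist (smul c x) Y"
        using le[of "inverse c" "smul c x"] False by (simp add: norm_inverse)
      then have "norm c * infdist x Y \<le> norm c * (inverse (norm c) * infdist (smul c x) Y)"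
        by (rule mult_left_mono) simp
      also have "\<dots> = infdist (smul c x) Y" using False by simp
      finally show ?thesis .
    qed
    then show ?thesis using le by (simp add: antisym)
  qed
qed

text \<open>The distance to \<open>Y\<close> is a seminorm that vanishes on \<open>Y\<close>. A
  functional dominated by it annihilates \<open>Y\<close>, yet it can be chosen nonzero at a point
  outside the closure.\<close>

lemma subspace_dense_if_annihilator_trivial:
  assumes Y: "subspace Y"
    and ann: "\<And>\<psi>. \<psi> \<in> dual_space smul \<Longrightarrow> (\<And>y. y \<in> Y \<Longrightarrow> blinfun_apply \<psi> y = 0) \<Longrightarrow> \<psi> = 0"
  shows "closure Y = UNIV"
proof (rule ccontr)
  have ne: "Y \<noteq> {}" using Y subspace_0 by auto
  assume "closure Y \<noteq> UNIV"
  then obtain x0 where x0: "x0 \<notin> closure Y" by blast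
  have le: "infdist x Y \<le> norm x" for x
    using infdist_le[OF subspace_0[OF Y], of x] by simp
  obtain \<psi> where \<psi>: "\<psi> \<in> dual_space smul" "\<And>x. norm (blinfun_apply \<psi> x) \<le> 2 * infdist x Y"
    "infdist x0 Y \<le> 2 * norm (blinfun_apply \<psi> x0)"
    using hahn_banach_seminorm[of "\<lambda>x. infdist x Y" x0] infdist_add_le[OF Y] infdist_smul[OF Y] le
    by blast
  have "\<psi> = 0"
  proof (rule ann[OF \<psi>(1)])
    fix y assume "y \<in> Y"
    then show "blinfun_apply \<psi> y = 0" using \<psi>(2)[of y] by simp
  qed
  then have "infdist x0 Y \<le> 0" using \<psi>(3) by simp
  then have "x0 \<in> closure Y" using in_closure_iff_infdist_zero[OF ne] infdist_nonneg[of x0 Y] by simp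
  then show False using x0 by simp
qed

end

section \<open>Powers of operators and strong convergence\<close>

lemma blinfun_pow_0 [simp]: "blinfun_pow T 0 = id_blinfun"
  by (simp add: blinfun_pow_def)

lemma blinfun_pow_Suc: "blinfun_pow T (Suc m) x = T (blinfun_pow T m x)"
  by (simp add: blinfun_pow_def)

lemma blinfun_pow_add: "blinfun_pow T (m + k) x = blinfun_pow T m (blinfun_pow T k x)"
  by (induction m) (simp_all add: blinfun_pow_Suc)

lemma blinfun_pow_Suc2: "blinfun_pow T (Suc m) x = blinfun_pow T m (T x)"
  using blinfun_pow_add[of T m 1 x] by (simp add: blinfun_pow_Suc)

lemma norm_blinfun_le: "norm T \<le> C \<Longrightarrow> norm (blinfun_apply T x) \<le> C * norm x"
  by (meson mult_right_mono norm_blinfun norm_ge_zero order_trans)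

text \<open>The comparison sequence may depend on \<open>e\<close>, and its limit is never named.
  This serves both for extension from a dense set and for comparing powers with Euler steps whose
  length depends on \<open>e\<close>.\<close>

lemma convergent_if_approximable:
  fixes u :: "nat \<Rightarrow> 'a::banach"
  assumes "\<And>e. e > 0 \<Longrightarrow> \<exists>y. convergent y \<and> (\<forall>\<^sub>F n in sequentially. norm (u n - y n) \<le> e)"
  shows "convergent u"
proof (rule Cauchy_convergent, rule CauchyI)
  fix e :: real assume "e > 0"
  then obtain y where y: "convergent y" "\<forall>\<^sub>F n in sequentially. norm (u n - y n) \<le> e / 4"
    using assms[of "e / 4"] by auto
  obtain N1 where N1: "\<And>n. n \<ge> N1 \<Longrightarrow> norm (u n - y n) \<le> e / 4"
    using y(2) by (auto simp: eventually_sequentially)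
  obtain N2 where N2: "\<And>m n. m \<ge> N2 \<Longrightarrow> n \<ge> N2 \<Longrightarrow> norm (y m - y n) < e / 4"
    using CauchyD[OF convergent_Cauchy[OF y(1)], of "e / 4"] \<open>e > 0\<close> by auto
  show "\<exists>M. \<forall>m\<ge>M. \<forall>n\<ge>M. norm (u m - u n) < e"
  proof (intro exI allI impI)
    fix m n assume mn: "max N1 N2 \<le> m" "max N1 N2 \<le> n"
    have "norm (u m - u n) = norm ((u m - y m) + (y m - y n) - (u n - y n))" by simp
    also have "\<dots> \<le> norm (u m - y m) + norm (y m - y n) + norm (u n - y n)"
      using norm_triangle_ineq4[of "(u m - y m) + (y m - y n)" "u n - y n"]
        norm_triangle_ineq[of "u m - y m" "y m - y n"] by linarith
    also have "\<dots> \<le> e / 4 + norm (y m - y n) + e / 4" using mn N1 by (intro add_mono) auto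
    also have "\<dots> < e" using N2[of m n] mn \<open>e > 0\<close> by simp
    finally show "norm (u m - u n) < e" .
  qed
qed

lemma closure_UNIV_approx:
  fixes S :: "'a::real_normed_vector set"
  assumes "closure S = UNIV" "e > 0"
  obtains y where "y \<in> S" "norm (x - y) < e"
proof -
  have "x \<in> closure S" using assms by simp
  then show thesis using that assms(2) by (auto simp: closure_approachable dist_norm norm_minus_commute)
qed

lemma convergent_on_dense:
  fixes L :: "nat \<Rightarrow> 'a::banach \<Rightarrow>\<^sub>L 'b::banach"
  assumes C: "\<And>n. norm (L n) \<le> C" and S: "closure S = UNIV"
    and conv: "\<And>x. x \<in> S \<Longrightarrow> convergent (\<lambda>n. L n x)"
  shows "convergent (\<lambda>n. L n x)"
proof (rule convergent_if_approximable)
  fix e :: real assume e: "e > 0"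
  have C0: "C \<ge> 0" using C[of 0] norm_ge_zero[of "L 0"] by linarith
  \<comment> \<open>Dividing by \<open>C + 1\<close> covers the case \<open>C = 0\<close>; the same
    device recurs below.\<close>
  obtain y where y: "y \<in> S" "norm (x - y) < e / (C + 1)"
    using closure_UNIV_approx[OF S, of "e / (C + 1)" x] e C0 by auto
  have "norm (L n x - L n y) \<le> e" for n
  proof -
    have "norm (L n x - L n y) \<le> C * norm (x - y)"
      using norm_blinfun_le[OF C, of n "x - y"] by (simp add: blinfun.diff_right)
    also have "\<dots> \<le> (C + 1) * norm (x - y)" by (simp add: mult_right_mono)
    also have "\<dots> \<le> e" using y(2) C0 by (simp add: field_simps)
    finally show ?thesis .
  qed
  then show "\<exists>y. convergent y \<and> (\<forall>\<^sub>F n in sequentially. norm (L n x - y n) \<le> e)"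
    using conv[OF y(1)] by (intro exI[of _ "\<lambda>n. L n y"]) simp
qed

lemma tendsto_zero_on_dense:
  fixes L :: "nat \<Rightarrow> 'a::banach \<Rightarrow>\<^sub>L 'b::banach"
  assumes C: "\<And>n. norm (L n) \<le> C" and S: "closure S = UNIV"
    and conv: "\<And>x. x \<in> S \<Longrightarrow> (\<lambda>n. L n x) \<longlonglongrightarrow> 0"
  shows "(\<lambda>n. L n x) \<longlonglongrightarrow> 0"
proof (rule LIMSEQ_I)
  fix e :: real assume e: "e > 0"
  have C0: "C \<ge> 0" using C[of 0] norm_ge_zero[of "L 0"] by linarith
  obtain y where y: "y \<in> S" "norm (x - y) < (e / 2) / (C + 1)"
    using closure_UNIV_approx[OF S, of "(e / 2) / (C + 1)" x] e C0 by auto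
  obtain N where N: "\<And>n. n \<ge> N \<Longrightarrow> norm (L n y) < e / 2"
    using LIMSEQ_D[OF conv[OF y(1)], of "e / 2"] e by auto
  have "norm (L n x - 0) < e" if "n \<ge> N" for n
  proof -
    have "norm (L n x) \<le> norm (L n (x - y)) + norm (L n y)"
      using norm_triangle_ineq[of "L n (x - y)" "L n y"] by (simp add: blinfun.diff_right)
    also have "norm (L n (x - y)) \<le> (C + 1) * norm (x - y)"
      using norm_blinfun_le[OF C, of n "x - y"] norm_ge_zero[of "x - y"]
      unfolding distrib_right by linarith
    also have "\<dots> \<le> e / 2" using y(2) C0 by (simp add: field_simps)
    finally show ?thesis using N[OF that] by simp
  qed
  then show "\<exists>N. \<forall>n\<ge>N. norm (L n x - 0) < e" by blast
qed

lemma strong_limit: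
  fixes L :: "nat \<Rightarrow> 'a::real_normed_vector \<Rightarrow>\<^sub>L 'b::real_normed_vector"
  assumes C: "\<And>n. norm (L n) \<le> C" and conv: "\<And>x. convergent (\<lambda>n. L n x)"
  obtains K where "norm K \<le> C" "\<And>x. (\<lambda>n. L n x) \<longlonglongrightarrow> blinfun_apply K x"
proof -
  define f where "f = (\<lambda>x. lim (\<lambda>n. L n x))"
  have f: "(\<lambda>n. L n x) \<longlonglongrightarrow> f x" for x
    using conv[of x] by (simp add: f_def convergent_LIMSEQ_iff)
  have fb: "norm (f x) \<le> C * norm x" for x
    by (rule Lim_bounded[OF tendsto_norm[OF f], of 0]) (use norm_blinfun_le[OF C] in auto)
  have bl: "bounded_linear f"
  proof (rule bounded_linear_intro[where K = C])
    show "f (x + y) = f x + f y" for x y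
      by (rule LIMSEQ_unique[OF f]) (use tendsto_add[OF f f] in \<open>simp add: blinfun.add_right\<close>)
    show "f (r *\<^sub>R x) = r *\<^sub>R f x" for r x
      by (rule LIMSEQ_unique[OF f]) (use tendsto_scaleR[OF tendsto_const f] in \<open>simp add: blinfun.scaleR_right\<close>)
  qed (use fb in \<open>simp add: mult.commute\<close>)
  have "C \<ge> 0" using C[of 0] norm_ge_zero[of "L 0"] by linarith
  show thesis
    by (rule that[of "Blinfun f"])
      (use f fb \<open>C \<ge> 0\<close> in \<open>auto intro!: norm_blinfun_bound simp: bounded_linear_Blinfun_apply[OF bl]\<close>)
qed

text \<open>The uniform bound makes strong convergence compatible with moving arguments; with
  \<open>x = 0\<close> it says that null sequences stay null.\<close>

lemma strong_limit_apply:
  fixes L :: "nat \<Rightarrow> 'a::real_normed_vector \<Rightarrow>\<^sub>L 'b::real_normed_vector"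
  assumes C: "\<And>n. norm (L n) \<le> C" and L: "(\<lambda>n. L n x) \<longlonglongrightarrow> y" and u: "u \<longlonglongrightarrow> x"
  shows "(\<lambda>n. L n (u n)) \<longlonglongrightarrow> y"
proof -
  have "(\<lambda>n. L n (u n - x)) \<longlonglongrightarrow> 0"
  proof (rule Lim_null_comparison)
    show "\<forall>\<^sub>F n in sequentially. norm (L n (u n - x)) \<le> C * norm (u n - x)"
      using norm_blinfun_le[OF C] by simp
    show "(\<lambda>n. C * norm (u n - x)) \<longlonglongrightarrow> 0"
      using u by (auto intro!: tendsto_mult_right_zero tendsto_norm_zero simp: LIM_zero_iff)
  qed
  from tendsto_add[OF L this] show ?thesis by (simp add: blinfun.diff_right)
qed

section \<open>Discrete approximations of a semigroup\<close>

text \<open>The growth is given by powers of \<open>1 + b * h n\<close> instead of an exponential,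
  since these combine with the denominators \<open>1 + l * h n\<close> of the Neumann series to a
  geometric series that sums exactly.\<close>

locale power_bounded =
  fixes V :: "nat \<Rightarrow> 'a::banach \<Rightarrow>\<^sub>L 'a" and h :: "nat \<Rightarrow> real" and M b :: real
  assumes h_pos: "h n > 0" and h_tendsto: "h \<longlonglongrightarrow> 0" and b_nonneg: "b \<ge> 0"
    and pow_bound: "norm (blinfun_pow (V n) k) \<le> M * (1 + b * h n) ^ k"
begin

abbreviation P :: "nat \<Rightarrow> nat \<Rightarrow> 'a \<Rightarrow>\<^sub>L 'a" where "P n \<equiv> blinfun_pow (V n)"

definition A :: "nat \<Rightarrow> 'a \<Rightarrow>\<^sub>L 'a" where "A n = (1 / h n) *\<^sub>R (V n - id_blinfun)"

text \<open>The Neumann series of \<open>(l - A n)\<^sup>-\<^sup>1\<close>, as \<open>l - A n = ((1 + l * h n) - V n) / h n\<close>.\<close>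

definition Res :: "nat \<Rightarrow> real \<Rightarrow> 'a \<Rightarrow>\<^sub>L 'a" where
  "Res n l = (\<Sum>k. (h n / (1 + l * h n) ^ Suc k) *\<^sub>R P n k)"

lemma M_nonneg: "M \<ge> 0"
  using order_trans[OF norm_ge_zero pow_bound[of 0 0]] by simp

lemma V_eq: "V n x = x + h n *\<^sub>R A n x"
  using h_pos[of n] by (simp add: A_def blinfun.diff_left blinfun.scaleR_left)

lemma pow_growth: "real k * h n \<le> s \<Longrightarrow> (1 + b * h n) ^ k \<le> exp (b * s)"
proof -
  assume s: "real k * h n \<le> s"
  have "(1 + b * h n) ^ k \<le> exp (b * h n) ^ k"
    using b_nonneg h_pos[of n] by (intro power_mono) auto
  also have "\<dots> = exp (b * (real k * h n))" by (simp add: exp_of_nat_mult[symmetric] algebra_simps)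
  also have "\<dots> \<le> exp (b * s)" using s b_nonneg by (simp add: mult_left_mono)
  finally show ?thesis .
qed

lemma P_bound: "real k * h n \<le> s \<Longrightarrow> norm (P n k) \<le> M * exp (b * s)"
  using pow_bound[of n k] mult_left_mono[OF pow_growth M_nonneg] by (meson order_trans)

lemma A_commute:
  assumes "\<And>x. blinfun_apply B (V n x) = V n (B x)"
  shows "blinfun_apply B (A n x) = A n (B x)"
  using assms by (simp add: A_def blinfun.diff_left blinfun.scaleR_left blinfun.diff_right blinfun.scaleR_right)

lemma P_V: "P n k (V n x) = V n (P n k x)"
  by (metis blinfun_pow_Suc blinfun_pow_Suc2)

lemma P_A: "P n k (A n x) = A n (P n k x)"
  by (rule A_commute) (rule P_V)

text \<open>The step length cancels, so the resulting resolvent bounds are uniform in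
  \<open>n\<close>.\<close>

lemma geometric:
  assumes l: "l > b"
  shows "(\<lambda>k. h n / (1 + l * h n) ^ Suc k * (1 + b * h n) ^ k) sums (1 / (l - b))"
proof -
  let ?q = "1 + l * h n" and ?r = "1 + b * h n"
  have q: "0 < ?r" "?r < ?q" using l b_nonneg h_pos[of n] by (auto intro: add_pos_nonneg)
  have "(\<lambda>k. (?r / ?q) ^ k) sums (1 / (1 - ?r / ?q))" using q by (intro geometric_sums) auto
  from sums_mult[OF this, of "h n / ?q"]
  have "(\<lambda>k. h n / ?q * (?r / ?q) ^ k) sums (h n / ?q * (1 / (1 - ?r / ?q)))" .
  moreover have "h n / ?q * (1 / (1 - ?r / ?q)) = 1 / (l - b)"
  proof -
    have "1 - ?r / ?q = h n * (l - b) / ?q" using q by (simp add: field_simps)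
    then show ?thesis using q l h_pos[of n] less_imp_neq[OF less_trans[OF q]] by simp
  qed
  ultimately show ?thesis by (simp add: power_divide field_simps)
qed

lemma Res_sums:
  assumes l: "l > b"
  shows "(\<lambda>k. (h n / (1 + l * h n) ^ Suc k) *\<^sub>R P n k) sums Res n l"
proof -
  have q: "1 + l * h n > 0" using l b_nonneg h_pos[of n] by (intro add_pos_nonneg) auto
  have "summable (\<lambda>k. (h n / (1 + l * h n) ^ Suc k) *\<^sub>R P n k)"
  proof (rule summable_comparison_test')
    show "summable (\<lambda>k. M * (h n / (1 + l * h n) ^ Suc k * (1 + b * h n) ^ k))"
      using geometric[OF l] by (intro summable_mult sums_summable)
    fix k :: nat assume "k \<ge> 0"
    have "norm ((h n / (1 + l * h n) ^ Suc k) *\<^sub>R P n k) = h n / (1 + l * h n) ^ Suc k * norm (P n k)"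
      using h_pos[of n] q by simp
    also have "\<dots> \<le> h n / (1 + l * h n) ^ Suc k * (M * (1 + b * h n) ^ k)"
      using h_pos[of n] q by (intro mult_left_mono pow_bound) simp
    finally show "norm ((h n / (1 + l * h n) ^ Suc k) *\<^sub>R P n k)
        \<le> M * (h n / (1 + l * h n) ^ Suc k * (1 + b * h n) ^ k)"
      by (simp add: mult_ac)
  qed
  then show ?thesis unfolding Res_def by (rule summable_sums)
qed

lemma Res_apply_sums:
  "l > b \<Longrightarrow> (\<lambda>k. (h n / (1 + l * h n) ^ Suc k) *\<^sub>R P n k x) sums Res n l x"
  using bounded_linear.sums[OF blinfun.bounded_linear_left Res_sums] by (simp add: blinfun.scaleR_left)

lemma Res_V: 
  assumes l: "l > b" shows "Res n l (V n x) = V n (Res n l x)"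
proof (rule sums_unique2[OF Res_apply_sums[OF l]])
  show "(\<lambda>k. (h n / (1 + l * h n) ^ Suc k) *\<^sub>R P n k (V n x)) sums V n (Res n l x)"
    using bounded_linear.sums[OF blinfun.bounded_linear_right Res_apply_sums[OF l], of "V n" n x]
    by (simp add: blinfun.scaleR_right P_V)
qed

text \<open>Applying \<open>V n\<close> to the series shifts it by one term and multiplies it by
  \<open>1 + l * h n\<close>; the first term, which the shift loses, produces
  \<open>- x\<close>.\<close>

lemma A_Res:
  assumes l: "l > b"
  shows "A n (Res n l x) = l *\<^sub>R Res n l x - x"
proof -
  let ?q = "1 + l * h n" and ?c = "\<lambda>k. (h n / (1 + l * h n) ^ Suc k) *\<^sub>R P n k x"
  have q: "?q > 0" using l b_nonneg h_pos[of n] by (intro add_pos_nonneg) auto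
  have "(\<lambda>k. V n (?c k)) sums V n (Res n l x)"
    by (rule bounded_linear.sums[OF blinfun.bounded_linear_right Res_apply_sums[OF l]])
  moreover have "V n (?c k) = ?q *\<^sub>R ?c (Suc k)" for k
    using q by (simp add: blinfun.scaleR_right blinfun_pow_Suc)
  ultimately have 1: "(\<lambda>k. ?q *\<^sub>R ?c (Suc k)) sums V n (Res n l x)" by simp
  have "(\<lambda>k. ?c (Suc k)) sums (Res n l x - ?c 0)"
    using Res_apply_sums[OF l, of n x] by (subst sums_Suc_iff) simp
  then have "(\<lambda>k. ?q *\<^sub>R ?c (Suc k)) sums (?q *\<^sub>R (Res n l x - ?c 0))"
    by (rule bounded_linear.sums[OF bounded_linear_scaleR_right])
  from sums_unique2[OF 1 this]
  have "V n (Res n l x) = ?q *\<^sub>R Res n l x - h n *\<^sub>R x" using q by (simp add: scaleR_right_diff_distrib)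
  then have "h n *\<^sub>R A n (Res n l x) = h n *\<^sub>R (l *\<^sub>R Res n l x - x)"
    by (simp add: V_eq algebra_simps)
  then show ?thesis using h_pos[of n] by simp
qed

lemma Res_A: "l > b \<Longrightarrow> Res n l (A n x) = l *\<^sub>R Res n l x - x"
  by (simp add: A_commute Res_V A_Res)

lemma P_Res: "l > b \<Longrightarrow> P n k (Res n l x) = Res n l (P n k x)"
  by (induction k) (simp_all add: blinfun_pow_Suc Res_V)

text \<open>Tracking all powers \<open>P n k\<close> at once gives power bounds for the resolvent with the same
  constant \<open>M\<close>.\<close>

lemma P_Res_bound_step:
  assumes l: "l > b" and B: "\<And>i. norm (P n i y) \<le> B * (1 + b * h n) ^ i"
  shows "norm (P n k (Res n l y)) \<le> B / (l - b) * (1 + b * h n) ^ k"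
proof -
  have q: "1 + l * h n > 0" using l b_nonneg h_pos[of n] by (intro add_pos_nonneg) auto
  let ?c = "\<lambda>i. h n / (1 + l * h n) ^ Suc i" and ?r = "1 + b * h n"
  have s: "(\<lambda>i. ?c i *\<^sub>R P n i (P n k y)) sums P n k (Res n l y)"
    using Res_apply_sums[OF l, of n "P n k y"] by (simp add: P_Res[OF l])
  have t: "(\<lambda>i. B * ?r ^ k * (?c i * ?r ^ i)) sums (B * ?r ^ k * (1 / (l - b)))"
    by (rule sums_mult[OF geometric[OF l]])
  have le: "norm (?c i *\<^sub>R P n i (P n k y)) \<le> B * ?r ^ k * (?c i * ?r ^ i)" for i
  proof -
    have "norm (?c i *\<^sub>R P n i (P n k y)) = ?c i * norm (P n (i + k) y)"
      using q h_pos[of n] by (simp add: blinfun_pow_add)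
    also have "\<dots> \<le> ?c i * (B * ?r ^ (i + k))" using q h_pos[of n] by (intro mult_left_mono B) simp
    finally show ?thesis by (simp add: power_add mult_ac)
  qed
  have "norm (P n k (Res n l y)) \<le> (\<Sum>i. B * ?r ^ k * (?c i * ?r ^ i))"
    unfolding sums_unique[OF s] by (rule norm_suminf_le[OF le sums_summable[OF t]])
  then show ?thesis unfolding sums_unique[OF t, symmetric] by (simp add: mult_ac)
qed

lemma P_Res_bound:
  assumes l: "l > b"
  shows "norm (P n k (blinfun_pow (Res n l) j x)) \<le> M * norm x / (l - b) ^ j * (1 + b * h n) ^ k"
proof (induction j arbitrary: k)
  case 0
  show ?case using norm_blinfun_le[OF pow_bound, of n k x] by (simp add: mult_ac)
next
  case (Suc j)
  show ?case using P_Res_bound_step[OF l Suc.IH, of k] by (simp add: blinfun_pow_Suc mult_ac)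
qed

lemma Res_bound: "l > b \<Longrightarrow> norm (Res n l) \<le> M / (l - b)"
proof (rule norm_blinfun_bound)
  fix x assume l: "l > b"
  show "norm (Res n l x) \<le> M / (l - b) * norm x"
    using P_Res_bound[OF l, of n 0 1 x] by (simp add: blinfun_pow_Suc)
qed (use M_nonneg in auto)

lemma P_diff:
  assumes "m \<le> k" "real k * h n \<le> s"
  shows "norm (P n k x - P n m x) \<le> (real k - real m) * h n * (M * exp (b * s) * norm (A n x))"
  using assms
proof (induction k rule: dec_induct)
  case (step k)
  have k: "real k * h n \<le> s" using step.prems h_pos[of n] by (simp add: algebra_simps)
  have "P n (Suc k) x - P n k x = h n *\<^sub>R P n k (A n x)"
    unfolding blinfun_pow_Suc2 by (simp add: V_eq blinfun.add_right blinfun.scaleR_right)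
  then have "norm (P n (Suc k) x - P n k x) \<le> h n * (M * exp (b * s) * norm (A n x))"
    using norm_blinfun_le[OF P_bound[OF k], of "A n x"] h_pos[of n] by simp
  then have "norm (P n (Suc k) x - P n m x)
      \<le> h n * (M * exp (b * s) * norm (A n x)) + (real k - real m) * h n * (M * exp (b * s) * norm (A n x))"
    using step.IH[OF k] norm_triangle_ineq[of "P n (Suc k) x - P n k x" "P n k x - P n m x"] by simp
  also have "\<dots> = (real (Suc k) - real m) * h n * (M * exp (b * s) * norm (A n x))"
    by (simp add: algebra_simps)
  finally show ?case .
qed simp

text \<open>The increments are \<open>h n *\<^sub>R P n i (A n x)\<close>. Replacing
  \<open>P n i (A n x)\<close> by \<open>A n x\<close> costs a multiple of \<open>i * h n\<close> by
  \<open>P_diff\<close>; in the sum over \<open>i\<close> the factor 1/2 is given away.\<close>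

lemma P_taylor:
  assumes "real k * h n \<le> s" "norm (A n (A n x)) \<le> a2"
  shows "norm (P n k x - x - (real k * h n) *\<^sub>R A n x) \<le> (real k * h n)\<^sup>2 * (M * exp (b * s) * a2)"
  using assms(1)
proof (induction k)
  case (Suc k)
  let ?C = "M * exp (b * s) * a2"
  have C: "M * exp (b * s) * norm (A n (A n x)) \<le> ?C" "0 \<le> ?C"
    using assms(2) M_nonneg by (auto intro!: mult_left_mono mult_nonneg_nonneg intro: order_trans[OF norm_ge_zero])
  have k: "real k * h n \<le> s" using Suc.prems h_pos[of n] by (simp add: algebra_simps)
  have "P n (Suc k) x - x - (real (Suc k) * h n) *\<^sub>R A n x
    = (P n k x - x - (real k * h n) *\<^sub>R A n x) + h n *\<^sub>R (P n k (A n x) - A n x)"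
    unfolding blinfun_pow_Suc2
    by (simp add: V_eq blinfun.add_right blinfun.scaleR_right scaleR_right_diff_distrib scaleR_left_distrib
        distrib_right)
  moreover have "norm (h n *\<^sub>R (P n k (A n x) - A n x)) \<le> h n * (real k * h n * ?C)"
  proof -
    have "norm (P n k (A n x) - A n x) \<le> real k * h n * ?C"
      using P_diff[of 0 k n s "A n x"] k mult_left_mono[OF C(1), of "real k * h n"] h_pos[of n] by simp
    then show ?thesis using h_pos[of n] by simp
  qed
  ultimately have "norm (P n (Suc k) x - x - (real (Suc k) * h n) *\<^sub>R A n x)
      \<le> (real k * h n)\<^sup>2 * ?C + h n * (real k * h n * ?C)"
    using Suc.IH[OF k] norm_triangle_mono by metis
  also have "\<dots> = ((real k * h n)\<^sup>2 + h n * (real k * h n)) * ?C" by (simp add: algebra_simps)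
  also have "\<dots> \<le> (real (Suc k) * h n)\<^sup>2 * ?C"
    using h_pos[of n] by (intro mult_right_mono C(2)) (simp add: power2_eq_square algebra_simps)
  finally show ?case .
qed simp

text \<open>\<open>m\<close> backward Euler steps of length \<open>1 / l\<close> for \<open>A n\<close>.\<close>

definition G :: "nat \<Rightarrow> real \<Rightarrow> nat \<Rightarrow> 'a \<Rightarrow>\<^sub>L 'a" where
  "G n l m = l ^ m *\<^sub>R blinfun_pow (Res n l) m"

lemma G_0: "G n l 0 x = x"
  by (simp add: G_def blinfun.scaleR_left)

lemma G_Suc: "G n l (Suc m) x = l *\<^sub>R Res n l (G n l m x)"
  by (simp add: G_def blinfun.scaleR_left blinfun.scaleR_right blinfun_pow_Suc)

lemma G_Suc2: "G n l (Suc m) x = G n l m (l *\<^sub>R Res n l x)"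
  by (simp add: G_def blinfun.scaleR_left blinfun.scaleR_right blinfun_pow_Suc2 del: blinfun_pow_0)

lemma P_G: "l > b \<Longrightarrow> P n k (G n l m x) = G n l m (P n k x)"
  by (induction m) (simp_all add: G_0 G_Suc blinfun.scaleR_right P_Res)

text \<open>The bound is uniform in \<open>l\<close>. For \<open>l \<ge> 2 * b\<close> one factor
  \<open>l / (l - b)\<close> is at most \<open>exp (2 * b / l)\<close>, so
  \<open>m \<le> s * l\<close> Euler steps cost \<open>exp (2 * b * s)\<close>, and the powers of
  \<open>V n\<close> cost another \<open>exp (b * s)\<close>.\<close>

lemma P_G_bound:
  assumes l: "l > b" "l \<ge> 2 * b" and i: "real i * h n \<le> s" and m: "real m \<le> s * l"
  shows "norm (P n i (G n l m x)) \<le> M * exp (3 * b * s) * norm x"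
proof -
  have l0: "l > 0" using l b_nonneg by linarith
  have "l * l \<le> (l - b) * (l + 2 * b)"
    using mult_nonneg_nonneg[of b "l - 2 * b"] l b_nonneg by (simp add: algebra_simps)
  then have "l / (l - b) \<le> 1 + 2 * b / l" using l l0 by (simp add: field_simps)
  also have "\<dots> \<le> exp (2 * b / l)" by (rule exp_ge_add_one_self)
  finally have "(l / (l - b)) ^ m \<le> exp (2 * b / l) ^ m" using l l0 by (intro power_mono) auto
  also have "\<dots> = exp (2 * b * (real m / l))" by (simp add: exp_of_nat_mult[symmetric] algebra_simps)
  also have "\<dots> \<le> exp (2 * b * s)"
    using m l0 b_nonneg by (simp add: mult_left_mono pos_divide_le_eq)
  finally have e: "(l / (l - b)) ^ m \<le> exp (2 * b * s)" .
  have "norm (P n i (G n l m x)) = l ^ m * norm (P n i (blinfun_pow (Res n l) m x))"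
    using l0 by (simp add: G_def blinfun.scaleR_left blinfun.scaleR_right)
  also have "\<dots> \<le> l ^ m * (M * norm x / (l - b) ^ m * (1 + b * h n) ^ i)"
    using l0 by (intro mult_left_mono P_Res_bound l) simp
  also have "\<dots> = M * norm x * ((l / (l - b)) ^ m * (1 + b * h n) ^ i)"
    by (simp add: power_divide)
  also have "\<dots> \<le> M * norm x * (exp (2 * b * s) * exp (b * s))"
    using M_nonneg b_nonneg h_pos[of n] l l0
    by (intro mult_left_mono mult_mono e pow_growth i) auto
  also have "\<dots> = M * exp (3 * b * s) * norm x" by (simp flip: exp_add)
  finally show ?thesis .
qed

text \<open>With \<open>N\<close> the number of steps \<open>h n\<close> in \<open>1 / l\<close>, both \<open>P n N\<close> and a backward Euler step agree
  with \<open>I + A n / l\<close> up to second order; the error of \<open>j\<close> such steps telescopes because all operators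
  commute.\<close>

lemma P_G_compare:
  assumes l: "l > b" "l \<ge> 2 * b" "l > 0" and N: "real N * h n * l \<le> 1" "1 \<le> (real N + 1) * h n * l"
    and a: "norm (A n x) \<le> a1" "norm (A n (A n x)) \<le> a2" and j: "real j \<le> s * l"
  defines "C \<equiv> M * exp (3 * b * s)"
  shows "norm (P n (N * j) x - G n l j x) \<le> real j * (C * (2 * C * a2 / l\<^sup>2 + h n * a1))"
proof -
  define D where "D = P n N x - l *\<^sub>R Res n l x"
  have a0: "0 \<le> a1" "0 \<le> a2" using a norm_ge_zero order_trans by blast+
  have Nm: "real (N * m) * h n \<le> s" if "m \<le> j" for m
  proof -
    have "real (N * m) * h n * l = (real N * h n * l) * real m" by simp
    also have "\<dots> \<le> 1 * real m" using N by (intro mult_right_mono) auto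
    also have "\<dots> \<le> s * l" using j that by simp
    finally show ?thesis using l by simp
  qed
  \<comment> \<open>For \<open>j = 0\<close> there is no step to compare. From
    \<open>j \<ge> 1\<close> follows \<open>1 \<le> s * l\<close>, so a single step of length
    \<open>1 / l\<close> fits into time \<open>s\<close> and the stability bounds apply to
    it.\<close>
  have D: "norm D \<le> 2 * C * a2 / l\<^sup>2 + h n * a1" if "j \<ge> 1"
  proof -
    have sl: "1 \<le> s * l" using j that by linarith
    have s: "s \<ge> 0" using zero_less_mult_pos2[of s l] sl l(3) by linarith
    have Nh: "real N * h n \<le> s" using Nm[of 1] that by simp
    have C: "M * exp (b * s) \<le> C" "C \<ge> 0"
      unfolding C_def using s b_nonneg M_nonneg by (auto intro!: mult_left_mono mult_right_mono)
    have Nh1: "0 \<le> real N * h n" "real N * h n \<le> 1 / l" "1 / l \<le> real N * h n + h n"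
      using N l h_pos[of n] by (auto simp: field_simps)
    have 1: "norm (P n N x - x - (real N * h n) *\<^sub>R A n x) \<le> C * a2 / l\<^sup>2"
    proof -
      have "norm (P n N x - x - (real N * h n) *\<^sub>R A n x) \<le> (real N * h n)\<^sup>2 * (M * exp (b * s) * a2)"
        by (rule P_taylor[OF Nh a(2)])
      also have "\<dots> \<le> (1 / l)\<^sup>2 * (C * a2)"
        using Nh1 C a0 M_nonneg by (intro mult_mono power_mono mult_right_mono) auto
      finally show ?thesis by (simp add: power_divide)
    qed
    \<comment> \<open>Two uses of \<open>Res_A\<close> turn the remainder into
      \<open>(1 / l) *\<^sub>R Res n l (A n (A n x))\<close>, that is, one Euler step divided by the
      square of \<open>l\<close>.\<close>
    have 2: "norm (l *\<^sub>R Res n l x - x - (1 / l) *\<^sub>R A n x) \<le> C * a2 / l\<^sup>2"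
    proof -
      have "l *\<^sub>R Res n l x - x - (1 / l) *\<^sub>R A n x = (1 / l) *\<^sub>R (l *\<^sub>R Res n l (A n x) - A n x)"
        by (subst Res_A[OF l(1), symmetric]) (use l(3) in \<open>simp add: scaleR_right_diff_distrib\<close>)
      also have "\<dots> = (1 / l) *\<^sub>R Res n l (A n (A n x))" by (simp only: Res_A[OF l(1)])
      also have "\<dots> = (1 / l\<^sup>2) *\<^sub>R P n 0 (G n l 1 (A n (A n x)))"
        using l(3) by (simp add: G_Suc G_0 power2_eq_square)
      finally have "norm (l *\<^sub>R Res n l x - x - (1 / l) *\<^sub>R A n x)
        = (1 / l\<^sup>2) * norm (P n 0 (G n l 1 (A n (A n x))))" by simp
      also have "\<dots> \<le> (1 / l\<^sup>2) * (C * norm (A n (A n x)))"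
        unfolding C_def using sl s by (intro mult_left_mono P_G_bound l(1,2)) auto
      also have "\<dots> \<le> (1 / l\<^sup>2) * (C * a2)" using a C by (intro mult_left_mono) auto
      finally show ?thesis by simp
    qed
    \<comment> \<open>The rounding of \<open>1 / l\<close> to \<open>N\<close> whole steps, an error
      of at most one step \<open>h n\<close>.\<close>
    have 3: "norm ((1 / l - real N * h n) *\<^sub>R A n x) \<le> h n * a1"
      unfolding norm_scaleR using Nh1 a h_pos[of n] by (intro mult_mono) auto
    have "D = (P n N x - x - (real N * h n) *\<^sub>R A n x) - (l *\<^sub>R Res n l x - x - (1 / l) *\<^sub>R A n x)
        - (1 / l - real N * h n) *\<^sub>R A n x"
      by (simp add: D_def scaleR_left_diff_distrib)
    then have "norm D \<le> norm (P n N x - x - (real N * h n) *\<^sub>R A n x)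
        + norm (l *\<^sub>R Res n l x - x - (1 / l) *\<^sub>R A n x) + norm ((1 / l - real N * h n) *\<^sub>R A n x)"
      using norm_triangle_ineq4[of "(P n N x - x - (real N * h n) *\<^sub>R A n x)
          - (l *\<^sub>R Res n l x - x - (1 / l) *\<^sub>R A n x)" "(1 / l - real N * h n) *\<^sub>R A n x"]
        norm_triangle_ineq4[of "P n N x - x - (real N * h n) *\<^sub>R A n x"
          "l *\<^sub>R Res n l x - x - (1 / l) *\<^sub>R A n x"]
      by simp
    also have "\<dots> \<le> C * a2 / l\<^sup>2 + C * a2 / l\<^sup>2 + h n * a1" using 1 2 3 by linarith
    finally show ?thesis by simp
  qed
  \<comment> \<open>The hybrids of \<open>i\<close> Euler steps and \<open>m\<close> blocks of
    powers interpolate between the two processes. Each exchange of one block for one Euler step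
    costs the local error \<open>D\<close>, propagated by stable operators.\<close>
  have "norm (G n l i (P n (N * m) x) - G n l (i + m) x) \<le> real m * (C * (2 * C * a2 / l\<^sup>2 + h n * a1))"
    if "i + m \<le> j" for i m
    using that
  proof (induction m arbitrary: i)
    case (Suc m)
    have "P n (N * Suc m) x = P n (N * m) (P n N x)" by (metis blinfun_pow_add mult_Suc_right add.commute)
    then have "G n l i (P n (N * Suc m) x) - G n l (i + Suc m) x
      = G n l i (P n (N * m) D) + (G n l (Suc i) (P n (N * m) x) - G n l (Suc i + m) x)"
      by (simp add: D_def blinfun.diff_right G_Suc2 blinfun.scaleR_right P_Res[OF l(1)])
    moreover have "norm (G n l i (P n (N * m) D)) \<le> C * (2 * C * a2 / l\<^sup>2 + h n * a1)"
    proof -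
      have "norm (G n l i (P n (N * m) D)) \<le> C * norm D"
        unfolding P_G[OF l(1), symmetric] C_def
        using Suc.prems j by (intro P_G_bound l Nm) auto
      also have "\<dots> \<le> C * (2 * C * a2 / l\<^sup>2 + h n * a1)"
        using M_nonneg Suc.prems by (intro mult_left_mono D) (auto simp: C_def)
      finally show ?thesis .
    qed
    ultimately have "norm (G n l i (P n (N * Suc m) x) - G n l (i + Suc m) x)
       \<le> C * (2 * C * a2 / l\<^sup>2 + h n * a1) + real m * (C * (2 * C * a2 / l\<^sup>2 + h n * a1))"
      using Suc.IH[of "Suc i"] Suc.prems by (metis add_Suc_shift norm_triangle_mono)
    then show ?case by (simp add: distrib_right)
  qed simp
  from this[of 0 j] show ?thesis by (simp add: G_0)
qed

text \<open>The \<open>N * j\<close> steps of the block comparison fall short of time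
  \<open>s\<close> by at most \<open>1 / l + s * l * h n\<close>: rounding \<open>s * l\<close>
  loses at most \<open>1 / l\<close>, and each of the \<open>j \<le> s * l\<close> blocks loses at
  most \<open>h n\<close>. \<open>P_diff\<close> bridges this gap.\<close>

lemma P_G_compare_floor:
  assumes l: "l > b" "l \<ge> 2 * b" "l > 0" and s: "s \<ge> 0"
    and a: "norm (A n x) \<le> a1" "norm (A n (A n x)) \<le> a2"
  defines "C \<equiv> M * exp (3 * b * s)"
  shows "norm (P n (nat \<lfloor>s / h n\<rfloor>) x - G n l (nat \<lfloor>s * l\<rfloor>) x)
    \<le> (1 / l + s * l * h n) * (C * a1) + s * l * (C * (2 * C * a2 / l\<^sup>2 + h n * a1))"
proof -
  define k where "k = nat \<lfloor>s / h n\<rfloor>"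
  define j where "j = nat \<lfloor>s * l\<rfloor>"
  define N where "N = nat \<lfloor>1 / (l * h n)\<rfloor>"
  note h = h_pos[of n]
  have a0: "0 \<le> a1" "0 \<le> a2" using a norm_ge_zero order_trans by blast+
  have C: "C \<ge> 0" "M * exp (b * s) \<le> C"
    unfolding C_def using s b_nonneg M_nonneg by (auto intro!: mult_left_mono mult_right_mono)
  have fl: "real (nat \<lfloor>z\<rfloor>) \<le> z" "z < real (nat \<lfloor>z\<rfloor>) + 1" if "z \<ge> 0" for z :: real
    using that by linarith+
  have k: "real k \<le> s / h n" using fl s h by (simp add: k_def)
  have j: "real j \<le> s * l" "s * l < real j + 1" using fl s l by (simp_all add: j_def)
  have "real N \<le> 1 / (l * h n)" "1 / (l * h n) < real N + 1" using fl l h by (simp_all add: N_def)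
  then have N: "real N * h n * l \<le> 1" "1 \<le> (real N + 1) * h n * l" using l h by (simp_all add: field_simps)
  have kh: "real k * h n \<le> s" using k h by (simp add: field_simps)
  have Njh: "real (N * j) * h n \<le> s"
  proof -
    have "real (N * j) * h n * l = (real N * h n * l) * real j" by simp
    also have "\<dots> \<le> 1 * real j" using N by (intro mult_right_mono) auto
    also have "\<dots> \<le> s * l" using j by simp
    finally show ?thesis using l by simp
  qed
  have Njk: "N * j \<le> k"
  proof -
    have "real (N * j) \<le> s / h n" using Njh h by (simp add: field_simps)
    then show ?thesis unfolding k_def by linarith
  qed
  have low: "(real k - real (N * j)) * h n \<le> 1 / l + s * l * h n"
  proof -
    have "real j * 1 \<le> real j * ((real N + 1) * h n * l)" using N by (intro mult_left_mono) auto
    then have "s * l - 1 \<le> real (N * j) * h n * l + real j * h n * l" using j by (simp add: algebra_simps)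
    also have "real j * h n * l \<le> s * l * h n * l" using j h l by (intro mult_right_mono) auto
    finally have "(s - 1 / l - s * l * h n) * l \<le> real (N * j) * h n * l" using l by (simp add: algebra_simps)
    then have "s - 1 / l - s * l * h n \<le> real (N * j) * h n" using l by simp
    then show ?thesis using kh by (simp add: left_diff_distrib)
  qed
  have "norm (P n k x - P n (N * j) x) \<le> (real k - real (N * j)) * h n * (M * exp (b * s) * norm (A n x))"
    by (rule P_diff[OF Njk kh])
  also have "\<dots> \<le> (1 / l + s * l * h n) * (C * a1)"
    using low C a M_nonneg Njk h l s a0 by (intro mult_mono) auto
  finally have 1: "norm (P n k x - P n (N * j) x) \<le> (1 / l + s * l * h n) * (C * a1)" .
  have "norm (P n (N * j) x - G n l j x) \<le> real j * (C * (2 * C * a2 / l\<^sup>2 + h n * a1))"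
    unfolding C_def by (rule P_G_compare[OF l N a j(1)])
  also have "\<dots> \<le> s * l * (C * (2 * C * a2 / l\<^sup>2 + h n * a1))"
    using j C a0 h by (intro mult_right_mono) auto
  finally have "norm (P n k x - G n l j x)
      \<le> (1 / l + s * l * h n) * (C * a1) + s * l * (C * (2 * C * a2 / l\<^sup>2 + h n * a1))"
    using 1 norm_triangle_ineq[of "P n k x - P n (N * j) x" "P n (N * j) x - G n l j x"] by simp
  then show ?thesis unfolding k_def j_def .
qed

end

section \<open>The limit semigroup and its generator\<close>

locale chernoff_core = power_bounded +
  fixes Zg :: "('a \<times> 'a) set" and w :: real
  assumes A_tendsto: "(f, y) \<in> Zg \<Longrightarrow> (\<lambda>n. A n f) \<longlonglongrightarrow> y"
    and Domain_dense: "closure (Domain Zg) = UNIV"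
    and w_ge: "b \<le> w"
    and range_dense: "l > w \<Longrightarrow> closure ((\<lambda>(f, y). l *\<^sub>R f - y) ` Zg) = UNIV"
begin

lemma Res_tendsto_Domain:
  assumes fy: "(f, y) \<in> Zg" and l: "l > b"
  shows "(\<lambda>n. Res n l (l *\<^sub>R f - y)) \<longlonglongrightarrow> f"
proof -
  have eq: "Res n l (l *\<^sub>R f - y) = f + Res n l (A n f - y)" for n
    by (simp add: blinfun.diff_right blinfun.scaleR_right Res_A[OF l])
  have "(\<lambda>n. Res n l (A n f - y)) \<longlonglongrightarrow> 0"
    by (rule strong_limit_apply[OF Res_bound[OF l], where x = 0])
      (use A_tendsto[OF fy] in \<open>simp_all add: LIM_zero blinfun.zero_right\<close>)
  from tendsto_add[OF tendsto_const[of f] this] show ?thesis by (simp add: eq)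
qed

definition R :: "real \<Rightarrow> 'a \<Rightarrow>\<^sub>L 'a" where
  "R l = (SOME K. \<forall>x. (\<lambda>n. Res n l x) \<longlonglongrightarrow> blinfun_apply K x)"

lemma Res_tendsto:
  assumes l: "l > w"
  shows "(\<lambda>n. Res n l x) \<longlonglongrightarrow> R l x"
proof -
  have lb: "l > b" using l w_ge by simp
  have "convergent (\<lambda>n. Res n l x)" for x
    by (rule convergent_on_dense[OF Res_bound[OF lb] range_dense[OF l]])
      (use Res_tendsto_Domain[OF _ lb] in \<open>auto simp: convergent_def\<close>)
  then obtain K where "\<And>x. (\<lambda>n. Res n l x) \<longlonglongrightarrow> blinfun_apply K x"
    using strong_limit[of "\<lambda>n. Res n l", OF Res_bound[OF lb]] by blast
  then show ?thesis
    unfolding R_def using someI[of "\<lambda>K. \<forall>x. (\<lambda>n. Res n l x) \<longlonglongrightarrow> blinfun_apply K x" K] by blast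
qed

lemma R_Domain: "(f, y) \<in> Zg \<Longrightarrow> l > w \<Longrightarrow> R l (l *\<^sub>R f - y) = f"
  using Res_tendsto_Domain[of f y l] Res_tendsto[of l "l *\<^sub>R f - y"] w_ge LIMSEQ_unique by fastforce

lemma A_Res_tendsto: "l > w \<Longrightarrow> (\<lambda>n. A n (Res n l x)) \<longlonglongrightarrow> l *\<^sub>R R l x - x"
  using w_ge by (simp add: A_Res) (intro tendsto_intros Res_tendsto)

lemma range_R_dense: "l > w \<Longrightarrow> closure (range (blinfun_apply (R l))) = UNIV"
proof -
  assume l: "l > w"
  have "Domain Zg \<subseteq> range (blinfun_apply (R l))" using R_Domain[OF _ l] by (metis Domain.cases rangeI subsetI)
  from closure_mono[OF this] show ?thesis by (simp add: Domain_dense top.extremum_unique)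
qed

text \<open>By continuity \<open>R l\<close> maps the dense set \<open>range (R l)\<close> to a set
  that is dense in the range, which is itself dense.\<close>

lemma range_R_R_dense:
  assumes l: "l > w"
  shows "closure (range (\<lambda>x. R l (R l x))) = UNIV"
proof -
  have "blinfun_apply (R l) ` closure (range (blinfun_apply (R l)))
      \<subseteq> closure (blinfun_apply (R l) ` range (blinfun_apply (R l)))"
    by (rule image_closure_subset[OF linear_continuous_on[OF blinfun.bounded_linear_right] closed_closure])
      (rule closure_subset)
  then have "closure (range (blinfun_apply (R l))) \<subseteq> closure (closure (range (\<lambda>x. R l (R l x))))"
    by (intro closure_mono) (simp add: image_image range_R_dense[OF l])
  then show ?thesis by (simp add: range_R_dense[OF l] top.extremum_unique)
qed

lemma P_floor_bound: "s \<ge> 0 \<Longrightarrow> norm (P n (nat \<lfloor>s / h n\<rfloor>)) \<le> M * exp (b * s)"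
  by (rule P_bound) (use h_pos[of n] in \<open>simp add: pos_le_divide_eq[symmetric]\<close>)

text \<open>The number \<open>m\<close> of steps is fixed, so the factors converge one after the
  other. The starting vectors move because the comparison is made at
  \<open>Res n l0 (Res n l0 g)\<close>, not at its limit.\<close>

lemma G_convergent:
  assumes l: "l > w" and u: "convergent u"
  shows "convergent (\<lambda>n. G n l m (u n))"
proof (induction m)
  case 0
  show ?case using u by (simp add: G_0)
next
  case (Suc m)
  then obtain y where "(\<lambda>n. G n l m (u n)) \<longlonglongrightarrow> y" by (auto simp: convergent_def)
  then have "(\<lambda>n. Res n l (G n l m (u n))) \<longlonglongrightarrow> R l y"
    using l w_ge by (intro strong_limit_apply[OF Res_bound Res_tendsto]) auto
  from tendsto_scaleR[OF tendsto_const this, of l] show ?case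
    unfolding G_Suc convergent_def by blast
qed

text \<open>For fixed \<open>l\<close> the backward Euler steps converge as \<open>n\<close> grows, and their distance to the powers of
  \<open>V n\<close> is eventually of order \<open>1 / l\<close>, so the powers form a Cauchy sequence.\<close>

lemma P_floor_convergent_R_R:
  assumes l0: "l0 > w" and s: "s \<ge> 0"
  shows "convergent (\<lambda>n. P n (nat \<lfloor>s / h n\<rfloor>) (R l0 (R l0 g)))"
proof (rule convergent_if_approximable)
  fix e :: real assume e: "e > 0"
  \<comment> \<open>\<open>z n\<close> replaces the limit vector because \<open>A n\<close> and its
    square are bounded along it; stability of the powers absorbs the difference.\<close>
  define z where "z = (\<lambda>n. Res n l0 (Res n l0 g))"
  have l0b: "l0 > b" using l0 w_ge by simp
  have z: "z \<longlonglongrightarrow> R l0 (R l0 g)"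
    unfolding z_def by (rule strong_limit_apply[OF Res_bound[OF l0b] Res_tendsto[OF l0] Res_tendsto[OF l0]])
  have Az: "(\<lambda>n. A n (z n)) \<longlonglongrightarrow> l0 *\<^sub>R R l0 (R l0 g) - R l0 g"
    unfolding z_def A_Res[OF l0b]
    by (rule tendsto_diff[OF tendsto_scaleR[OF tendsto_const z[unfolded z_def]] Res_tendsto[OF l0]])
  then obtain a1 where a1: "\<And>n. norm (A n (z n)) \<le> a1"
    using BseqE[OF convergent_imp_Bseq[OF convergentI[OF Az]]] by blast
  have eq: "A n (A n (z n)) = l0 *\<^sub>R A n (z n) - (l0 *\<^sub>R Res n l0 g - g)" for n
    unfolding z_def by (simp add: A_Res[OF l0b] blinfun.diff_right blinfun.scaleR_right)
  have Az2: "(\<lambda>n. A n (A n (z n))) \<longlonglongrightarrow> l0 *\<^sub>R (l0 *\<^sub>R R l0 (R l0 g) - R l0 g) - (l0 *\<^sub>R R l0 g - g)"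
    unfolding eq by (intro tendsto_diff tendsto_scaleR tendsto_const Res_tendsto[OF l0] Az)
  then obtain a2 where a2: "\<And>n. norm (A n (A n (z n))) \<le> a2"
    using BseqE[OF convergent_imp_Bseq[OF convergentI[OF Az2]]] by blast
  define C where "C = M * exp (3 * b * s)"
  \<comment> \<open>The comparison error \<open>E n\<close> tends to \<open>K / l\<close> as
    \<open>n\<close> grows; \<open>l\<close> is then chosen so large that this limit is below
    \<open>e / 2\<close>.\<close>
  define K where "K = C * a1 + 2 * s * C\<^sup>2 * a2"
  define l where "l = max (max w (2 * b)) (max 0 (4 * K / e)) + 1"
  have l: "l > w" "l > b" "l \<ge> 2 * b" "l > 0" "l > 4 * K / e"
    unfolding l_def using w_ge by linarith+
  define E where "E = (\<lambda>n. (1 / l + s * l * h n) * (C * a1) + s * l * (C * (2 * C * a2 / l\<^sup>2 + h n * a1)))"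
  have PG: "norm (P n (nat \<lfloor>s / h n\<rfloor>) (z n) - G n l (nat \<lfloor>s * l\<rfloor>) (z n)) \<le> E n" for n
    unfolding E_def C_def by (rule P_G_compare_floor[OF l(2-4) s a1 a2])
  have "E \<longlonglongrightarrow> (1 / l + s * l * 0) * (C * a1) + s * l * (C * (2 * C * a2 / l\<^sup>2 + 0 * a1))"
    unfolding E_def by (intro tendsto_intros h_tendsto) (use l in auto)
  also have "(1 / l + s * l * 0) * (C * a1) + s * l * (C * (2 * C * a2 / l\<^sup>2 + 0 * a1)) = K / l"
    using l(4) by (simp add: K_def field_simps power2_eq_square)
  finally have "E \<longlonglongrightarrow> K / l" .
  moreover have "K / l < e / 2"
  proof -
    have "K * 4 < e * l" using l(5) e by (simp add: field_simps)
    moreover have "0 < e * l" using e l(4) by simp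
    ultimately have "K * 2 < e * l" by linarith
    then show ?thesis using l(4) by (simp add: field_simps)
  qed
  ultimately have E: "\<forall>\<^sub>F n in sequentially. E n < e / 2" by (rule order_tendstoD(2))
  have "(\<lambda>n. P n (nat \<lfloor>s / h n\<rfloor>) (R l0 (R l0 g) - z n)) \<longlonglongrightarrow> 0"
    by (rule strong_limit_apply[OF P_floor_bound[OF s], where x = 0])
      (use tendsto_diff[OF tendsto_const z, of "R l0 (R l0 g)"] in \<open>simp_all add: blinfun.zero_right\<close>)
  from tendstoD[OF this, of "e / 2"] e
  have Z: "\<forall>\<^sub>F n in sequentially. norm (P n (nat \<lfloor>s / h n\<rfloor>) (R l0 (R l0 g) - z n)) < e / 2"
    by (simp only: dist_norm diff_0_right half_gt_zero)
  have "\<forall>\<^sub>F n in sequentially. norm (P n (nat \<lfloor>s / h n\<rfloor>) (R l0 (R l0 g)) - G n l (nat \<lfloor>s * l\<rfloor>) (z n)) \<le> e"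
    using E Z
  proof eventually_elim
    case (elim n)
    have "P n (nat \<lfloor>s / h n\<rfloor>) (R l0 (R l0 g)) - G n l (nat \<lfloor>s * l\<rfloor>) (z n)
      = P n (nat \<lfloor>s / h n\<rfloor>) (R l0 (R l0 g) - z n)
        + (P n (nat \<lfloor>s / h n\<rfloor>) (z n) - G n l (nat \<lfloor>s * l\<rfloor>) (z n))"
      by (simp add: blinfun.diff_right)
    then have "norm (P n (nat \<lfloor>s / h n\<rfloor>) (R l0 (R l0 g)) - G n l (nat \<lfloor>s * l\<rfloor>) (z n))
      \<le> norm (P n (nat \<lfloor>s / h n\<rfloor>) (R l0 (R l0 g) - z n))
        + norm (P n (nat \<lfloor>s / h n\<rfloor>) (z n) - G n l (nat \<lfloor>s * l\<rfloor>) (z n))"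
      by (simp only: norm_triangle_ineq)
    then show ?case using elim PG[of n] by linarith
  qed
  then show "\<exists>y. convergent y \<and>
      (\<forall>\<^sub>F n in sequentially. norm (P n (nat \<lfloor>s / h n\<rfloor>) (R l0 (R l0 g)) - y n) \<le> e)"
    using G_convergent[OF l(1)] z by (blast intro: convergentI)
qed

lemma P_floor_convergent: "s \<ge> 0 \<Longrightarrow> convergent (\<lambda>n. P n (nat \<lfloor>s / h n\<rfloor>) x)"
  by (rule convergent_on_dense[OF P_floor_bound range_R_R_dense[of "w + 1"]])
    (auto intro: P_floor_convergent_R_R)

definition T :: "real \<Rightarrow> 'a \<Rightarrow>\<^sub>L 'a" where
  "T s = (SOME K. norm K \<le> M * exp (b * s) \<and> (\<forall>x. (\<lambda>n. P n (nat \<lfloor>s / h n\<rfloor>) x) \<longlonglongrightarrow> blinfun_apply K x))"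

lemma T_props:
  assumes s: "s \<ge> 0"
  shows T_bound: "norm (T s) \<le> M * exp (b * s)"
    and P_floor_tendsto: "(\<lambda>n. P n (nat \<lfloor>s / h n\<rfloor>) x) \<longlonglongrightarrow> T s x"
proof -
  obtain K where K: "norm K \<le> M * exp (b * s)" "\<And>x. (\<lambda>n. P n (nat \<lfloor>s / h n\<rfloor>) x) \<longlonglongrightarrow> blinfun_apply K x"
    using strong_limit[OF P_floor_bound[OF s] P_floor_convergent[OF s]] by blast
  then have "norm K \<le> M * exp (b * s) \<and> (\<forall>x. (\<lambda>n. P n (nat \<lfloor>s / h n\<rfloor>) x) \<longlonglongrightarrow> blinfun_apply K x)" by blast
  from someI[of "\<lambda>K. norm K \<le> M * exp (b * s) \<and> (\<forall>x. (\<lambda>n. P n (nat \<lfloor>s / h n\<rfloor>) x) \<longlonglongrightarrow> blinfun_apply K x)", OF this]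
  show "norm (T s) \<le> M * exp (b * s)" "(\<lambda>n. P n (nat \<lfloor>s / h n\<rfloor>) x) \<longlonglongrightarrow> T s x"
    unfolding T_def by blast+
qed

lemma T_0: "T 0 = id_blinfun"
  by (rule blinfun_eqI, rule LIMSEQ_unique[OF P_floor_tendsto]) simp_all

lemma floor_steps: "s \<ge> 0 \<Longrightarrow> (\<lambda>n. real (nat \<lfloor>s / h n\<rfloor>) * h n) \<longlonglongrightarrow> s"
proof (rule tendsto_sandwich[of "\<lambda>n. s - h n" _ _ "\<lambda>n. s"])
  assume s: "s \<ge> 0"
  have "real (nat \<lfloor>s / h n\<rfloor>) \<le> s / h n" "s / h n < real (nat \<lfloor>s / h n\<rfloor>) + 1" for n
    using s h_pos[of n] divide_nonneg_pos[of s "h n"] by linarith+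
  then have "real (nat \<lfloor>s / h n\<rfloor>) * h n \<le> s" "s < (real (nat \<lfloor>s / h n\<rfloor>) + 1) * h n" for n
    using h_pos[of n] by (metis pos_le_divide_eq, metis pos_divide_less_eq)
  then show "\<forall>\<^sub>F n in sequentially. s - h n \<le> real (nat \<lfloor>s / h n\<rfloor>) * h n"
    "\<forall>\<^sub>F n in sequentially. real (nat \<lfloor>s / h n\<rfloor>) * h n \<le> s"
    by (auto simp: algebra_simps intro!: always_eventually less_imp_le)
  show "(\<lambda>n. s - h n) \<longlonglongrightarrow> s" using tendsto_diff[OF tendsto_const h_tendsto] by simp
qed simp

lemma floor_steps_le: "s \<ge> 0 \<Longrightarrow> real (nat \<lfloor>s / h n\<rfloor>) * h n \<le> s"
  using h_pos[of n] by (simp add: pos_le_divide_eq[symmetric])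

text \<open>Serves \<open>T_add\<close>: the rounded step number of a sum of times may exceed the
  sum of the rounded numbers by one, hence by one application of \<open>V n\<close>.\<close>

lemma V_tendsto: "(\<lambda>n. V n x) \<longlonglongrightarrow> x"
proof -
  \<comment> \<open>The bound must not depend on \<open>n\<close>; the convergent sequence
    \<open>h\<close> is bounded, so its supremum can be used.\<close>
  have hM: "norm (V n - id_blinfun) \<le> M * (1 + b * (SUP n. h n)) + 1" for n
  proof -
    have "bdd_above (range h)" using convergent_imp_bounded[OF h_tendsto] by (simp add: bounded_imp_bdd_above)
    then have "h n \<le> (SUP n. h n)" by (simp add: cSUP_upper)
    then have "M * (1 + b * h n) \<le> M * (1 + b * (SUP n. h n))"
      using M_nonneg b_nonneg by (intro mult_left_mono add_left_mono) auto
    moreover have "norm (V n) \<le> M * (1 + b * h n)"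
    proof -
      have "P n 1 = V n" by (rule blinfun_eqI) (simp add: blinfun_pow_Suc)
      then show ?thesis using pow_bound[of n 1] by simp
    qed
    moreover have "norm (id_blinfun :: 'a \<Rightarrow>\<^sub>L 'a) \<le> 1" by (rule norm_blinfun_id_le)
    ultimately show ?thesis using norm_triangle_ineq4[of "V n" id_blinfun] by linarith
  qed
  have "(\<lambda>n. (V n - id_blinfun) x) \<longlonglongrightarrow> 0"
  proof (rule tendsto_zero_on_dense[OF hM Domain_dense])
    fix f assume "f \<in> Domain Zg"
    then obtain y where "(f, y) \<in> Zg" by blast
    from tendsto_scaleR[OF h_tendsto A_tendsto[OF this]]
    show "(\<lambda>n. (V n - id_blinfun) f) \<longlonglongrightarrow> 0" by (simp add: blinfun.diff_left V_eq)
  qed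
  from tendsto_add[OF this tendsto_const[of x]] show ?thesis by (simp add: blinfun.diff_left)
qed

lemma T_add:
  assumes s: "s \<ge> 0" and r: "r \<ge> 0"
  shows "T (s + r) = T s o\<^sub>L T r"
proof (rule blinfun_eqI)
  fix x
  let ?k = "\<lambda>s n. nat \<lfloor>s / h n\<rfloor>"
  have 1: "(\<lambda>n. P n (?k s n) (P n (?k r n) x)) \<longlonglongrightarrow> T s (T r x)"
    by (rule strong_limit_apply[OF P_floor_bound[OF s] P_floor_tendsto[OF s] P_floor_tendsto[OF r]])
  have 2: "(\<lambda>n. P n (?k s n) (P n (?k r n) (V n x))) \<longlonglongrightarrow> T s (T r x)"
    by (rule strong_limit_apply[OF P_floor_bound[OF s] P_floor_tendsto[OF s]],
        rule strong_limit_apply[OF P_floor_bound[OF r] P_floor_tendsto[OF r] V_tendsto])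
  have k: "?k (s + r) n = ?k s n + ?k r n \<or> ?k (s + r) n = Suc (?k s n + ?k r n)" for n
  proof -
    have "s / h n \<ge> 0" "r / h n \<ge> 0" using s r h_pos[of n] by (auto intro: divide_nonneg_pos)
    then show ?thesis by (simp add: add_divide_distrib) linarith
  qed
  have "(\<lambda>n. P n (?k (s + r) n) x - P n (?k s n) (P n (?k r n) x)) \<longlonglongrightarrow> 0"
  proof (rule Lim_null_comparison)
    show "(\<lambda>n. norm (P n (?k s n) (P n (?k r n) (V n x)) - P n (?k s n) (P n (?k r n) x))) \<longlonglongrightarrow> 0"
      using tendsto_norm[OF tendsto_diff[OF 2 1]] by simp
    show "\<forall>\<^sub>F n in sequentially. norm (P n (?k (s + r) n) x - P n (?k s n) (P n (?k r n) x))
      \<le> norm (P n (?k s n) (P n (?k r n) (V n x)) - P n (?k s n) (P n (?k r n) x))"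
    proof (rule always_eventually, rule allI)
      fix n
      show "norm (P n (?k (s + r) n) x - P n (?k s n) (P n (?k r n) x))
        \<le> norm (P n (?k s n) (P n (?k r n) (V n x)) - P n (?k s n) (P n (?k r n) x))"
        using k[of n] blinfun_pow_Suc2[of "V n" "?k s n + ?k r n" x]
        by (auto simp: blinfun_pow_add)
    qed
  qed
  from tendsto_add[OF this 1] have "(\<lambda>n. P n (?k (s + r) n) x) \<longlonglongrightarrow> T s (T r x)" by simp
  then show "T (s + r) x = (T s o\<^sub>L T r) x"
    using LIMSEQ_unique[OF P_floor_tendsto] s r by simp
qed

lemma R_T:
  assumes s: "s \<ge> 0" and l: "l > w"
  shows "R l (T s x) = T s (R l x)"
proof (rule LIMSEQ_unique)
  have lb: "l > b" using l w_ge by simp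
  show "(\<lambda>n. Res n l (P n (nat \<lfloor>s / h n\<rfloor>) x)) \<longlonglongrightarrow> R l (T s x)"
    by (rule strong_limit_apply[OF Res_bound[OF lb] Res_tendsto[OF l] P_floor_tendsto[OF s]])
  show "(\<lambda>n. Res n l (P n (nat \<lfloor>s / h n\<rfloor>) x)) \<longlonglongrightarrow> T s (R l x)"
    unfolding P_Res[OF lb, symmetric]
    by (rule strong_limit_apply[OF P_floor_bound[OF s] P_floor_tendsto[OF s] Res_tendsto[OF l]])
qed

lemma T_lipschitz:
  assumes fy: "(f, y) \<in> Zg" and r: "0 \<le> r" "r \<le> s"
  shows "norm (T s f - T r f) \<le> (s - r) * (M * exp (b * s) * norm y)"
proof (rule LIMSEQ_le)
  let ?k = "\<lambda>s n. nat \<lfloor>s / h n\<rfloor>"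
  have s: "s \<ge> 0" using r by simp
  show "(\<lambda>n. norm (P n (?k s n) f - P n (?k r n) f)) \<longlonglongrightarrow> norm (T s f - T r f)"
    by (intro tendsto_norm tendsto_diff P_floor_tendsto s r)
  show "(\<lambda>n. (real (?k s n) * h n - real (?k r n) * h n) * (M * exp (b * s) * norm (A n f)))
      \<longlonglongrightarrow> (s - r) * (M * exp (b * s) * norm y)"
    by (intro tendsto_mult tendsto_const tendsto_diff floor_steps s r tendsto_norm A_tendsto[OF fy])
  have "norm (P n (?k s n) f - P n (?k r n) f)
      \<le> (real (?k s n) * h n - real (?k r n) * h n) * (M * exp (b * s) * norm (A n f))" for n
  proof -
    have "?k r n \<le> ?k s n" using r h_pos[of n] by (intro nat_mono floor_mono divide_right_mono) auto
    from P_diff[OF this floor_steps_le[OF s]] show ?thesis by (simp add: left_diff_distrib)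
  qed
  then show "\<exists>N. \<forall>n\<ge>N. norm (P n (?k s n) f - P n (?k r n) f)
      \<le> (real (?k s n) * h n - real (?k r n) * h n) * (M * exp (b * s) * norm (A n f))" by blast
qed

text \<open>Orbits of domain vectors are locally Lipschitz; the locally uniform bound and density
  carry continuity over to all vectors.\<close>

lemma T_continuous: "continuous_on {0..} (\<lambda>s. T s f)"
  unfolding continuous_on_iff
proof (intro ballI allI impI)
  fix s e :: real
  assume "s \<in> {0..}" and e: "0 < e"
  then have s: "s \<ge> 0" by simp
  define C where "C = M * exp (b * (s + 1))"
  have C: "C \<ge> 0" using M_nonneg by (simp add: C_def)
  have TC: "norm (T r) \<le> C" if "0 \<le> r" "r \<le> s + 1" for r
    using T_bound[OF that(1)] mult_left_mono[OF _ M_nonneg, of "exp (b * r)" "exp (b * (s + 1))"] that b_nonneg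
    by (simp add: C_def mult_left_mono)
  obtain g where g: "g \<in> Domain Zg" "norm (f - g) < e / 3 / (C + 1)"
    using closure_UNIV_approx[OF Domain_dense, of "e / 3 / (C + 1)" f] e C by auto
  then obtain y where y: "(g, y) \<in> Zg" by blast
  have Cg: "C * norm (f - g) < e / 3"
  proof -
    have "C * norm (f - g) \<le> (C + 1) * norm (f - g)" by (intro mult_right_mono) auto
    also have "\<dots> < e / 3" using g(2) C by (simp add: field_simps)
    finally show ?thesis .
  qed
  define d where "d = min 1 (e / 3 / (C * norm y + 1))"
  have d: "d > 0" using e C by (simp add: d_def add_nonneg_pos)
  have "dist (T r f) (T s f) < e" if r: "r \<ge> 0" "dist r s < d" for r
  proof -
    have rs: "\<bar>r - s\<bar> < 1" "\<bar>r - s\<bar> * (C * norm y + 1) < e / 3"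
    proof -
      have "C * norm y + 1 > 0" using C by (simp add: add_nonneg_pos)
      moreover have "\<bar>r - s\<bar> < e / 3 / (C * norm y + 1)" using r(2) by (simp add: d_def dist_real_def)
      ultimately show "\<bar>r - s\<bar> * (C * norm y + 1) < e / 3" by (simp only: pos_less_divide_eq)
    qed (use r(2) in \<open>simp add: d_def dist_real_def\<close>)
    have lip: "norm (T u g - T v g) \<le> (u - v) * (C * norm y)" if "0 \<le> v" "v \<le> u" "u \<le> s + 1" for u v
    proof -
      have "norm (T u g - T v g) \<le> (u - v) * (M * exp (b * u) * norm y)" by (rule T_lipschitz[OF y that(1,2)])
      also have "\<dots> \<le> (u - v) * (C * norm y)"
        unfolding C_def using that b_nonneg M_nonneg
        by (intro mult_left_mono mult_right_mono) (auto intro: mult_left_mono)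
      finally show ?thesis .
    qed
    have "norm (T r g - T s g) \<le> \<bar>r - s\<bar> * (C * norm y)"
      using lip[of r s] lip[of s r] rs(1) s r(1) by (cases "r \<le> s") (auto simp: norm_minus_commute)
    also have "\<dots> \<le> \<bar>r - s\<bar> * (C * norm y + 1)" by (intro mult_left_mono) auto
    finally have 1: "norm (T r g - T s g) < e / 3" using rs(2) by simp
    have 2: "norm (T r (f - g)) < e / 3" "norm (T s (f - g)) < e / 3"
      using norm_blinfun_le[OF TC, of r "f - g"] norm_blinfun_le[OF TC, of s "f - g"] r s rs(1) Cg by linarith+
    have "T r f - T s f = T r (f - g) + (T r g - T s g) - T s (f - g)" by (simp add: blinfun.diff_right)
    then have "norm (T r f - T s f) \<le> norm (T r (f - g)) + norm (T r g - T s g) + norm (T s (f - g))"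
      using norm_triangle_ineq4[of "T r (f - g) + (T r g - T s g)" "T s (f - g)"]
        norm_triangle_ineq[of "T r (f - g)" "T r g - T s g"] by simp
    then show ?thesis using 1 2 by (simp add: dist_norm)
  qed
  then show "\<exists>d>0. \<forall>r\<in>{0..}. dist r s < d \<longrightarrow> dist (T r f) (T s f) < e" using d by auto
qed

lemma P_first_order:
  assumes "\<And>i. i < k \<Longrightarrow> norm (P n i (A n x) - A n x) \<le> E"
  shows "norm (P n k x - x - (real k * h n) *\<^sub>R A n x) \<le> real k * h n * E"
  using assms
proof (induction k)
  case (Suc k)
  have "P n (Suc k) x - x - (real (Suc k) * h n) *\<^sub>R A n x
    = (P n k x - x - (real k * h n) *\<^sub>R A n x) + h n *\<^sub>R (P n k (A n x) - A n x)"
    unfolding blinfun_pow_Suc2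
    by (simp add: V_eq blinfun.add_right blinfun.scaleR_right scaleR_right_diff_distrib scaleR_left_distrib
        distrib_right)
  moreover have "norm (h n *\<^sub>R (P n k (A n x) - A n x)) \<le> h n * E"
    using Suc.prems[of k] h_pos[of n] by simp
  moreover have "norm (P n k x - x - (real k * h n) *\<^sub>R A n x) \<le> real k * h n * E"
    using Suc.IH Suc.prems by simp
  ultimately have "norm (P n (Suc k) x - x - (real (Suc k) * h n) *\<^sub>R A n x) \<le> real k * h n * E + h n * E"
    using norm_triangle_mono by metis
  then show ?case by (simp add: algebra_simps)
qed simp

text \<open>The vectors \<open>x n\<close> may move, so that \<open>Res n l g\<close> with limit
  \<open>R l g\<close> is covered. The auxiliary \<open>z\<close> is a domain vector close to
  \<open>y\<close>: the powers are Lipschitz on \<open>z\<close>, while \<open>y - z\<close> is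
  controlled by stability alone. For the derivative, \<open>z\<close> is fixed first and
  \<open>s\<close> is made small afterwards. The constant \<open>C\<close> bounds the powers up to
  time 1.\<close>

lemma T_first_order:
  assumes x: "x \<longlonglongrightarrow> f" and Ax: "(\<lambda>n. A n (x n)) \<longlonglongrightarrow> y" and zv: "(z, v) \<in> Zg"
    and s: "0 \<le> s" "s \<le> 1"
  defines "C \<equiv> M * exp b"
  shows "norm (T s f - f - s *\<^sub>R y) \<le> s * ((C + 1) * norm (y - z) + s * (C * norm v))"
proof (rule LIMSEQ_le)
  let ?k = "\<lambda>n. nat \<lfloor>s / h n\<rfloor>"
  have C: "C \<ge> 0" using M_nonneg by (simp add: C_def)
  show "(\<lambda>n. norm (P n (?k n) (x n) - x n - (real (?k n) * h n) *\<^sub>R A n (x n)))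
      \<longlonglongrightarrow> norm (T s f - f - s *\<^sub>R y)"
    using strong_limit_apply[OF P_floor_bound[OF s(1)] P_floor_tendsto[OF s(1)] x]
    by (intro tendsto_norm tendsto_diff tendsto_scaleR floor_steps s x Ax)
  show "(\<lambda>n. (real (?k n) * h n) * ((C + 1) * norm (A n (x n) - z) + s * (C * norm (A n z))))
      \<longlonglongrightarrow> s * ((C + 1) * norm (y - z) + s * (C * norm v))"
    by (intro tendsto_mult tendsto_add tendsto_const tendsto_norm tendsto_diff floor_steps s Ax A_tendsto[OF zv])
  have "norm (P n (?k n) (x n) - x n - (real (?k n) * h n) *\<^sub>R A n (x n))
      \<le> (real (?k n) * h n) * ((C + 1) * norm (A n (x n) - z) + s * (C * norm (A n z)))" for n
  proof (rule P_first_order)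
    fix i assume i: "i < ?k n"
    let ?u = "A n (x n)"
    have ih: "real i * h n \<le> s"
    proof -
      have "real i * h n \<le> real (?k n) * h n" using i h_pos[of n] by (intro mult_right_mono) auto
      then show ?thesis using floor_steps_le[OF s(1), of n] by linarith
    qed
    then have ih1: "real i * h n \<le> 1" using s by linarith
    have PC: "norm (P n i) \<le> C" using P_bound[OF ih1] by (simp add: C_def)
    have 1: "norm (P n i (?u - z)) \<le> C * norm (?u - z)" by (rule norm_blinfun_le[OF PC])
    have "norm (P n i z - z) \<le> real i * h n * (C * norm (A n z))"
      using P_diff[of 0 i n 1 z] ih1 by (simp add: C_def)
    also have "\<dots> \<le> s * (C * norm (A n z))" using ih C by (intro mult_right_mono) auto
    finally have 2: "norm (P n i z - z) \<le> s * (C * norm (A n z))" .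
    have "P n i ?u - ?u = P n i (?u - z) + (P n i z - z) - (?u - z)" by (simp add: blinfun.diff_right)
    then have "norm (P n i ?u - ?u) \<le> norm (P n i (?u - z)) + norm (P n i z - z) + norm (?u - z)"
      using norm_triangle_ineq4[of "P n i (?u - z) + (P n i z - z)" "?u - z"]
        norm_triangle_ineq[of "P n i (?u - z)" "P n i z - z"] by simp
    then show "norm (P n i ?u - ?u) \<le> (C + 1) * norm (?u - z) + s * (C * norm (A n z))"
      using 1 2 by (simp add: distrib_right)
  qed
  then show "\<exists>N. \<forall>n\<ge>N. norm (P n (?k n) (x n) - x n - (real (?k n) * h n) *\<^sub>R A n (x n))
      \<le> (real (?k n) * h n) * ((C + 1) * norm (A n (x n) - z) + s * (C * norm (A n z)))" by blast
qed

lemma T_deriv: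
  assumes x: "x \<longlonglongrightarrow> f" and Ax: "(\<lambda>n. A n (x n)) \<longlonglongrightarrow> y"
  shows "((\<lambda>s. (1 / s) *\<^sub>R (T s f - f)) \<longlongrightarrow> y) (at_right 0)"
proof (rule tendstoI)
  fix e :: real assume e: "e > 0"
  define C where "C = M * exp b"
  have C: "C \<ge> 0" using M_nonneg by (simp add: C_def)
  obtain z where z: "z \<in> Domain Zg" "norm (y - z) < e / 2 / (C + 1)"
    using closure_UNIV_approx[OF Domain_dense, of "e / 2 / (C + 1)" y] e C by auto
  then obtain v where v: "(z, v) \<in> Zg" by blast
  have 1: "(C + 1) * norm (y - z) < e / 2" using z(2) C by (simp add: field_simps)
  define d where "d = min 1 (e / 2 / (C * norm v + 1))"
  have Cv: "C * norm v + 1 > 0" using C by (simp add: add_nonneg_pos)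
  then have d: "d > 0" using e by (simp add: d_def)
  have "dist ((1 / s) *\<^sub>R (T s f - f)) y < e" if s: "0 < s" "s < d" for s
  proof -
    have s1: "s \<le> 1" "s * (C * norm v + 1) < e / 2"
    proof -
      have "s < e / 2 / (C * norm v + 1)" using s by (simp add: d_def)
      then show "s * (C * norm v + 1) < e / 2" using Cv by (simp only: pos_less_divide_eq)
    qed (use s in \<open>simp add: d_def\<close>)
    have "norm (T s f - f - s *\<^sub>R y) \<le> s * ((C + 1) * norm (y - z) + s * (C * norm v))"
      unfolding C_def using s s1 by (intro T_first_order[OF x Ax v]) auto
    also have "\<dots> < s * e"
    proof (rule mult_strict_left_mono)
      show "(C + 1) * norm (y - z) + s * (C * norm v) < e"
        using 1 s1(2) s(1) by (simp add: distrib_left)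
    qed (use s in simp)
    finally have "norm (T s f - f - s *\<^sub>R y) / s < e" using s(1) by (simp add: field_simps)
    moreover have "(1 / s) *\<^sub>R (T s f - f) - y = (1 / s) *\<^sub>R (T s f - f - s *\<^sub>R y)"
      using s(1) by (simp add: scaleR_right_diff_distrib)
    ultimately show ?thesis using s(1) by (simp add: dist_norm)
  qed
  then show "\<forall>\<^sub>F s in at_right 0. dist ((1 / s) *\<^sub>R (T s f - f)) y < e"
    using d by (auto simp: eventually_at_right)
qed

lemma T_deriv_R:
  "l > w \<Longrightarrow> ((\<lambda>s. (1 / s) *\<^sub>R (T s (R l g) - R l g)) \<longlongrightarrow> l *\<^sub>R R l g - g) (at_right 0)"
  by (rule T_deriv[OF Res_tendsto A_Res_tendsto])

text \<open>The pairs with \<open>R l (l *\<^sub>R f - y) = f\<close> form a closed set that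
  contains \<open>Zg\<close>, and they are exactly the displayed range. Conversely, the continuous
  map from \<open>g\<close> to its pair sends the dense range of \<open>l - Zg\<close> into
  \<open>Zg\<close>, hence everything into the closure.\<close>

lemma closure_Zg_eq:
  assumes l: "l > w"
  shows "closure Zg = range (\<lambda>g. (R l g, l *\<^sub>R R l g - g))"
proof
  let ?\<Gamma> = "{(f, y). R l (l *\<^sub>R f - y) = f}"
  have eq: "?\<Gamma> = range (\<lambda>g. (R l g, l *\<^sub>R R l g - g))"
  proof (intro set_eqI iffI)
    fix p assume "p \<in> ?\<Gamma>"
    then obtain f y where p: "p = (f, y)" "R l (l *\<^sub>R f - y) = f" by auto
    then have "p = (\<lambda>g. (R l g, l *\<^sub>R R l g - g)) (l *\<^sub>R f - y)" by simp
    then show "p \<in> range (\<lambda>g. (R l g, l *\<^sub>R R l g - g))" by blast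
  qed auto
  have cl: "closed ?\<Gamma>"
    unfolding case_prod_unfold by (intro closed_Collect_eq continuous_intros)
  have "Zg \<subseteq> ?\<Gamma>" using R_Domain[OF _ l] by auto
  then show "closure Zg \<subseteq> range (\<lambda>g. (R l g, l *\<^sub>R R l g - g))"
    unfolding eq[symmetric] using cl by (rule closure_minimal)
  define \<Phi> where "\<Phi> = (\<lambda>g. (R l g, l *\<^sub>R R l g - g))"
  have "\<Phi> ` ((\<lambda>(f, y). l *\<^sub>R f - y) ` Zg) \<subseteq> Zg"
    by (auto simp: \<Phi>_def R_Domain[OF _ l])
  then have "\<Phi> ` ((\<lambda>(f, y). l *\<^sub>R f - y) ` Zg) \<subseteq> closure Zg" using closure_subset by blast
  then have "\<Phi> ` closure ((\<lambda>(f, y). l *\<^sub>R f - y) ` Zg) \<subseteq> closure Zg"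
    by (intro image_closure_subset closed_closure) (auto simp: \<Phi>_def intro!: continuous_intros)
  then show "range (\<lambda>g. (R l g, l *\<^sub>R R l g - g)) \<subseteq> closure Zg"
    by (simp add: range_dense[OF l] \<Phi>_def)
qed

text \<open>For the direction from derivative to closure, \<open>R l\<close> commutes with the
  semigroup, so the derivative of the orbit of \<open>R l f\<close> is \<open>R l y\<close>; by
  \<open>T_deriv_R\<close> it is also \<open>l *\<^sub>R R l f - f\<close>. Equating the two puts
  \<open>(f, y)\<close> into the form given by \<open>closure_Zg_eq\<close>.\<close>

lemma T_deriv_iff:
  "((\<lambda>s. (1 / s) *\<^sub>R (T s f - f)) \<longlongrightarrow> y) (at_right 0) \<longleftrightarrow> (f, y) \<in> closure Zg"
proof
  define l where "l = w + 1"
  have l: "l > w" by (simp add: l_def)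
  show "((\<lambda>s. (1 / s) *\<^sub>R (T s f - f)) \<longlongrightarrow> y) (at_right 0)" if "(f, y) \<in> closure Zg"
    using that T_deriv_R[OF l] unfolding closure_Zg_eq[OF l] by auto
  assume "((\<lambda>s. (1 / s) *\<^sub>R (T s f - f)) \<longlongrightarrow> y) (at_right 0)"
  then have "((\<lambda>s. R l ((1 / s) *\<^sub>R (T s f - f))) \<longlongrightarrow> R l y) (at_right 0)"
    by (rule blinfun.tendsto[OF tendsto_const])
  moreover have "\<forall>\<^sub>F s in at_right 0. R l ((1 / s) *\<^sub>R (T s f - f)) = (1 / s) *\<^sub>R (T s (R l f) - R l f)"
    by (rule eventually_at_rightI[of 0 1])
      (auto simp: blinfun.scaleR_right blinfun.diff_right R_T[OF _ l])
  ultimately have "((\<lambda>s. (1 / s) *\<^sub>R (T s (R l f) - R l f)) \<longlongrightarrow> R l y) (at_right 0)"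
    using tendsto_cong by fastforce
  then have "R l y = l *\<^sub>R R l f - f"
    using tendsto_unique[OF _ _ T_deriv_R[OF l]] trivial_limit_at_right_real by blast
  then have "R l (l *\<^sub>R f - y) = f" by (simp add: blinfun.diff_right blinfun.scaleR_right)
  then have "(f, y) = (\<lambda>g. (R l g, l *\<^sub>R R l g - g)) (l *\<^sub>R f - y)" by simp
  then show "(f, y) \<in> closure Zg" unfolding closure_Zg_eq[OF l] by blast
qed

lemma closure_Zg_T:
  assumes "(f, y) \<in> closure Zg" "s \<ge> 0"
  shows "(T s f, T s y) \<in> closure Zg"
proof -
  obtain g where "f = R (w + 1) g" "y = (w + 1) *\<^sub>R R (w + 1) g - g"
    using assms(1) unfolding closure_Zg_eq[of "w + 1", simplified] by blast
  then have "(T s f, T s y) = (\<lambda>g. (R (w + 1) g, (w + 1) *\<^sub>R R (w + 1) g - g)) (T s g)"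
    using R_T[OF assms(2), of "w + 1"] by (simp add: blinfun.diff_right blinfun.scaleR_right)
  then show ?thesis unfolding closure_Zg_eq[of "w + 1", simplified] by blast
qed

end

section \<open>Weak compactness\<close>

context banach_over
begin

text \<open>Weak lower semicontinuity of the norm up to a constant; 4 is the product of the two
  factors 2 in \<open>norming_functional\<close>.\<close>

lemma weak_limit_norm_le:
  assumes lim: "\<And>\<phi>. \<phi> \<in> dual_space smul \<Longrightarrow> (\<lambda>n. blinfun_apply \<phi> (u n)) \<longlonglongrightarrow> blinfun_apply \<phi> y"
    and K: "\<forall>\<^sub>F n in sequentially. norm (u n) \<le> K"
  shows "norm y \<le> 4 * K"
proof -
  obtain \<psi> where \<psi>: "\<psi> \<in> dual_space smul" "\<And>x. norm (blinfun_apply \<psi> x) \<le> 2 * norm x"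
    "norm y \<le> 2 * norm (blinfun_apply \<psi> y)"
    using norming_functional[of y] by metis
  have "norm (blinfun_apply \<psi> y) \<le> 2 * K"
  proof (rule tendsto_upperbound[OF tendsto_norm[OF lim[OF \<psi>(1)]]])
    show "\<forall>\<^sub>F n in sequentially. norm (blinfun_apply \<psi> (u n)) \<le> 2 * K"
      using K by eventually_elim (use \<psi>(2) in \<open>smt (verit)\<close>)
  qed simp
  then show ?thesis using \<psi>(3) by linarith
qed

lemma weakly_convergent_if_tendsto: "u \<longlonglongrightarrow> x \<Longrightarrow> weakly_convergent smul u"
  unfolding weakly_convergent_def by (blast intro: blinfun.tendsto[OF tendsto_const])

lemma weak_compact_if_convergent:
  assumes "convergent u"
  shows "every_subseq_has_weakly_convergent_subseq smul u"
  unfolding every_subseq_has_weakly_convergent_subseq_def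
proof (intro allI impI)
  fix p :: "nat \<Rightarrow> nat" assume p: "strict_mono p"
  from assms obtain x where "u \<longlonglongrightarrow> x" by (auto simp: convergent_def)
  then have "(u \<circ> p \<circ> id) \<longlonglongrightarrow> x" using LIMSEQ_subseq_LIMSEQ[OF _ p] by (simp add: o_def)
  then show "\<exists>q. strict_mono q \<and> weakly_convergent smul (u \<circ> p \<circ> q)"
    using weakly_convergent_if_tendsto strict_mono_id by blast
qed

text \<open>Along a diagonal subsequence every \<open>v j\<close> has a weak limit
  \<open>y j\<close>. Since \<open>v i\<close> and \<open>v j\<close> are both close to
  \<open>u\<close>, \<open>weak_limit_norm_le\<close> makes the \<open>y j\<close> a Cauchy sequence
  in norm, and its limit is the weak limit of \<open>u\<close> along the diagonal.\<close>

lemma weak_compact_if_approximable: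
  assumes approx: "\<And>e. e > 0 \<Longrightarrow> \<exists>v. every_subseq_has_weakly_convergent_subseq smul v \<and>
      (\<forall>\<^sub>F n in sequentially. norm (u n - v n) \<le> e)"
  shows "every_subseq_has_weakly_convergent_subseq smul u"
  unfolding every_subseq_has_weakly_convergent_subseq_def
proof (intro allI impI)
  fix p :: "nat \<Rightarrow> nat" assume p: "strict_mono p"
  define \<epsilon> where "\<epsilon> = (\<lambda>j. inverse (real (Suc j)))"
  have eps: "\<epsilon> j > 0" for j by (simp add: \<epsilon>_def)
  have eps0: "\<epsilon> \<longlonglongrightarrow> 0" unfolding \<epsilon>_def by (rule LIMSEQ_inverse_real_of_nat)
  obtain v where v: "\<And>j. every_subseq_has_weakly_convergent_subseq smul (v j)"
    "\<And>j. \<forall>\<^sub>F n in sequentially. norm (u n - v j n) \<le> \<epsilon> j"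
    using approx[OF eps] by metis
  interpret subseqs "\<lambda>j s. weakly_convergent smul (v j \<circ> p \<circ> s)"
  proof
    fix j and s :: "nat \<Rightarrow> nat" assume "strict_mono s"
    then have "strict_mono (p \<circ> s)" using p by (simp add: strict_mono_o)
    then show "\<exists>r'. strict_mono r' \<and> weakly_convergent smul (v j \<circ> p \<circ> (s \<circ> r'))"
      using v(1)[of j] unfolding every_subseq_has_weakly_convergent_subseq_def by (metis comp_assoc)
  qed
  define d where "d = p \<circ> diagseq"
  have d: "strict_mono d" using p subseq_diagseq by (simp add: d_def strict_mono_o)
  \<comment> \<open>The diagonal is a subsequence of the j-th selection only from index
    \<open>Suc j\<close> on; the shift is removed once the limits are named.\<close>
  have diag: "weakly_convergent smul (v j \<circ> p \<circ> (diagseq \<circ> (+) (Suc j)))" for j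
  proof (rule diagseq_holds)
    fix r s :: "nat \<Rightarrow> nat" and n
    assume r: "strict_mono r" and s: "weakly_convergent smul (v n \<circ> p \<circ> s)"
    then obtain x where
      "\<And>\<phi>. \<phi> \<in> dual_space smul \<Longrightarrow> (\<lambda>i. blinfun_apply \<phi> ((v n \<circ> p \<circ> s) i)) \<longlonglongrightarrow> blinfun_apply \<phi> x"
      unfolding weakly_convergent_def by blast
    from LIMSEQ_subseq_LIMSEQ[OF this r]
    show "weakly_convergent smul (v n \<circ> p \<circ> (s \<circ> r))"
      unfolding weakly_convergent_def by (auto simp: o_def)
  qed
  have "v j \<circ> p \<circ> (diagseq \<circ> (+) (Suc j)) = (\<lambda>n. v j (d (n + Suc j)))" for j
    by (rule ext) (simp add: d_def add.commute[of j])
  then have "weakly_convergent smul (\<lambda>n. v j (d (n + Suc j)))" for j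
    using diag[of j] by simp
  then have "\<exists>y. \<forall>\<phi>\<in>dual_space smul. (\<lambda>n. blinfun_apply \<phi> (v j (d (n + Suc j)))) \<longlonglongrightarrow> blinfun_apply \<phi> y" for j
    unfolding weakly_convergent_def by blast
  then obtain y where "\<And>j \<phi>. \<phi> \<in> dual_space smul \<Longrightarrow>
      (\<lambda>n. blinfun_apply \<phi> (v j (d (n + Suc j)))) \<longlonglongrightarrow> blinfun_apply \<phi> (y j)"
    by metis
  then have y: "(\<lambda>n. blinfun_apply \<phi> (v j (d n))) \<longlonglongrightarrow> blinfun_apply \<phi> (y j)"
    if "\<phi> \<in> dual_space smul" for j \<phi>
    using that LIMSEQ_offset[of "\<lambda>n. blinfun_apply \<phi> (v j (d n))" "Suc j"] by blast
  have ud: "\<forall>\<^sub>F n in sequentially. norm (u (d n) - v j (d n)) \<le> \<epsilon> j" for j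
    using eventually_subseq[OF d v(2)] .
  have dist: "norm (y i - y j) \<le> 4 * (\<epsilon> i + \<epsilon> j)" for i j
  proof (rule weak_limit_norm_le)
    show "(\<lambda>n. blinfun_apply \<phi> (v i (d n) - v j (d n))) \<longlonglongrightarrow> blinfun_apply \<phi> (y i - y j)"
      if "\<phi> \<in> dual_space smul" for \<phi>
      unfolding blinfun.diff_right by (intro tendsto_diff y that)
    show "\<forall>\<^sub>F n in sequentially. norm (v i (d n) - v j (d n)) \<le> \<epsilon> i + \<epsilon> j"
      using ud[of i] ud[of j]
    proof eventually_elim
      case (elim n)
      then show ?case
        using norm_triangle_ineq4[of "u (d n) - v j (d n)" "u (d n) - v i (d n)"] by simp
    qed
  qed
  have "Cauchy y"
  proof (rule CauchyI)
    fix e :: real assume e: "e > 0"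
    obtain N where N: "\<And>n. n \<ge> N \<Longrightarrow> \<epsilon> n < e / 8"
      using LIMSEQ_D[OF eps0, of "e / 8"] e eps by (auto simp: abs_of_pos)
    have "norm (y m - y n) < e" if "m \<ge> N" "n \<ge> N" for m n
      using dist[of m n] N[OF that(1)] N[OF that(2)] by simp
    then show "\<exists>N. \<forall>m\<ge>N. \<forall>n\<ge>N. norm (y m - y n) < e" by blast
  qed
  then obtain a where a: "y \<longlonglongrightarrow> a" using Cauchy_convergent convergent_def by blast
  have "(\<lambda>n. blinfun_apply \<psi> (u (d n))) \<longlonglongrightarrow> blinfun_apply \<psi> a" if \<psi>: "\<psi> \<in> dual_space smul" for \<psi>
  proof (rule tendstoI)
    fix e :: real assume e: "e > 0"
    have "(\<lambda>j. norm \<psi> * \<epsilon> j + norm (blinfun_apply \<psi> (y j - a))) \<longlonglongrightarrow> norm \<psi> * 0 + norm (blinfun_apply \<psi> (a - a))"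
      by (intro tendsto_intros eps0 a)
    then have "\<forall>\<^sub>F j in sequentially. norm \<psi> * \<epsilon> j + norm (blinfun_apply \<psi> (y j - a)) < e / 2"
      by (rule order_tendstoD(2)) (use e in \<open>simp add: blinfun.zero_right\<close>)
    then obtain j where j: "norm \<psi> * \<epsilon> j + norm (blinfun_apply \<psi> (y j - a)) < e / 2"
      by (auto simp: eventually_sequentially)
    have "\<forall>\<^sub>F n in sequentially. dist (blinfun_apply \<psi> (v j (d n))) (blinfun_apply \<psi> (y j)) < e / 2"
      using tendstoD[OF y[OF \<psi>, of j], of "e / 2"] e by simp
    then show "\<forall>\<^sub>F n in sequentially. dist (blinfun_apply \<psi> (u (d n))) (blinfun_apply \<psi> a) < e"
      using ud[of j]
    proof eventually_elim
      case (elim n)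
      have "norm (blinfun_apply \<psi> (u (d n) - v j (d n))) \<le> norm \<psi> * \<epsilon> j"
        using norm_blinfun[of \<psi> "u (d n) - v j (d n)"] mult_left_mono[OF elim(2) norm_ge_zero[of \<psi>]] by linarith
      moreover have "blinfun_apply \<psi> (u (d n)) - blinfun_apply \<psi> a = blinfun_apply \<psi> (u (d n) - v j (d n))
          + (blinfun_apply \<psi> (v j (d n)) - blinfun_apply \<psi> (y j)) + blinfun_apply \<psi> (y j - a)"
        by (simp add: blinfun.diff_right)
      then have "norm (blinfun_apply \<psi> (u (d n)) - blinfun_apply \<psi> a) \<le> norm (blinfun_apply \<psi> (u (d n) - v j (d n)))
          + norm (blinfun_apply \<psi> (v j (d n)) - blinfun_apply \<psi> (y j)) + norm (blinfun_apply \<psi> (y j - a))"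
        using norm_triangle_ineq[of "blinfun_apply \<psi> (u (d n) - v j (d n))
            + (blinfun_apply \<psi> (v j (d n)) - blinfun_apply \<psi> (y j))" "blinfun_apply \<psi> (y j - a)"]
          norm_triangle_ineq[of "blinfun_apply \<psi> (u (d n) - v j (d n))"
            "blinfun_apply \<psi> (v j (d n)) - blinfun_apply \<psi> (y j)"] by simp
      ultimately show ?case using elim(1) j unfolding dist_norm by linarith
    qed
  qed
  then have "weakly_convergent smul (u \<circ> p \<circ> diagseq)"
    unfolding weakly_convergent_def d_def by auto
  then show "\<exists>q. strict_mono q \<and> weakly_convergent smul (u \<circ> p \<circ> q)" using subseq_diagseq by blast
qed

text \<open>Evaluation at \<open>x\<close> is weak-* continuous, so the functionals that do not
  vanish at \<open>x\<close> form an open set; if it contained \<open>\<psi>\<close>, it would meet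
  \<open>D\<close>.\<close>

lemma weak_star_dense_separates:
  assumes D: "weak_star_topology smul closure_of D = dual_space smul"
    and x: "\<And>\<phi>. \<phi> \<in> D \<Longrightarrow> blinfun_apply \<phi> x = 0" and \<psi>: "\<psi> \<in> dual_space smul"
  shows "blinfun_apply \<psi> x = 0"
proof (rule ccontr)
  assume nz: "blinfun_apply \<psi> x \<noteq> 0"
  let ?T = "product_topology (\<lambda>_::'a. euclidean :: 'k topology) UNIV"
  have "continuous_map ?T euclidean (\<lambda>g. g x)" by (rule continuous_map_product_projection) simp
  then have "openin ?T {g \<in> topspace ?T. g x \<in> - {0}}"
    by (rule openin_continuous_map_preimage) auto
  then have "openin (weak_star_topology smul) (blinfun_apply -` {g. g x \<noteq> 0} \<inter> dual_space smul)"
    unfolding weak_star_topology_def openin_pullback_topology by auto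
  moreover have "\<psi> \<in> weak_star_topology smul closure_of D" using D \<psi> by simp
  then have "\<forall>O'. \<psi> \<in> O' \<and> openin (weak_star_topology smul) O' \<longrightarrow> (\<exists>\<phi>. \<phi> \<in> D \<and> \<phi> \<in> O')"
    by (simp add: in_closure_of)
  moreover have "\<psi> \<in> blinfun_apply -` {g. g x \<noteq> 0} \<inter> dual_space smul" using nz \<psi> by simp
  ultimately obtain \<phi> where "\<phi> \<in> D" "\<phi> \<in> blinfun_apply -` {g. g x \<noteq> 0} \<inter> dual_space smul"
    by meson
  then show False using x by simp
qed

text \<open>Otherwise \<open>\<psi>\<close> stays away from 0 along a subsequence. Refining it for
  \<open>y\<close> and then for \<open>z\<close> gives the differences a weak limit, which
  \<open>D\<close> annihilates and therefore \<open>\<psi>\<close> as well.\<close>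

lemma weak_compact_diff_null:
  assumes D: "weak_star_topology smul closure_of D = dual_space smul" "D \<subseteq> dual_space smul"
    and y: "every_subseq_has_weakly_convergent_subseq smul y"
    and z: "every_subseq_has_weakly_convergent_subseq smul z"
    and null: "\<And>\<phi>. \<phi> \<in> D \<Longrightarrow> (\<lambda>n. blinfun_apply \<phi> (y n - z n)) \<longlonglongrightarrow> 0"
    and \<psi>: "\<psi> \<in> dual_space smul"
  shows "(\<lambda>n. blinfun_apply \<psi> (y n - z n)) \<longlonglongrightarrow> 0"
proof (rule tendstoI, rule ccontr)
  fix e :: real assume e: "e > 0"
  assume "\<not> (\<forall>\<^sub>F n in sequentially. dist (blinfun_apply \<psi> (y n - z n)) 0 < e)"
  then obtain p :: "nat \<Rightarrow> nat" where p: "strict_mono p" "\<And>n. \<not> dist (blinfun_apply \<psi> (y (p n) - z (p n))) 0 < e"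
    using not_eventually_sequentiallyD by blast
  obtain q where q: "strict_mono q" "weakly_convergent smul (y \<circ> p \<circ> q)"
    using y p(1) unfolding every_subseq_has_weakly_convergent_subseq_def by blast
  obtain r where r: "strict_mono r" "weakly_convergent smul (z \<circ> (p \<circ> q) \<circ> r)"
    using z strict_mono_o[OF p(1) q(1)] unfolding every_subseq_has_weakly_convergent_subseq_def by blast
  define d where "d = p \<circ> q \<circ> r"
  have d: "strict_mono d" using p q r by (simp add: d_def strict_mono_o)
  obtain a where a: "\<And>\<phi>. \<phi> \<in> dual_space smul \<Longrightarrow> (\<lambda>n. blinfun_apply \<phi> ((y \<circ> p \<circ> q) n)) \<longlonglongrightarrow> blinfun_apply \<phi> a"
    using q(2) unfolding weakly_convergent_def by blast
  obtain c where c: "\<And>\<phi>. \<phi> \<in> dual_space smul \<Longrightarrow> (\<lambda>n. blinfun_apply \<phi> (z (d n))) \<longlonglongrightarrow> blinfun_apply \<phi> c"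
    using r(2) unfolding weakly_convergent_def d_def by (auto simp: o_def)
  have lim: "(\<lambda>n. blinfun_apply \<phi> (y (d n) - z (d n))) \<longlonglongrightarrow> blinfun_apply \<phi> (a - c)"
    if "\<phi> \<in> dual_space smul" for \<phi>
    using tendsto_diff[OF LIMSEQ_subseq_LIMSEQ[OF a[OF that] r(1)] c[OF that]]
    by (simp add: blinfun.diff_right d_def o_def)
  have "blinfun_apply \<phi> (a - c) = 0" if "\<phi> \<in> D" for \<phi>
    using LIMSEQ_unique[OF lim LIMSEQ_subseq_LIMSEQ[OF null[OF that] d, unfolded o_def]] that D(2) by blast
  then have "blinfun_apply \<psi> (a - c) = 0" by (rule weak_star_dense_separates[OF D(1) _ \<psi>])
  then have "(\<lambda>n. blinfun_apply \<psi> (y (d n) - z (d n))) \<longlonglongrightarrow> 0" using lim[OF \<psi>] by simp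
  then have "\<forall>\<^sub>F n in sequentially. dist (blinfun_apply \<psi> (y (d n) - z (d n))) 0 < e" using e by (rule tendstoD)
  then obtain n where "dist (blinfun_apply \<psi> (y (d n) - z (d n))) 0 < e" by (auto simp: eventually_sequentially)
  then show False using p(2)[of "q (r n)"] by (simp add: d_def)
qed

end

section \<open>Dominated convergence for step functions\<close>

lemma step_function_has_integral:
  fixes f :: "nat \<Rightarrow> real"
  assumes m: "m > 0"
  shows "((\<lambda>s. f (nat \<lfloor>m * s\<rfloor>)) has_integral (\<Sum>k<K. f k) / m) {0..real K / m}"
proof (induction K)
  case (Suc K)
  have le: "real K / m \<le> real (Suc K) / m" using m by (simp add: divide_right_mono)
  from has_integral_const_real[of "f K" "real K / m" "real (Suc K) / m"]
  have "((\<lambda>s. f K) has_integral f K / m) {real K / m..real (Suc K) / m}"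
    using le by (simp add: diff_divide_distrib[symmetric])
  \<comment> \<open>At the right end point the floor already jumps to \<open>K + 1\<close>; this
    single point does not change the integral.\<close>
  then have "((\<lambda>s. f (nat \<lfloor>m * s\<rfloor>)) has_integral f K / m) {real K / m..real (Suc K) / m}"
  proof (rule has_integral_spike_finite[of "{real (Suc K) / m}", rotated 2])
    fix s assume "s \<in> {real K / m..real (Suc K) / m} - {real (Suc K) / m}"
    then have "real K \<le> m * s" "m * s < real K + 1" using m by (auto simp: field_simps)
    then have "nat \<lfloor>m * s\<rfloor> = K" by linarith
    then show "f (nat \<lfloor>m * s\<rfloor>) = f K" by simp
  qed simp
  from has_integral_combine[OF _ le Suc.IH this] m show ?case
    by (simp add: add_divide_distrib)
qed (use has_integral_refl(2)[of "\<lambda>s. f (nat \<lfloor>m * s\<rfloor>)" 0] in simp)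

text \<open>The average is the integral over [0, S] of a step function in \<open>s\<close>, so
  dominated convergence needs the limit only for each \<open>s\<close> separately.\<close>

lemma step_function_average_null:
  fixes e :: "nat \<Rightarrow> nat \<Rightarrow> real"
  assumes C: "\<And>n k. k \<le> Suc n * S \<Longrightarrow> \<bar>e n k\<bar> \<le> C"
    and lim: "\<And>s. s \<ge> 0 \<Longrightarrow> (\<lambda>n. e n (nat \<lfloor>real (Suc n) * s\<rfloor>)) \<longlonglongrightarrow> 0"
  shows "(\<lambda>n. (\<Sum>k<Suc n * S. e n k) / real (Suc n)) \<longlonglongrightarrow> 0"
proof -
  have I: "((\<lambda>s. e n (nat \<lfloor>real (Suc n) * s\<rfloor>)) has_integral (\<Sum>k<Suc n * S. e n k) / real (Suc n)) {0..real S}" for n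
    using step_function_has_integral[of "real (Suc n)" "e n" "Suc n * S"]
    by (simp only: of_nat_mult) (simp del: of_nat_Suc)
  have "(\<lambda>n. integral {0..real S} (\<lambda>s. e n (nat \<lfloor>real (Suc n) * s\<rfloor>))) \<longlonglongrightarrow> integral {0..real S} (\<lambda>s. 0)"
  proof (rule dominated_convergence(2))
    show "(\<lambda>s. e n (nat \<lfloor>real (Suc n) * s\<rfloor>)) integrable_on {0..real S}" for n using I by blast
    show "(\<lambda>s. C) integrable_on {0..real S}" by (rule integrable_const_ivl)
    show "norm (e n (nat \<lfloor>real (Suc n) * s\<rfloor>)) \<le> C" if "s \<in> {0..real S}" for n s
    proof -
      have "real (Suc n) * s \<le> real (Suc n) * real S" using that by (intro mult_left_mono) auto
      then have "real (Suc n) * s \<le> real (Suc n * S)" by (simp only: of_nat_mult)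
      then have "nat \<lfloor>real (Suc n) * s\<rfloor> \<le> Suc n * S" by linarith
      then show ?thesis using C by simp
    qed
  qed (use lim in auto)
  then show ?thesis by (simp only: integral_unique[OF I] integral_0)
qed

section \<open>The resolvent of a generator\<close>

text \<open>Growth is recorded at integer times; accordingly, the Laplace transforms are truncated
  at integers when \<open>k\<close> grows.\<close>

lemma semigroup_pow:
  assumes T0: "T 0 = id_blinfun" and T_add: "\<And>s r. s \<ge> 0 \<Longrightarrow> r \<ge> 0 \<Longrightarrow> T (s + r) = T s o\<^sub>L T r"
  shows "norm (T (real k) x) \<le> norm (T 1) ^ k * norm x"
proof (induction k)
  case 0
  show ?case by (simp add: T0)
next
  case (Suc k)
  have "T (real (Suc k)) x = T 1 (T (real k) x)" using T_add[of 1 "real k"] by simp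
  then have "norm (T (real (Suc k)) x) \<le> norm (T 1) * norm (T (real k) x)" by (simp add: norm_blinfun)
  also have "\<dots> \<le> norm (T 1) * (norm (T 1) ^ k * norm x)" by (intro mult_left_mono Suc.IH) simp
  finally show ?case by simp
qed

text \<open>In terms of the generator, \<open>l - generator\<close> sends \<open>w\<close> to
  \<open>g\<close> minus the boundary term of the truncation. Applying \<open>T r\<close> moves the
  window of integration from [0, k] to [r, k + r] and multiplies by \<open>exp (l * r)\<close>,
  which makes the difference quotient computable.\<close>

lemma semigroup_truncated_laplace:
  fixes T :: "real \<Rightarrow> 'a::banach \<Rightarrow>\<^sub>L 'a" and l :: real and g :: 'a
  assumes T0: "T 0 = id_blinfun" and T_add: "\<And>s r. s \<ge> 0 \<Longrightarrow> r \<ge> 0 \<Longrightarrow> T (s + r) = T s o\<^sub>L T r"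
    and cont: "\<And>f. continuous_on {0..} (\<lambda>s. T s f)" and k: "k \<ge> 0"
  defines "w \<equiv> integral {0..k} (\<lambda>s. exp (- (l * s)) *\<^sub>R T s g)"
  shows "((\<lambda>r. (1 / r) *\<^sub>R (T r w - w)) \<longlongrightarrow> l *\<^sub>R w - (g - exp (- (l * k)) *\<^sub>R T k g)) (at_right 0)"
proof -
  define u where "u = (\<lambda>s. exp (- (l * s)) *\<^sub>R T s g)"
  have u: "continuous_on {0..} u" unfolding u_def by (intro continuous_intros cont)
  have uc: "continuous_on {a..b} u" if "0 \<le> a" for a b
    by (rule continuous_on_subset[OF u]) (use that in auto)
  have uk: "continuous_on {0..b} (\<lambda>s. u (k + s))" for b
    by (rule continuous_on_compose2[OF u]) (use k in \<open>auto intro!: continuous_intros\<close>)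
  have w: "w = integral {0..k} u" by (simp add: w_def u_def)
  \<comment> \<open>A form of \<open>T r w\<close> in which \<open>r\<close> enters only through the
    exponential and the upper limits of integrals, so the fundamental theorem of calculus applies;
    the windows differ by two integrals over [0, r].\<close>
  define \<phi> where "\<phi> = (\<lambda>r. exp (l * r) *\<^sub>R (w + (integral {0..r} (\<lambda>s. u (k + s)) - integral {0..r} u)))"
  have T\<phi>: "T r w = \<phi> r" if r: "r \<ge> 0" for r
  proof -
    have "T r w = integral {0..k} (\<lambda>s. T r (u s))"
      unfolding w using integral_linear[OF integrable_continuous_real[OF uc] blinfun.bounded_linear_right, of 0 k "T r"]
      by (simp add: o_def)
    also have "\<dots> = integral {0..k} (\<lambda>s. exp (l * r) *\<^sub>R u (r + s))"
    proof (rule integral_cong)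
      fix s assume s: "s \<in> {0..k}"
      have "exp (l * r) * exp (- (l * (r + s))) = exp (- (l * s))"
        by (simp add: exp_add[symmetric] algebra_simps)
      then show "T r (u s) = exp (l * r) *\<^sub>R u (r + s)"
        using T_add[of r s] r s by (simp add: u_def blinfun.scaleR_right)
    qed
    also have "\<dots> = exp (l * r) *\<^sub>R integral {r..k + r} u"
      using integral_shift_Icc_real[of 0 k u r] by (simp add: o_def)
    also have "integral {r..k + r} u = w + (integral {0..r} (\<lambda>s. u (k + s)) - integral {0..r} u)"
    proof -
      have "integral {0..r} u + integral {r..k + r} u = integral {0..k + r} u"
        using r k by (intro Henstock_Kurzweil_Integration.integral_combine integrable_continuous_real uc) auto
      also have "\<dots> = integral {0..k} u + integral {k..k + r} u"
        using r k by (intro Henstock_Kurzweil_Integration.integral_combine[symmetric] integrable_continuous_real uc) auto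
      also have "integral {k..k + r} u = integral {0..r} (\<lambda>s. u (k + s))"
        using integral_shift_Icc_real[of 0 r u k] by (simp add: o_def add.commute)
      finally show ?thesis by (simp add: w algebra_simps)
    qed
    finally show ?thesis by (simp add: \<phi>_def)
  qed
  have "((\<lambda>r. w + (integral {0..r} (\<lambda>s. u (k + s)) - integral {0..r} u)) has_vector_derivative 0 + (u (k + 0) - u 0))
      (at 0 within {0..1})"
    by (intro has_vector_derivative_add has_vector_derivative_diff has_vector_derivative_const
        integral_has_vector_derivative uk uc) auto
  moreover have "((\<lambda>r. exp (l * r)) has_field_derivative l) (at 0 within {0..1})"
    by (auto intro!: derivative_eq_intros)
  ultimately have "(\<phi> has_vector_derivative
      (exp (l * 0) *\<^sub>R (0 + (u (k + 0) - u 0)) + l *\<^sub>R (w + (integral {0..0} (\<lambda>s. u (k + s)) - integral {0..0} u))))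
      (at 0 within {0..1})"
    unfolding \<phi>_def by (intro has_vector_derivative_scaleR)
  then have "(\<phi> has_vector_derivative (u k - u 0 + l *\<^sub>R w)) (at 0 within {0..1})" by simp
  then have "((\<lambda>r. (1 / norm (r - 0)) *\<^sub>R (\<phi> r - (\<phi> 0 + (r - 0) *\<^sub>R (u k - u 0 + l *\<^sub>R w)))) \<longlongrightarrow> 0) (at 0 within {0..1})"
    unfolding has_vector_derivative_def has_derivative_within by blast
  then have "((\<lambda>r. (1 / norm (r - 0)) *\<^sub>R (\<phi> r - (\<phi> 0 + (r - 0) *\<^sub>R (u k - u 0 + l *\<^sub>R w)))) \<longlongrightarrow> 0) (at_right 0)"
    by (simp add: at_within_Icc_at_right)
  moreover have "\<forall>\<^sub>F r in at_right 0. (1 / norm (r - 0)) *\<^sub>R (\<phi> r - (\<phi> 0 + (r - 0) *\<^sub>R (u k - u 0 + l *\<^sub>R w)))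
      = (1 / r) *\<^sub>R (T r w - w) - (u k - u 0 + l *\<^sub>R w)"
  proof (rule eventually_at_rightI[of 0 1])
    fix r :: real assume r: "r \<in> {0<..<1}"
    have "\<phi> 0 = w" by (simp add: \<phi>_def)
    then show "(1 / norm (r - 0)) *\<^sub>R (\<phi> r - (\<phi> 0 + (r - 0) *\<^sub>R (u k - u 0 + l *\<^sub>R w)))
      = (1 / r) *\<^sub>R (T r w - w) - (u k - u 0 + l *\<^sub>R w)"
      using r by (simp add: T\<phi> diff_diff_add[symmetric] scaleR_right_diff_distrib)
  qed simp
  ultimately have "((\<lambda>r. (1 / r) *\<^sub>R (T r w - w) - (u k - u 0 + l *\<^sub>R w)) \<longlongrightarrow> 0) (at_right 0)"
    by (rule Lim_transform_eventually)
  then have "((\<lambda>r. (1 / r) *\<^sub>R (T r w - w)) \<longlongrightarrow> u k - u 0 + l *\<^sub>R w) (at_right 0)" by (simp add: LIM_zero_iff)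
  moreover have "u k - u 0 + l *\<^sub>R w = l *\<^sub>R w - (g - exp (- (l * k)) *\<^sub>R T k g)" by (simp add: u_def T0)
  ultimately show ?thesis by simp
qed

text \<open>Truncation at time \<open>k\<close> leaves a boundary term that decays geometrically,
  with ratio \<open>norm (T 1) * exp (- l) < 1\<close> because
  \<open>norm (T 1) < l < exp l\<close>.\<close>

lemma generator_range_dense:
  fixes T :: "real \<Rightarrow> 'a::banach \<Rightarrow>\<^sub>L 'a"
  assumes T0: "T 0 = id_blinfun" and T_add: "\<And>s r. s \<ge> 0 \<Longrightarrow> r \<ge> 0 \<Longrightarrow> T (s + r) = T s o\<^sub>L T r"
    and cont: "\<And>f. continuous_on {0..} (\<lambda>s. T s f)" and l: "l > norm (T 1)"
  shows "closure {l *\<^sub>R w - v |w v. ((\<lambda>r. (1 / r) *\<^sub>R (T r w - w)) \<longlongrightarrow> v) (at_right 0)} = UNIV"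
    (is "closure ?S = UNIV")
proof -
  have "g \<in> closure ?S" for g
  proof -
    have S: "g - exp (- (l * real k)) *\<^sub>R T (real k) g \<in> ?S" for k
    proof -
      let ?w = "integral {0..real k} (\<lambda>s. exp (- (l * s)) *\<^sub>R T s g)"
      have "g - exp (- (l * real k)) *\<^sub>R T (real k) g
          = l *\<^sub>R ?w - (l *\<^sub>R ?w - (g - exp (- (l * real k)) *\<^sub>R T (real k) g))" by simp
      moreover have "((\<lambda>r. (1 / r) *\<^sub>R (T r ?w - ?w)) \<longlongrightarrow> l *\<^sub>R ?w - (g - exp (- (l * real k)) *\<^sub>R T (real k) g))
          (at_right 0)"
        by (rule semigroup_truncated_laplace) (use T0 T_add cont in auto)
      ultimately show ?thesis by blast
    qed
    define c where "c = norm (T 1) * exp (- l)"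
    have "norm (T 1) < exp l" using l exp_ge_add_one_self[of l] by linarith
    then have c: "0 \<le> c" "c < 1" by (simp_all add: c_def exp_minus field_simps)
    have "(\<lambda>k. exp (- (l * real k)) *\<^sub>R T (real k) g) \<longlonglongrightarrow> 0"
    proof (rule Lim_null_comparison)
      have "norm (exp (- (l * real k)) *\<^sub>R T (real k) g) \<le> c ^ k * norm g" for k
      proof -
        have "norm (exp (- (l * real k)) *\<^sub>R T (real k) g) \<le> exp (- l) ^ k * (norm (T 1) ^ k * norm g)"
          using semigroup_pow[of T k g] T0 T_add by (simp add: exp_of_nat_mult[symmetric] mult.commute)
        then show ?thesis by (simp add: c_def power_mult_distrib mult_ac)
      qed
      then show "\<forall>\<^sub>F k in sequentially. norm (exp (- (l * real k)) *\<^sub>R T (real k) g) \<le> c ^ k * norm g" by simp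
      show "(\<lambda>k. c ^ k * norm g) \<longlonglongrightarrow> 0" using c by (intro tendsto_mult_left_zero LIMSEQ_realpow_zero)
    qed
    from tendsto_diff[OF tendsto_const[of g] this]
    have "(\<lambda>k. g - exp (- (l * real k)) *\<^sub>R T (real k) g) \<longlonglongrightarrow> g" by simp
    then show ?thesis
      unfolding closure_sequential using S
      by (intro exI[of _ "\<lambda>k. g - exp (- (l * real k)) *\<^sub>R T (real k) g"]) simp
  qed
  then show ?thesis by blast
qed

section \<open>Approximations of a densely defined operator\<close>

lemma closure_op_eq_Some:
  assumes "closable Z"
  shows "closure_op Z f = Some g \<longleftrightarrow> (f, g) \<in> closure (Map.graph Z)"
proof -
  have "(THE g'. (f, g') \<in> closure (Map.graph Z)) = g" if "(f, g) \<in> closure (Map.graph Z)" for g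
    using that assms unfolding closable_def by (intro the_equality) (auto dest: single_valuedD)
  then show ?thesis by (auto simp: closure_op_def)
qed

lemma strong_deriv0_eq_Some:
  fixes T :: "real \<Rightarrow> 'e::real_normed_vector \<Rightarrow>\<^sub>L 'e"
  shows "strong_deriv0 UNIV T f = Some y \<longleftrightarrow> ((\<lambda>s. (1 / s) *\<^sub>R (T s f - T 0 f)) \<longlongrightarrow> y) (at_right 0)"
  unfolding strong_deriv0_def Let_def
  using tendsto_Lim[OF trivial_limit_at_right_real] by (auto split: if_splits)

text \<open>\<open>F_pow\<close> is the stability bound for \<open>n = 1\<close>, which carries all
  of it because \<open>s\<close> is arbitrary; \<open>F_deriv\<close> is hypothesis (i). Steps are
  indexed from 0, with length \<open>t / real (Suc n)\<close>.\<close>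

locale chernoff_setting = banach_over smul
  for smul :: "'k::real_or_complex \<Rightarrow> 'a::banach \<Rightarrow> 'a" +
  fixes Z :: "'a \<rightharpoonup> 'a" and t :: real and F :: "real \<Rightarrow> 'a \<Rightarrow>\<^sub>L 'a" and M a :: real
  assumes Z_linear: "linear_operator smul Z"
    and Z_dense: "closure (dom Z) = UNIV"
    and t_pos: "t > 0"
    and F_ops: "s \<ge> 0 \<Longrightarrow> F s \<in> bounded_ops smul"
    and F_0: "F 0 = id_blinfun"
    and M_ge: "M \<ge> 1" and a_nonneg: "a \<ge> 0"
    and F_pow: "s \<ge> 0 \<Longrightarrow> norm (blinfun_pow (F s) m) \<le> M * exp (a * s) ^ m"
    and F_deriv: "Z f = Some y \<Longrightarrow> ((\<lambda>s. (1 / s) *\<^sub>R (F s f - f)) \<longlongrightarrow> y) (at_right 0)"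
begin

declare of_nat_Suc [simp del]

text \<open>The constant comes from \<open>exp x \<le> 1 + x * exp x\<close> for \<open>x = a * t / Suc n \<le> a * t\<close>.\<close>

sublocale power_bounded "\<lambda>n. F (t / real (Suc n))" "\<lambda>n. t / real (Suc n)" M "a * exp (a * t)"
proof
  show "0 < t / real (Suc n)" for n using t_pos by simp
  show "(\<lambda>n. t / real (Suc n)) \<longlonglongrightarrow> 0"
    using tendsto_mult[OF tendsto_const[of t] LIMSEQ_inverse_real_of_nat] by (simp add: divide_inverse)
  show "0 \<le> a * exp (a * t)" using a_nonneg by simp
  fix n k
  let ?h = "t / real (Suc n)"
  have h: "0 \<le> ?h" "?h \<le> t" using t_pos by (auto simp: divide_le_eq)
  have "exp (a * ?h) * (1 - a * ?h) \<le> exp (a * ?h) * exp (- (a * ?h))"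
    using exp_ge_add_one_self[of "- (a * ?h)"] by (intro mult_left_mono) auto
  then have "exp (a * ?h) \<le> 1 + a * ?h * exp (a * ?h)" by (simp add: exp_add[symmetric] algebra_simps)
  also have "\<dots> \<le> 1 + a * ?h * exp (a * t)"
    using h a_nonneg mult_left_mono[OF h(2) a_nonneg]
    by (intro add_left_mono mult_left_mono) (simp_all)
  finally have "exp (a * ?h) \<le> 1 + a * exp (a * t) * ?h" by (simp add: mult_ac)
  then have "exp (a * ?h) ^ k \<le> (1 + a * exp (a * t) * ?h) ^ k" by (intro power_mono) auto
  then show "norm (blinfun_pow (F ?h) k) \<le> M * (1 + a * exp (a * t) * ?h) ^ k"
    using F_pow[OF h(1), of k] M_ge by (meson mult_left_mono order_trans zero_le_one)
qed

lemma steps_at_right: "filterlim (\<lambda>n. t / real (Suc n)) (at_right 0) sequentially"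
  using h_tendsto h_pos by (simp add: tendsto_imp_filterlim_at_right)

lemma A_Z_tendsto: "Z f = Some y \<Longrightarrow> (\<lambda>n. A n f) \<longlonglongrightarrow> y"
  using filterlim_compose[OF F_deriv steps_at_right]
  by (simp add: A_def blinfun.scaleR_left blinfun.diff_left)

lemma Z_0: "Z 0 = Some 0"
proof -
  obtain u where u: "Z 0 = Some u" using Z_linear by (auto simp: linear_operator_def)
  have "(\<lambda>n. A n 0) \<longlonglongrightarrow> u" by (rule A_Z_tendsto[OF u])
  then show ?thesis using u LIMSEQ_unique tendsto_const by (simp add: blinfun.zero_right) blast
qed

lemma Z_add: "Z f = Some u \<Longrightarrow> Z g = Some v \<Longrightarrow> Z (f + g) = Some (u + v)"
  and Z_smul: "Z f = Some u \<Longrightarrow> Z (smul c f) = Some (smul c u)"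
  using Z_linear by (auto simp: linear_operator_def)

lemma smul_scaleR: "smul c (r *\<^sub>R x) = r *\<^sub>R smul c x"
  by (metis scale_left_commute smul_of_real)

lemma dom_subspace: "subspace (dom Z)"
  by (rule subspaceI) (auto intro: Z_0 Z_add Z_smul)

lemma range_subspace: "subspace {l *\<^sub>R f - y |f y. Z f = Some y}"
proof (rule subspaceI)
  show "0 \<in> {l *\<^sub>R f - y |f y. Z f = Some y}"
    using Z_0 by (intro CollectI exI[of _ 0]) simp
next
  fix x x' assume "x \<in> {l *\<^sub>R f - y |f y. Z f = Some y}" "x' \<in> {l *\<^sub>R f - y |f y. Z f = Some y}"
  then obtain f y f' y' where f: "Z f = Some y" "Z f' = Some y'" "x = l *\<^sub>R f - y" "x' = l *\<^sub>R f' - y'" by blast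
  then have "x + x' = l *\<^sub>R (f + f') - (y + y')" by (simp add: scaleR_right_distrib)
  then show "x + x' \<in> {l *\<^sub>R f - y |f y. Z f = Some y}" using Z_add[OF f(1,2)] by blast
next
  fix c x assume "x \<in> {l *\<^sub>R f - y |f y. Z f = Some y}"
  then obtain f y where f: "Z f = Some y" "x = l *\<^sub>R f - y" by blast
  then have "smul c x = l *\<^sub>R smul c f - smul c y" by (simp add: scale_right_diff_distrib smul_scaleR)
  then show "smul c x \<in> {l *\<^sub>R f - y |f y. Z f = Some y}" using Z_smul[OF f(1)] by blast
qed

lemma F_smul: "s \<ge> 0 \<Longrightarrow> F s (smul c x) = smul c (F s x)"
  using F_ops by (auto simp: bounded_ops_def)

lemma P_smul: "P n k (smul c x) = smul c (P n k x)"
  using t_pos by (induction k) (simp_all add: blinfun_pow_Suc F_smul)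

lemma smul_tendsto: "(u \<longlongrightarrow> x) \<FF> \<Longrightarrow> ((\<lambda>n. smul c (u n)) \<longlongrightarrow> smul c x) \<FF>"
proof -
  assume u: "(u \<longlongrightarrow> x) \<FF>"
  have "bounded_linear (smul c)"
    by (rule bounded_linear_intro[where K = "norm c"])
      (auto simp: scale_right_distrib smul_scaleR norm_smul mult.commute)
  from bounded_linear.tendsto[OF this u] show ?thesis .
qed

section \<open>Generation from dense ranges, and approximants from a generator\<close>

lemma chernoff_coreI:
  assumes w: "a * exp (a * t) \<le> w"
    and dense: "\<And>l. l > w \<Longrightarrow> closure {l *\<^sub>R f - y |f y. Z f = Some y} = UNIV"
  shows "chernoff_core (\<lambda>n. F (t / real (Suc n))) (\<lambda>n. t / real (Suc n)) M (a * exp (a * t)) (Map.graph Z) w"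
proof unfold_locales
  have D: "Domain (Map.graph Z) = dom Z" by (auto simp: Map.graph_def dom_def)
  show "closure (Domain (Map.graph Z)) = UNIV" by (simp add: D Z_dense)
  show "(\<lambda>n. A n f) \<longlonglongrightarrow> y" if "(f, y) \<in> Map.graph Z" for f y
    using that A_Z_tendsto by (simp add: Map.graph_def)
  show "closure ((\<lambda>(f, y). l *\<^sub>R f - y) ` Map.graph Z) = UNIV" if "l > w" for l
  proof -
    have "(\<lambda>(f, y). l *\<^sub>R f - y) ` Map.graph Z = {l *\<^sub>R f - y |f y. Z f = Some y}"
      by (auto simp: Map.graph_def image_iff)
    then show ?thesis using dense[OF that] by simp
  qed
qed (rule w)

text \<open>Closability comes with the construction: \<open>T_deriv_iff\<close> identifies the
  closure of the graph with a set of limits, and limits are unique.\<close>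

lemma generator_if_range_dense:
  assumes w: "a * exp (a * t) \<le> w"
    and dense: "\<And>l. l > w \<Longrightarrow> closure {l *\<^sub>R f - y |f y. Z f = Some y} = UNIV"
  shows "closable Z" "is_generator smul (closure_op Z)"
proof -
  interpret chernoff_core "\<lambda>n. F (t / real (Suc n))" "\<lambda>n. t / real (Suc n)" M "a * exp (a * t)"
    "Map.graph Z" w
    by (rule chernoff_coreI[OF w dense])
  show cl: "closable Z"
    unfolding closable_def
    using T_deriv_iff tendsto_unique[OF trivial_limit_at_right_real] by (blast intro: single_valuedI)
  have "C0_semigroup smul T"
    unfolding C0_semigroup_def
  proof (intro conjI allI impI)
    show "T s \<in> bounded_ops smul" if "s \<ge> 0" for s
      unfolding bounded_ops_def
    proof (intro CollectI allI)
      fix c x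
      show "T s (smul c x) = smul c (T s x)"
        by (rule LIMSEQ_unique[OF P_floor_tendsto[OF that]])
          (unfold P_smul, rule smul_tendsto[OF P_floor_tendsto[OF that]])
    qed
  qed (use T_0 T_add T_continuous in auto)
  moreover have "closure_op Z = strong_deriv0 UNIV T"
  proof
    fix f
    have "closure_op Z f = Some y \<longleftrightarrow> strong_deriv0 UNIV T f = Some y" for y
      by (simp add: closure_op_eq_Some[OF cl] strong_deriv0_eq_Some T_0 T_deriv_iff)
    then show "closure_op Z f = strong_deriv0 UNIV T f" by (metis not_None_eq)
  qed
  ultimately show "is_generator smul (closure_op Z)" unfolding is_generator_def by blast
qed

text \<open>The given semigroup \<open>U\<close> supplies the dense ranges. The approximants come
  from the semigroup \<open>T\<close> built from the powers of \<open>F\<close>, which maps the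
  closure of the graph into itself: they are first components of graph points that tend to the orbit
  point. The rounded number of steps reaches time \<open>t * s\<close>.\<close>

lemma approximants_if_generator:
  assumes cl: "closable Z" and gen: "is_generator smul (closure_op Z)"
    and f: "f \<in> dom Z" and s: "s \<ge> 0"
  obtains x y z where "\<And>n. Z (x n) = Some (y n)" "x \<longlonglongrightarrow> z" "convergent y"
    "(\<lambda>n. P n (nat \<lfloor>real (Suc n) * s\<rfloor>) f) \<longlonglongrightarrow> z"
proof -
  obtain U where U: "C0_semigroup smul U" "closure_op Z = strong_deriv0 UNIV U"
    using gen by (auto simp: is_generator_def)
  have U0: "U 0 = id_blinfun" and U_add: "\<And>s r. s \<ge> 0 \<Longrightarrow> r \<ge> 0 \<Longrightarrow> U (s + r) = U s o\<^sub>L U r"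
    and U_cont: "\<And>f. continuous_on {0..} (\<lambda>s. U s f)"
    using U(1) by (auto simp: C0_semigroup_def)
  define w where "w = max (a * exp (a * t)) (norm (U 1))"
  have dense: "closure {l *\<^sub>R f - y |f y. Z f = Some y} = UNIV" if l: "l > w" for l
  proof -
    have "{l *\<^sub>R w - v |w v. ((\<lambda>r. (1 / r) *\<^sub>R (U r w - w)) \<longlongrightarrow> v) (at_right 0)}
        \<subseteq> (\<lambda>(f, y). l *\<^sub>R f - y) ` closure (Map.graph Z)"
    proof safe
      fix x v assume "((\<lambda>r. (1 / r) *\<^sub>R (U r x - x)) \<longlongrightarrow> v) (at_right 0)"
      then have "closure_op Z x = Some v" by (simp add: U(2) strong_deriv0_eq_Some U0)
      then have "(x, v) \<in> closure (Map.graph Z)" by (simp add: closure_op_eq_Some[OF cl])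
      then show "l *\<^sub>R x - v \<in> (\<lambda>(f, y). l *\<^sub>R f - y) ` closure (Map.graph Z)" by force
    qed
    also have "\<dots> \<subseteq> closure ((\<lambda>(f, y). l *\<^sub>R f - y) ` Map.graph Z)"
      by (rule image_closure_subset)
        (auto simp: case_prod_unfold intro!: continuous_intros closure_subset[THEN subsetD])
    also have "(\<lambda>(f, y). l *\<^sub>R f - y) ` Map.graph Z = {l *\<^sub>R f - y |f y. Z f = Some y}"
      by (auto simp: Map.graph_def image_iff)
    finally have "closure {l *\<^sub>R w - v |w v. ((\<lambda>r. (1 / r) *\<^sub>R (U r w - w)) \<longlongrightarrow> v) (at_right 0)}
        \<subseteq> closure {l *\<^sub>R f - y |f y. Z f = Some y}" by (rule closure_minimal) simp
    moreover have "l > norm (U 1)" using l by (simp add: w_def)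
    ultimately show ?thesis using generator_range_dense[of U l] U0 U_add U_cont by auto
  qed
  interpret chernoff_core "\<lambda>n. F (t / real (Suc n))" "\<lambda>n. t / real (Suc n)" M "a * exp (a * t)"
    "Map.graph Z" w
    by (rule chernoff_coreI[OF _ dense]) (simp_all add: w_def)
  obtain y0 where "(f, y0) \<in> Map.graph Z" using f by (auto simp: Map.graph_def)
  then have "(f, y0) \<in> closure (Map.graph Z)" using closure_subset by blast
  then have "(T (t * s) f, T (t * s) y0) \<in> closure (Map.graph Z)"
    using t_pos s by (intro closure_Zg_T) auto
  then obtain p where p: "\<And>n. p n \<in> Map.graph Z" "p \<longlonglongrightarrow> (T (t * s) f, T (t * s) y0)"
    by (auto simp: closure_sequential)
  show thesis
  proof (rule that[of "fst \<circ> p" "snd \<circ> p" "T (t * s) f"])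
    show "Z ((fst \<circ> p) n) = Some ((snd \<circ> p) n)" for n
      using p(1)[of n] by (auto simp: Map.graph_def)
    show "(fst \<circ> p) \<longlonglongrightarrow> T (t * s) f" using tendsto_fst[OF p(2)] by (simp add: o_def)
    show "convergent (snd \<circ> p)" using tendsto_snd[OF p(2)] by (auto simp: o_def convergent_def)
    have "t * s / (t / real (Suc n)) = real (Suc n) * s" for n using t_pos by simp
    then show "(\<lambda>n. P n (nat \<lfloor>real (Suc n) * s\<rfloor>) f) \<longlonglongrightarrow> T (t * s) f"
      using P_floor_tendsto[of "t * s" f] t_pos s by (simp add: mult.commute[of s])
  qed
qed

section \<open>Annihilators of the range\<close>

lemma weak_compact_P:
  assumes B: "closure B = UNIV" and C: "\<And>n. norm (P n (k n)) \<le> C"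
    and approx: "\<And>f. f \<in> B \<Longrightarrow> \<exists>v. (\<lambda>n. norm (P n (k n) f - v n)) \<longlonglongrightarrow> 0 \<and>
      every_subseq_has_weakly_convergent_subseq smul v"
  shows "every_subseq_has_weakly_convergent_subseq smul (\<lambda>n. P n (k n) g)"
proof (rule weak_compact_if_approximable)
  fix e :: real assume e: "e > 0"
  have C0: "C \<ge> 0" using order_trans[OF norm_ge_zero C] .
  \<comment> \<open>Compactness is available for orbits started in \<open>B\<close>; a general
    \<open>g\<close> is reached by density and the uniform bound on the powers.\<close>
  obtain f where f: "f \<in> B" "norm (g - f) < e / 2 / (C + 1)"
    using closure_UNIV_approx[OF B, of "e / 2 / (C + 1)" g] e C0 by auto
  obtain v where v: "(\<lambda>n. norm (P n (k n) f - v n)) \<longlonglongrightarrow> 0" "every_subseq_has_weakly_convergent_subseq smul v"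
    using approx[OF f(1)] by blast
  have gf: "(C + 1) * norm (g - f) < e / 2" using f(2) C0 by (simp add: field_simps)
  have "\<forall>\<^sub>F n in sequentially. norm (P n (k n) f - v n) < e / 2"
    by (rule order_tendstoD(2)[OF v(1)]) (use e in simp)
  then have "\<forall>\<^sub>F n in sequentially. norm (P n (k n) g - v n) \<le> e"
  proof eventually_elim
    case (elim n)
    have "norm (P n (k n) (g - f)) \<le> (C + 1) * norm (g - f)"
      using norm_blinfun_le[OF C, of n "g - f"] norm_ge_zero[of "g - f"] unfolding distrib_right by linarith
    moreover have "norm (P n (k n) g - v n) \<le> norm (P n (k n) (g - f)) + norm (P n (k n) f - v n)"
      using norm_triangle_ineq[of "P n (k n) (g - f)" "P n (k n) f - v n"] by (simp add: blinfun.diff_right)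
    ultimately show ?case using elim gf by linarith
  qed
  then show "\<exists>v. every_subseq_has_weakly_convergent_subseq smul v \<and>
      (\<forall>\<^sub>F n in sequentially. norm (P n (k n) g - v n) \<le> e)"
    using v(2) by blast
qed

abbreviation D_adj :: "('a \<Rightarrow>\<^sub>L 'k) set" where
  "D_adj \<equiv> dom (strong_deriv0 (dual_space smul) (\<lambda>s. adjoint_op (F s)))"

text \<open>\<open>L\<close> is the adjoint of \<open>Z\<close> at \<open>\<phi>\<close>: both sides
  are limits of \<open>\<phi>\<close> at the same difference quotients. The limit defining
  \<open>L\<close> is in norm, so it can be applied along moving vectors.\<close>

lemma D_adj_deriv:
  assumes "\<phi> \<in> D_adj"
  obtains L where "((\<lambda>s. (1 / s) *\<^sub>R ((\<phi> o\<^sub>L F s) - \<phi>)) \<longlongrightarrow> L) (at_right 0)"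
    "\<And>x z. Z x = Some z \<Longrightarrow> blinfun_apply L x = blinfun_apply \<phi> z"
proof -
  have "\<phi> o\<^sub>L F 0 = \<phi>" by (rule blinfun_eqI) (simp add: F_0)
  then obtain L where L: "((\<lambda>s. (1 / s) *\<^sub>R ((\<phi> o\<^sub>L F s) - \<phi>)) \<longlongrightarrow> L) (at_right 0)"
    using assms unfolding strong_deriv0_def Let_def by (auto split: if_splits)
  have "blinfun_apply L x = blinfun_apply \<phi> z" if "Z x = Some z" for x z
  proof (rule tendsto_unique[OF trivial_limit_at_right_real])
    show "((\<lambda>s. blinfun_apply ((1 / s) *\<^sub>R ((\<phi> o\<^sub>L F s) - \<phi>)) x) \<longlongrightarrow> blinfun_apply L x) (at_right 0)"
      by (rule blinfun.tendsto[OF L tendsto_const])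
    show "((\<lambda>s. blinfun_apply ((1 / s) *\<^sub>R ((\<phi> o\<^sub>L F s) - \<phi>)) x) \<longlongrightarrow> blinfun_apply \<phi> z) (at_right 0)"
      using blinfun.tendsto[OF tendsto_const F_deriv[OF that], of \<phi>]
      by (simp add: blinfun.scaleR_left blinfun.scaleR_right blinfun.diff_left blinfun.diff_right)
  qed
  then show thesis using that L by blast
qed

text \<open>\<open>y\<close> is replaced by \<open>A n f\<close>, and \<open>A n\<close> is moved
  past the powers onto \<open>\<phi>\<close>, giving \<open>Q n\<close> at
  \<open>P n (k n) f\<close>. Norm convergence replaces \<open>Q n\<close> by \<open>L\<close>, the
  vector is replaced by \<open>x n\<close>, and \<open>L (x n) = \<phi> (z n)\<close>.\<close>

lemma adjoint_residual_null:
  assumes \<phi>: "\<phi> \<in> D_adj" and f: "Z f = Some y" and C: "\<And>n. norm (P n (k n)) \<le> C"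
    and xz: "\<And>n. Z (x n) = Some (z n)" and null: "(\<lambda>n. P n (k n) f - x n) \<longlonglongrightarrow> 0"
  shows "(\<lambda>n. blinfun_apply \<phi> (P n (k n) y - z n)) \<longlonglongrightarrow> 0"
proof -
  obtain L where L: "((\<lambda>s. (1 / s) *\<^sub>R ((\<phi> o\<^sub>L F s) - \<phi>)) \<longlongrightarrow> L) (at_right 0)"
    "\<And>x z. Z x = Some z \<Longrightarrow> blinfun_apply L x = blinfun_apply \<phi> z"
    using D_adj_deriv[OF \<phi>] by blast
  define Q where "Q = (\<lambda>n. (1 / (t / real (Suc n))) *\<^sub>R ((\<phi> o\<^sub>L F (t / real (Suc n))) - \<phi>))"
  have Q: "Q \<longlonglongrightarrow> L" unfolding Q_def using filterlim_compose[OF L(1) steps_at_right] .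
  have QA: "blinfun_apply (Q n) u = blinfun_apply \<phi> (A n u)" for n u
    by (simp add: Q_def A_def blinfun.scaleR_left blinfun.scaleR_right blinfun.diff_left blinfun.diff_right
       )
  have 1: "(\<lambda>n. blinfun_apply \<phi> (P n (k n) (y - A n f))) \<longlonglongrightarrow> 0"
  proof -
    have "(\<lambda>n. P n (k n) (y - A n f)) \<longlonglongrightarrow> 0"
      by (rule strong_limit_apply[OF C, where x = 0])
        (use tendsto_diff[OF tendsto_const A_Z_tendsto[OF f], of y] in \<open>simp_all add: blinfun.zero_right\<close>)
    from blinfun.tendsto[OF tendsto_const this, of \<phi>] show ?thesis by (simp add: blinfun.zero_right)
  qed
  have 2: "(\<lambda>n. blinfun_apply (Q n - L) (P n (k n) f)) \<longlonglongrightarrow> 0"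
  proof (rule Lim_null_comparison)
    show "\<forall>\<^sub>F n in sequentially. norm (blinfun_apply (Q n - L) (P n (k n) f)) \<le> norm (Q n - L) * (C * norm f)"
      using norm_blinfun_le[OF C, of _ f] norm_blinfun[of "Q _ - L" "P _ (k _) f"]
      by (intro always_eventually allI) (meson mult_left_mono norm_ge_zero norm_blinfun order_trans)
    show "(\<lambda>n. norm (Q n - L) * (C * norm f)) \<longlonglongrightarrow> 0"
      using Q by (intro tendsto_mult_left_zero tendsto_norm_zero) (simp add: LIM_zero_iff)
  qed
  have 3: "(\<lambda>n. blinfun_apply L (P n (k n) f - x n)) \<longlonglongrightarrow> 0"
    using blinfun.tendsto[OF tendsto_const null, of L] by (simp add: blinfun.zero_right)
  have "blinfun_apply \<phi> (P n (k n) y - z n) = blinfun_apply \<phi> (P n (k n) (y - A n f))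
      + blinfun_apply (Q n - L) (P n (k n) f) + blinfun_apply L (P n (k n) f - x n)" for n
    by (simp add: blinfun.diff_left blinfun.diff_right QA P_A L(2)[OF xz])
  then show ?thesis using tendsto_add[OF tendsto_add[OF 1 2] 3] by simp
qed

text \<open>Annihilation reads \<open>\<psi> (z n) = l *\<^sub>R \<psi> (x n)\<close>. The three
  null sequences exchange \<open>A n f\<close> for \<open>y\<close>, the powers at \<open>y\<close>
  for \<open>z n\<close> (here weak compactness is used), and \<open>x n\<close> for the powers at
  \<open>f\<close>.\<close>

lemma annihilator_residual_null:
  assumes D: "weak_star_topology smul closure_of D_adj = dual_space smul"
    and f: "Z f = Some y" and C: "\<And>n. norm (P n (k n)) \<le> C"
    and xz: "\<And>n. Z (x n) = Some (z n)" and null: "(\<lambda>n. P n (k n) f - x n) \<longlonglongrightarrow> 0"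
    and z: "every_subseq_has_weakly_convergent_subseq smul z"
    and Py: "every_subseq_has_weakly_convergent_subseq smul (\<lambda>n. P n (k n) y)"
    and \<psi>: "\<psi> \<in> dual_space smul"
    and ann: "\<And>f y. Z f = Some y \<Longrightarrow> blinfun_apply \<psi> (l *\<^sub>R f - y) = 0"
  shows "(\<lambda>n. blinfun_apply \<psi> (P n (k n) (A n f)) - l *\<^sub>R blinfun_apply \<psi> (P n (k n) f)) \<longlonglongrightarrow> 0"
proof -
  have D_sub: "D_adj \<subseteq> dual_space smul" by (auto simp: strong_deriv0_def Let_def split: if_splits)
  have 1: "(\<lambda>n. blinfun_apply \<psi> (P n (k n) (A n f - y))) \<longlonglongrightarrow> 0"
  proof -
    have "(\<lambda>n. P n (k n) (A n f - y)) \<longlonglongrightarrow> 0"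
      by (rule strong_limit_apply[OF C, where x = 0])
        (use tendsto_diff[OF A_Z_tendsto[OF f] tendsto_const, of y] in \<open>simp_all add: blinfun.zero_right\<close>)
    from blinfun.tendsto[OF tendsto_const this, of \<psi>] show ?thesis by (simp add: blinfun.zero_right)
  qed
  have 2: "(\<lambda>n. blinfun_apply \<psi> (P n (k n) y - z n)) \<longlonglongrightarrow> 0"
    by (rule weak_compact_diff_null[OF D D_sub Py z adjoint_residual_null[OF _ f C xz null] \<psi>])
  have 3: "(\<lambda>n. l *\<^sub>R blinfun_apply \<psi> (P n (k n) f - x n)) \<longlonglongrightarrow> 0"
    using tendsto_scaleR[OF tendsto_const blinfun.tendsto[OF tendsto_const null, of \<psi>], of l]
    by (simp add: blinfun.zero_right)
  have "blinfun_apply \<psi> (P n (k n) (A n f)) - l *\<^sub>R blinfun_apply \<psi> (P n (k n) f)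
    = blinfun_apply \<psi> (P n (k n) (A n f - y)) + blinfun_apply \<psi> (P n (k n) y - z n)
      - l *\<^sub>R blinfun_apply \<psi> (P n (k n) f - x n)" for n
    using ann[OF xz[of n]] by (simp add: blinfun.diff_right blinfun.scaleR_right scaleR_right_diff_distrib)
  then show ?thesis using tendsto_diff[OF tendsto_add[OF 1 2] 3] by simp
qed

text \<open>With p_k the value of \<open>\<psi>\<close> at \<open>P n k f\<close> and e_k the k-th
  residual, (1 + l h) p_k = p_{k+1} - h e_k. Solving for p_0 gives the estimate; the weights of the
  residuals, negative powers of 1 + l h, are bounded by 1.\<close>

lemma discrete_resolvent_estimate:
  fixes \<psi> :: "'a \<Rightarrow>\<^sub>L 'k"
  assumes l: "l \<ge> 0"
  defines "h \<equiv> \<lambda>n. t / real (Suc n)"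
  shows "norm (\<psi> f) \<le> norm (\<psi> (P n K f)) / (1 + l * h n) ^ K
    + h n * (\<Sum>k<K. norm (\<psi> (P n k (A n f)) - l *\<^sub>R \<psi> (P n k f)))"
proof (induction K)
  case (Suc K)
  have h: "h n > 0" using t_pos by (simp add: h_def)
  let ?q = "1 + l * h n" and ?e = "\<psi> (P n K (A n f)) - l *\<^sub>R \<psi> (P n K f)"
  have q: "?q \<ge> 1" using l h by simp
  have "P n (Suc K) f = P n K f + h n *\<^sub>R P n K (A n f)"
    unfolding blinfun_pow_Suc2 by (simp add: V_eq h_def blinfun.add_right blinfun.scaleR_right)
  then have "?q *\<^sub>R \<psi> (P n K f) = \<psi> (P n (Suc K) f) - h n *\<^sub>R ?e"
    by (simp add: blinfun.add_right blinfun.scaleR_right algebra_simps)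
  then have "?q * norm (\<psi> (P n K f)) = norm (\<psi> (P n (Suc K) f) - h n *\<^sub>R ?e)"
    using q by (metis norm_scaleR abs_of_nonneg order_trans zero_le_one)
  also have "\<dots> \<le> norm (\<psi> (P n (Suc K) f)) + h n * norm ?e"
    using norm_triangle_ineq4[of "\<psi> (P n (Suc K) f)" "h n *\<^sub>R ?e"] h by simp
  finally have "norm (\<psi> (P n K f)) \<le> (norm (\<psi> (P n (Suc K) f)) + h n * norm ?e) / ?q"
    using q by (simp add: pos_le_divide_eq mult.commute)
  then have "norm (\<psi> (P n K f)) / ?q ^ K \<le> (norm (\<psi> (P n (Suc K) f)) + h n * norm ?e) / ?q / ?q ^ K"
    using q by (intro divide_right_mono) auto
  also have "\<dots> = norm (\<psi> (P n (Suc K) f)) / ?q ^ Suc K + (h n * norm ?e) / ?q ^ Suc K"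
    by (simp add: add_divide_distrib)
  also have "(h n * norm ?e) / ?q ^ Suc K \<le> (h n * norm ?e) / 1"
    using one_le_power[OF q, of "Suc K"] h by (intro divide_left_mono) (auto simp del: power_Suc)
  finally show ?case using Suc.IH by (simp add: distrib_left)
qed simp

text \<open>Two limits in this order: for fixed \<open>S\<close>, that is up to time
  \<open>t * S\<close>, the residuals average out as \<open>n\<close> grows; letting
  \<open>S\<close> grow then removes the boundary term.\<close>

lemma annihilator_zero:
  fixes \<psi> :: "'a \<Rightarrow>\<^sub>L 'k"
  assumes l: "l > a * exp (a * t)" and f: "Z f = Some y"
    and null: "\<And>s. s \<ge> 0 \<Longrightarrow> (\<lambda>n. \<psi> (P n (nat \<lfloor>real (Suc n) * s\<rfloor>) (A n f))
        - l *\<^sub>R \<psi> (P n (nat \<lfloor>real (Suc n) * s\<rfloor>) f)) \<longlonglongrightarrow> 0"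
  shows "\<psi> f = 0"
proof -
  define h where "h = (\<lambda>n. t / real (Suc n))"
  define b where "b = a * exp (a * t)"
  have b: "0 \<le> b" "b < l" using b_nonneg l by (simp_all add: b_def)
  have l0: "l \<ge> 0" using b by simp
  have h: "h n > 0" "h n \<le> t" for n using t_pos by (auto simp: h_def divide_le_eq)
  \<comment> \<open>Since \<open>h n \<le> t\<close>, one step contracts by at least the factor 1 -
    c / (n + 1), so \<open>Suc n\<close> steps contract by \<open>exp (- c)\<close> uniformly in
    \<open>n\<close>.\<close>
  define c where "c = (l - b) * t / (1 + l * t)"
  have lt: "1 + l * t > 0" using l0 t_pos by (simp add: add_pos_nonneg)
  have c: "c > 0" using b t_pos lt by (simp add: c_def)
  have decay: "((1 + b * h n) / (1 + l * h n)) ^ (Suc n * S) \<le> exp (- c) ^ S" for n S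
  proof -
    have q: "1 + l * h n > 0" using l0 h[of n] by (simp add: add_pos_nonneg)
    have "c / real (Suc n) = (l - b) * h n / (1 + l * t)" by (simp add: c_def h_def)
    also have "\<dots> \<le> (l - b) * h n / (1 + l * h n)"
      using b h[of n] q l0 lt by (intro divide_left_mono) (auto intro: mult_left_mono)
    finally have 1: "c / real (Suc n) \<le> (l - b) * h n / (1 + l * h n)" .
    have "(1 + b * h n) / (1 + l * h n) = 1 - (l - b) * h n / (1 + l * h n)"
      using q by (simp add: field_simps)
    also have "\<dots> \<le> 1 + - (c / real (Suc n))" using 1 by simp
    also have "\<dots> \<le> exp (- (c / real (Suc n)))" by (rule exp_ge_add_one_self)
    finally have "((1 + b * h n) / (1 + l * h n)) ^ Suc n \<le> exp (- (c / real (Suc n))) ^ Suc n"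
      using b h[of n] q by (intro power_mono) auto
    also have "\<dots> = exp (- c)" by (simp add: exp_of_nat_mult[symmetric] del: power_Suc)
    finally show ?thesis
      using b h[of n] q unfolding power_mult by (intro power_mono) auto
  qed
  obtain CA where CA: "\<And>n. norm (A n f) \<le> CA"
    using BseqE[OF convergent_imp_Bseq[OF convergentI[OF A_Z_tendsto[OF f]]]] by blast
  let ?e = "\<lambda>n k. norm (\<psi> (P n k (A n f)) - l *\<^sub>R \<psi> (P n k f))"
  have est: "norm (\<psi> f) \<le> norm \<psi> * M * norm f * exp (- c) ^ S" for S
  proof -
    define C where "C = norm \<psi> * (M * exp (b * (t * S)) * CA) + l * (norm \<psi> * (M * exp (b * (t * S)) * norm f))"
    have sum_null: "(\<lambda>n. (\<Sum>k<Suc n * S. ?e n k) / real (Suc n)) \<longlonglongrightarrow> 0"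
    proof (rule step_function_average_null)
      fix n k assume k: "k \<le> Suc n * S"
      have "real k * h n \<le> real (Suc n * S) * h n" using k h[of n] by (intro mult_right_mono of_nat_mono) auto
      also have "\<dots> = t * S" by (simp add: h_def del: mult_Suc)
      finally have P: "norm (P n k) \<le> M * exp (b * (t * S))" unfolding h_def b_def by (rule P_bound)
      have bound: "norm (\<psi> (P n k u)) \<le> norm \<psi> * (M * exp (b * (t * S)) * norm u)" for u
        using norm_blinfun[of \<psi> "P n k u"] mult_left_mono[OF norm_blinfun_le[OF P, of u] norm_ge_zero[of \<psi>]]
        by linarith
      have "?e n k \<le> norm (\<psi> (P n k (A n f))) + l * norm (\<psi> (P n k f))"
        using norm_triangle_ineq4[of "\<psi> (P n k (A n f))" "l *\<^sub>R \<psi> (P n k f)"] l0 by simp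
      also have "\<dots> \<le> norm \<psi> * (M * exp (b * (t * S)) * norm (A n f)) + l * (norm \<psi> * (M * exp (b * (t * S)) * norm f))"
        using l0 by (intro add_mono mult_left_mono bound) auto
      also have "\<dots> \<le> C" unfolding C_def using M_ge l0 by (intro add_mono mult_left_mono CA) auto
      finally show "\<bar>?e n k\<bar> \<le> C" by simp
    next
      fix s :: real assume "s \<ge> 0"
      from tendsto_norm_zero[OF null[OF this]] show "(\<lambda>n. ?e n (nat \<lfloor>real (Suc n) * s\<rfloor>)) \<longlonglongrightarrow> 0" .
    qed
    have "norm (\<psi> f) \<le> norm \<psi> * M * norm f * exp (- c) ^ S + t * ((\<Sum>k<Suc n * S. ?e n k) / real (Suc n))" for n
    proof -
      let ?K = "Suc n * S"
      have q: "1 + l * h n > 0" using l0 h[of n] by (simp add: add_pos_nonneg)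
      have "norm (\<psi> (P n ?K f)) \<le> norm \<psi> * (M * (1 + b * h n) ^ ?K * norm f)"
        using norm_blinfun[of \<psi> "P n ?K f"]
          mult_left_mono[OF norm_blinfun_le[OF pow_bound[of n ?K], of f] norm_ge_zero[of \<psi>]]
        unfolding h_def b_def by linarith
      then have "norm (\<psi> (P n ?K f)) / (1 + l * h n) ^ ?K \<le> norm \<psi> * (M * (1 + b * h n) ^ ?K * norm f) / (1 + l * h n) ^ ?K"
        using q by (intro divide_right_mono) auto
      also have "\<dots> = norm \<psi> * M * norm f * ((1 + b * h n) / (1 + l * h n)) ^ ?K"
        by (simp add: power_divide del: mult_Suc)
      also have "\<dots> \<le> norm \<psi> * M * norm f * exp (- c) ^ S"
        using M_ge by (intro mult_left_mono decay) auto
      finally show ?thesis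
        using discrete_resolvent_estimate[OF l0, of \<psi> f n ?K] unfolding h_def
        by (simp only: times_divide_eq_left times_divide_eq_right)
    qed
    moreover have "(\<lambda>n. norm \<psi> * M * norm f * exp (- c) ^ S + t * ((\<Sum>k<Suc n * S. ?e n k) / real (Suc n)))
        \<longlonglongrightarrow> norm \<psi> * M * norm f * exp (- c) ^ S + t * 0"
      by (intro tendsto_intros sum_null)
    ultimately have "norm (\<psi> f) \<le> norm \<psi> * M * norm f * exp (- c) ^ S + t * 0"
      by (intro LIMSEQ_le_const) auto
    then show ?thesis by simp
  qed
  have "(\<lambda>S. norm \<psi> * M * norm f * exp (- c) ^ S) \<longlonglongrightarrow> 0"
    using c by (intro tendsto_mult_right_zero LIMSEQ_realpow_zero) auto
  then have "norm (\<psi> f) \<le> 0" by (rule LIMSEQ_le_const) (use est in auto)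
  then show ?thesis by simp
qed

lemma range_dense_if_approximants:
  assumes D: "weak_star_topology smul closure_of D_adj = dual_space smul"
    and B: "B \<subseteq> dom Z" "closure B = UNIV"
    and approx: "\<And>f s. f \<in> B \<Longrightarrow> s \<ge> 0 \<Longrightarrow> \<exists>x z. (\<forall>n. Z (x n) = Some (z n)) \<and>
      (\<lambda>n. norm (P n (nat \<lfloor>real (Suc n) * s\<rfloor>) f - x n)) \<longlonglongrightarrow> 0 \<and>
      every_subseq_has_weakly_convergent_subseq smul z \<and>
      every_subseq_has_weakly_convergent_subseq smul x"
    and l: "l > a * exp (a * t)"
  shows "closure {l *\<^sub>R f - y |f y. Z f = Some y} = UNIV"
proof (rule subspace_dense_if_annihilator_trivial[OF range_subspace])
  fix \<psi> :: "'a \<Rightarrow>\<^sub>L 'k"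
  assume \<psi>: "\<psi> \<in> dual_space smul"
    and "\<And>y. y \<in> {l *\<^sub>R f - y |f y. Z f = Some y} \<Longrightarrow> blinfun_apply \<psi> y = 0"
  then have ann: "\<And>f y. Z f = Some y \<Longrightarrow> blinfun_apply \<psi> (l *\<^sub>R f - y) = 0" by blast
  have zero: "blinfun_apply \<psi> f = 0" if f: "f \<in> B" for f
  proof -
    obtain y where y: "Z f = Some y" using B(1) f by blast
    show ?thesis
    proof (rule annihilator_zero[OF l y])
      fix s :: real assume s: "s \<ge> 0"
      let ?k = "\<lambda>n. nat \<lfloor>real (Suc n) * s\<rfloor>"
      have C: "norm (P n (?k n)) \<le> M * exp (a * exp (a * t) * (t * s))" for n
      proof (rule P_bound)
        have "real (?k n) \<le> real (Suc n) * s" using s by (simp add: of_nat_floor)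
        then have "real (?k n) * (t / real (Suc n)) \<le> real (Suc n) * s * (t / real (Suc n))"
          using t_pos by (intro mult_right_mono) auto
        then show "real (?k n) * (t / real (Suc n)) \<le> t * s" by (simp add: mult.commute)
      qed
      obtain x z where xz: "\<And>n. Z (x n) = Some (z n)" "(\<lambda>n. norm (P n (?k n) f - x n)) \<longlonglongrightarrow> 0"
        "every_subseq_has_weakly_convergent_subseq smul z"
        using approx[OF f s] by blast
      \<comment> \<open>This uses (a) and (c) for all of \<open>B\<close> at the same
        \<open>s\<close>, since \<open>y = Z f\<close> need not belong to \<open>B\<close>.\<close>
      have "every_subseq_has_weakly_convergent_subseq smul (\<lambda>n. P n (?k n) y)"
        by (rule weak_compact_P[OF B(2) C]) (use approx[OF _ s] in blast)
      from annihilator_residual_null[OF D y C xz(1) tendsto_norm_zero_cancel[OF xz(2)] xz(3) this \<psi> ann]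
      show "(\<lambda>n. blinfun_apply \<psi> (P n (?k n) (A n f)) - l *\<^sub>R blinfun_apply \<psi> (P n (?k n) f)) \<longlonglongrightarrow> 0" .
    qed
  qed
  show "\<psi> = 0"
  proof (rule blinfun_eqI)
    fix g
    obtain u where u: "\<And>n. u n \<in> B" "u \<longlonglongrightarrow> g" using B(2) closure_sequential[of g B] by blast
    have "(\<lambda>n. blinfun_apply \<psi> (u n)) \<longlonglongrightarrow> blinfun_apply \<psi> g" by (rule blinfun.tendsto[OF tendsto_const u(2)])
    then have "(\<lambda>n. 0) \<longlonglongrightarrow> blinfun_apply \<psi> g" by (simp add: zero u(1))
    then show "blinfun_apply \<psi> g = blinfun_apply 0 g" using LIMSEQ_unique[OF tendsto_const] by fastforce
  qed
qed

end

text \<open>The sequences start at index 1, so (b) and (c) speak of \<open>fs (Suc n)\<close>, while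
  the value \<open>fs 0\<close> does not influence the limit in (a).\<close>

theorem theorem5p3:
  fixes smul :: "'k::real_or_complex \<Rightarrow> 'a::banach \<Rightarrow> 'a"
    and Z :: "'a \<rightharpoonup> 'a"
    and t :: real
    and F :: "real \<Rightarrow> 'a \<Rightarrow>\<^sub>L 'a"
  assumes "banach_over smul"
    and "linear_operator smul Z"
    and "closure (dom Z) = UNIV"
    and "t > 0"
    and "F \<in> chernoff_functions smul"
    and "dom Z \<subseteq> dom (strong_deriv0 UNIV F)"
    and "\<And>f. f \<in> dom Z \<Longrightarrow> strong_deriv0 UNIV F f = Z f"
    and "weak_star_topology smul closure_of
           dom (strong_deriv0 (dual_space smul) (\<lambda>s. adjoint_op (F s))) = dual_space smul"
  shows "closable Z \<and> is_generator smul (closure_op Z) \<longleftrightarrow>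
    (\<exists>A. module.subspace smul A \<and> A \<subseteq> dom Z \<and> closure A = UNIV \<and>
      (\<forall>f\<in>A. \<forall>s\<ge>0. \<exists>fs :: nat \<Rightarrow> 'a.
         (\<forall>n\<ge>1. fs n \<in> dom Z) \<and>
         (\<lambda>n. norm (blinfun_pow (F (t / real n)) (nat \<lfloor>real n * s\<rfloor>) f - fs n)) \<longlonglongrightarrow> 0 \<and>
         every_subseq_has_weakly_convergent_subseq smul (\<lambda>n. the (Z (fs (Suc n)))) \<and>
         every_subseq_has_weakly_convergent_subseq smul (\<lambda>n. fs (Suc n))))"
proof -
  interpret banach_over smul by (rule assms(1))
  obtain M a' where M: "M \<ge> 1" and bound: "\<And>n m s. n \<ge> 1 \<Longrightarrow> m \<ge> 1 \<Longrightarrow> s \<ge> 0 \<Longrightarrow>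
      norm (blinfun_pow (F (s / real n)) m) \<le> M * exp (a' * real m / real n * s)"
    using assms(5) unfolding chernoff_functions_def by blast
  \<comment> \<open>The discrete estimates use a nonnegative growth rate, so the given one is
    enlarged to its absolute value.\<close>
  define a where "a = \<bar>a'\<bar>"
  have F0: "F 0 = id_blinfun" using assms(5) by (simp add: chernoff_functions_def)
  interpret chernoff_setting smul Z t F M a
  proof
    show "linear_operator smul Z" "closure (dom Z) = UNIV" "t > 0" by (fact assms)+
    show "F s \<in> bounded_ops smul" if "s \<ge> 0" for s using assms(5) that by (simp add: chernoff_functions_def)
    show "M \<ge> 1" "a \<ge> 0" "F 0 = id_blinfun" using M F0 by (auto simp: a_def)
    show "norm (blinfun_pow (F s) m) \<le> M * exp (a * s) ^ m" if s: "s \<ge> 0" for s m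
    \<comment> \<open>The stability hypothesis starts at \<open>m = 1\<close>; the zeroth power is
      the identity, whose norm is at most \<open>1 \<le> M\<close>.\<close>
    proof (cases "m = 0")
      case True
      then show ?thesis using M norm_blinfun_id_le order_trans by simp blast
    next
      case False
      have "norm (blinfun_pow (F s) m) \<le> M * exp (a' * real m * s)" using bound[of 1 m s] False s by simp
      also have "\<dots> \<le> M * exp (real m * (a * s))"
        using M s abs_ge_self[of a'] mult_right_mono[of a' a "real m * s"] by (simp add: a_def mult_ac)
      finally show ?thesis by (simp add: exp_of_nat_mult)
    qed
    show "((\<lambda>s. (1 / s) *\<^sub>R (F s f - f)) \<longlongrightarrow> y) (at_right 0)" if "Z f = Some y" for f y
    proof -
      have "strong_deriv0 UNIV F f = Some y" using assms(7)[of f] that by (simp add: domI)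
      then have "((\<lambda>s. (1 / s) *\<^sub>R (F s f - F 0 f)) \<longlongrightarrow> y) (at_right 0)"
        by (simp only: strong_deriv0_eq_Some)
      then show ?thesis by (simp add: F0)
    qed
  qed
  show ?thesis
  proof
    assume gen: "closable Z \<and> is_generator smul (closure_op Z)"
    have "\<exists>fs. (\<forall>n\<ge>1. fs n \<in> dom Z) \<and>
         (\<lambda>n. norm (blinfun_pow (F (t / real n)) (nat \<lfloor>real n * s\<rfloor>) f - fs n)) \<longlonglongrightarrow> 0 \<and>
         every_subseq_has_weakly_convergent_subseq smul (\<lambda>n. the (Z (fs (Suc n)))) \<and>
         every_subseq_has_weakly_convergent_subseq smul (\<lambda>n. fs (Suc n))"
      if f: "f \<in> dom Z" and s: "s \<ge> 0" for f s
    proof -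
      obtain x y z where xyz: "\<And>n. Z (x n) = Some (y n)" "x \<longlonglongrightarrow> z" "convergent y"
        "(\<lambda>n. P n (nat \<lfloor>real (Suc n) * s\<rfloor>) f) \<longlonglongrightarrow> z"
        using approximants_if_generator[OF _ _ f s] gen by blast
      \<comment> \<open>Undoes the index shift; truncated subtraction gives \<open>fs 0\<close> the
        value \<open>x 0\<close>.\<close>
      define fs where "fs = (\<lambda>n. x (n - 1))"
      have "(\<lambda>n. norm (P n (nat \<lfloor>real (Suc n) * s\<rfloor>) f - x n)) \<longlonglongrightarrow> 0"
        using tendsto_norm_zero[of "\<lambda>n. P n (nat \<lfloor>real (Suc n) * s\<rfloor>) f - x n"] tendsto_diff[OF xyz(4,2)] by simp
      then have "(\<lambda>n. norm (blinfun_pow (F (t / real n)) (nat \<lfloor>real n * s\<rfloor>) f - fs n)) \<longlonglongrightarrow> 0"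
        by (subst filterlim_sequentially_Suc[symmetric]) (simp add: fs_def)
      then show ?thesis
        using xyz(1) weak_compact_if_convergent[OF xyz(3)] weak_compact_if_convergent[OF convergentI[OF xyz(2)]]
        by (intro exI[of _ fs]) (auto simp: fs_def)
    qed
    then show "\<exists>A. subspace A \<and> A \<subseteq> dom Z \<and> closure A = UNIV \<and>
      (\<forall>f\<in>A. \<forall>s\<ge>0. \<exists>fs :: nat \<Rightarrow> 'a.
         (\<forall>n\<ge>1. fs n \<in> dom Z) \<and>
         (\<lambda>n. norm (blinfun_pow (F (t / real n)) (nat \<lfloor>real n * s\<rfloor>) f - fs n)) \<longlonglongrightarrow> 0 \<and>
         every_subseq_has_weakly_convergent_subseq smul (\<lambda>n. the (Z (fs (Suc n)))) \<and>
         every_subseq_has_weakly_convergent_subseq smul (\<lambda>n. fs (Suc n)))"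
      by (intro exI[of _ "dom Z"] conjI ballI allI impI dom_subspace assms(3) order_refl)
  next
    assume "\<exists>A. subspace A \<and> A \<subseteq> dom Z \<and> closure A = UNIV \<and>
      (\<forall>f\<in>A. \<forall>s\<ge>0. \<exists>fs :: nat \<Rightarrow> 'a.
         (\<forall>n\<ge>1. fs n \<in> dom Z) \<and>
         (\<lambda>n. norm (blinfun_pow (F (t / real n)) (nat \<lfloor>real n * s\<rfloor>) f - fs n)) \<longlonglongrightarrow> 0 \<and>
         every_subseq_has_weakly_convergent_subseq smul (\<lambda>n. the (Z (fs (Suc n)))) \<and>
         every_subseq_has_weakly_convergent_subseq smul (\<lambda>n. fs (Suc n)))"
    then obtain B where B: "B \<subseteq> dom Z" "closure B = UNIV"
      and approx: "\<And>f s. f \<in> B \<Longrightarrow> s \<ge> 0 \<Longrightarrow> \<exists>fs :: nat \<Rightarrow> 'a.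
         (\<forall>n\<ge>1. fs n \<in> dom Z) \<and>
         (\<lambda>n. norm (blinfun_pow (F (t / real n)) (nat \<lfloor>real n * s\<rfloor>) f - fs n)) \<longlonglongrightarrow> 0 \<and>
         every_subseq_has_weakly_convergent_subseq smul (\<lambda>n. the (Z (fs (Suc n)))) \<and>
         every_subseq_has_weakly_convergent_subseq smul (\<lambda>n. fs (Suc n))"
      by blast
    have dense: "closure {l *\<^sub>R f - y |f y. Z f = Some y} = UNIV" if "l > a * exp (a * t)" for l
    proof (rule range_dense_if_approximants[OF assms(8) B _ that])
      fix f and s :: real assume "f \<in> B" "s \<ge> 0"
      then obtain fs :: "nat \<Rightarrow> 'a" where fs: "\<And>n. n \<ge> 1 \<Longrightarrow> fs n \<in> dom Z"
         "(\<lambda>n. norm (blinfun_pow (F (t / real n)) (nat \<lfloor>real n * s\<rfloor>) f - fs n)) \<longlonglongrightarrow> 0"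
         "every_subseq_has_weakly_convergent_subseq smul (\<lambda>n. the (Z (fs (Suc n))))"
         "every_subseq_has_weakly_convergent_subseq smul (\<lambda>n. fs (Suc n))"
        using approx by meson
      have "\<forall>n. Z (fs (Suc n)) = Some (the (Z (fs (Suc n))))" using fs(1) by (metis domD le_add1 option.sel plus_1_eq_Suc)
      then show "\<exists>x z. (\<forall>n. Z (x n) = Some (z n)) \<and>
          (\<lambda>n. norm (P n (nat \<lfloor>real (Suc n) * s\<rfloor>) f - x n)) \<longlonglongrightarrow> 0 \<and>
          every_subseq_has_weakly_convergent_subseq smul z \<and>
          every_subseq_has_weakly_convergent_subseq smul x"
        using LIMSEQ_Suc[OF fs(2)] fs(3,4)
        by (intro exI[of _ "\<lambda>n. fs (Suc n)"] exI[of _ "\<lambda>n. the (Z (fs (Suc n)))"]) blast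
    qed
    show "closable Z \<and> is_generator smul (closure_op Z)"
      using generator_if_range_dense[OF order_refl dense] by blast
  qed
qed

end
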